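(* Let $X$ be a finite group heap, $A$ an abelian group (written multiplicatively, with identity $e$), and $\psi\in Z^2_{\rm SD}(X,A)$. Then the $2$-cocycle heap invariant $\Psi_\psi$ is an invariant of oriented framed links, i.e. it takes the same value in $\mathbb{Z}[A\times A]\cong \mathbb{Z}[A]\otimes\mathbb{Z}[A]$ on any two blackboard framed diagrams of the same oriented framed link. Moreover, if $\psi$ is a $2$-coboundary, then the value of the invariant is trivial, i.e. it lies in the subgroup of $\mathbb{Z}[A]\otimes\mathbb{Z}[A]$ spanned by $e\otimes e$. The invariant $\Psi_\psi(K)$ depends only on the cohomology class $[\psi]\in H^2_{\rm SD}(X,A)$.
   Context: A group heap is a group $X$ with the ternary operation $[x,y,z]=xy^{-1}z$. A function $\psi:X^3\to A$ is a $2$-cocycle, $\psi\in Z^2_{\rm SD}(X,A)$, if (in multiplicative notation) for all $x,y,z,u,v\in X$ $$\psi(x,y,z)\,\psi(xu^{-1}v,yu^{-1}v,zu^{-1}v)^{-1}\,\psi(x,u,v)^{-1}\,\psi(xy^{-1}z,u,v)=e.$$ It is a $2$-coboundary if there is $f:X\to A$ with $\psi(x,y,z)=f(x)f(xy^{-1}z)^{-1}$ for all $x,y,z$ (or the inverse of this expression). $H^2_{\rm SD}(X,A)$ is the group of $2$-cocycles modulo $2$-coboundaries. Oriented framed links are represented by oriented link diagrams with the blackboard framing. Two such diagrams represent the same oriented framed link if and only if they are related by planar isotopies, Reidemeister moves of type II and III, and the cancelation move, which inserts or removes two adjacent kinks with crossings of opposite signs on a string. Coloring: thicken a diagram $D$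 in the plane to a ribbon diagram, so that each arc (maximal piece between consecutive under-crossings, or a closed component curve without under-crossings) becomes two parallel boundary strings. A coloring $\mathcal C$ of $D$ by $X$ assigns an element of $X$ to each boundary string of each arc so that at each crossing: if a boundary string of the under-arc colored $x$ passes under the over-arc, meeting first the over-string colored $u$ and then the over-string colored $v$, then it is colored $xu^{-1}v$ on the other side. Weights: every oriented component has a right and a left boundary string (with respect to its orientation), indexed by $\ell=0$ and $\ell=1$ respectively. At a crossing $\tau$ of sign $\epsilon(\tau)=\pm1$, let $u_\tau$ and $v_\tau$ be the colors of the right and left boundary strings of the oriented over-arc, and let $x_\tau^{(\ell)}$ be the color of the $\ell$-th boundary string of the under-arc on the right-hand side of the over-arc (the side from which the orientation normal of the over-arc points away; the other side's color is $x_\tau^{(\ell)}u_\tau^{-1}v_\tau$). The Boltzmann weight is $B_\ell(\mathcal C,\tau)=\psi(x_\tau^{(\ell)},u_\tau,v_\tau)^{\epsilon(\tau)}$. The $2$-cocycle heap invariant is $$\Psi_\psi(D)=\sum_{\mathcal C}\Big(\prod_\tau B_0(\mathcal C,\tau),\ \prod_\tau B_1(\mathcal C,\tau)\Big)\in\mathbb{Z}[A\times A],$$ the sum being over all colorings of $D$ by $X$ and the products over all crossings. *)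

theory Defs
  imports "HOL-Analysis.Analysis" "HOL-Library.Poly_Mapping"
begin

section \<open>Self-distributive cohomology of group heaps\<close>

text \<open>
  Groups are written additively (class \<^class>\<open>group_add\<close> is not commutative): the heap
  operation \<open>x y\<^sup>-\<^sup>1 z\<close> is \<open>x - y + z\<close>, and the identity \<open>e\<close> of the coefficient group is \<open>0\<close>.
\<close>

definition heap :: "'x::group_add \<Rightarrow> 'x \<Rightarrow> 'x \<Rightarrow> 'x" where
  "heap x y z = x - y + z"

definition Z2_SD :: "('x::group_add \<Rightarrow> 'x \<Rightarrow> 'x \<Rightarrow> 'a::ab_group_add) set" where
  "Z2_SD = {\<psi>. \<forall>x y z u v.
     \<psi> x y z - \<psi> (heap x u v) (heap y u v) (heap z u v) - \<psi> x u v + \<psi> (heap x y z) u v = 0}"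

definition B2_SD :: "('x::group_add \<Rightarrow> 'x \<Rightarrow> 'x \<Rightarrow> 'a::ab_group_add) set" where
  "B2_SD = {\<psi>. \<exists>f. \<forall>x y z. \<psi> x y z = f x - f (heap x y z)}"

definition cohomologous ::
  "(('x::group_add \<Rightarrow> 'x \<Rightarrow> 'x \<Rightarrow> 'a::ab_group_add) \<times> ('x \<Rightarrow> 'x \<Rightarrow> 'x \<Rightarrow> 'a)) set" where
  "cohomologous = {(\<phi>, \<psi>). \<phi> \<in> Z2_SD \<and> \<psi> \<in> Z2_SD \<and> (\<lambda>x y z. \<phi> x y z - \<psi> x y z) \<in> B2_SD}"

definition H2_SD :: "('x::group_add \<Rightarrow> 'x \<Rightarrow> 'x \<Rightarrow> 'a::ab_group_add) set set" where
  "H2_SD = Z2_SD // cohomologous"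

text \<open>The class of \<open>\<psi> \<in> Z2_SD\<close> as an element (coset) of \<^const>\<open>H2_SD\<close>.\<close>

definition cohomology_class ::
  "('x::group_add \<Rightarrow> 'x \<Rightarrow> 'x \<Rightarrow> 'a::ab_group_add) \<Rightarrow> ('x \<Rightarrow> 'x \<Rightarrow> 'x \<Rightarrow> 'a) set" where
  "cohomology_class \<psi> = cohomologous `` {\<psi>}"


section \<open>Oriented link diagrams in the plane\<close>

text \<open>
  The components are closed curves in the plane \<open>\<complex>\<close>, indexed by \<open>0, \<dots>, ncomp D - 1\<close> and given as
  1-periodic functions of a real parameter, which also provides the orientation. A pair
  \<open>(i, t)\<close> is a parameter point of the diagram; \<open>(i, t)\<close> and \<open>(i, t + 1)\<close> are the same point of
  the link. The crossing information is the set of those parameter points at which the curve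
  passes under another strand. The framing is the blackboard framing and hence not part of the data.
\<close>

record link_diag =
  ncomp :: nat
  curve :: "nat \<Rightarrow> real \<Rightarrow> complex"
  underpts :: "(nat \<times> real) set"

definition points :: "link_diag \<Rightarrow> (nat \<times> real) set" where
  "points D = {p. fst p < ncomp D}"

definition same_point :: "nat \<times> real \<Rightarrow> nat \<times> real \<Rightarrow> bool" where
  "same_point p q \<longleftrightarrow> fst p = fst q \<and> snd p - snd q \<in> \<int>"

definition pos :: "link_diag \<Rightarrow> nat \<times> real \<Rightarrow> complex" where
  "pos D p = curve D (fst p) (snd p)"

definition velocity :: "link_diag \<Rightarrow> nat \<times> real \<Rightarrow> complex" where
  "velocity D p = vector_derivative (curve D (fst p)) (at (snd p))"

definition plane_det :: "complex \<Rightarrow> complex \<Rightarrow> real" where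
  "plane_det a b = Re a * Im b - Im a * Re b"

text \<open>Crossings are pairs \<open>(p, q)\<close> with \<open>p\<close> the over-point and \<open>q\<close> the under-point,
  the parameters being normalized to \<open>[0, 1)\<close>.\<close>

definition crossings :: "link_diag \<Rightarrow> ((nat \<times> real) \<times> (nat \<times> real)) set" where
  "crossings D = {(p, q). p \<in> points D \<and> q \<in> points D \<and> snd p \<in> {0..<1} \<and> snd q \<in> {0..<1} \<and>
     p \<noteq> q \<and> pos D p = pos D q \<and> q \<in> underpts D}"

definition link_diagram :: "link_diag \<Rightarrow> bool" where
  "link_diagram D \<longleftrightarrow>
     (\<forall>i < ncomp D. curve D i C1_differentiable_on UNIV \<and>
        (\<forall>t. curve D i (t + 1) = curve D i t) \<and> (\<forall>t. velocity D (i, t) \<noteq> 0)) \<and>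
     (\<forall>p \<in> points D. \<forall>q \<in> points D. pos D p = pos D q \<and> \<not> same_point p q \<longrightarrow>
        plane_det (velocity D p) (velocity D q) \<noteq> 0 \<and> (p \<in> underpts D \<longleftrightarrow> q \<notin> underpts D)) \<and>
     (\<forall>p \<in> points D. \<forall>q \<in> points D. \<forall>r \<in> points D. pos D p = pos D q \<and> pos D q = pos D r \<longrightarrow>
        same_point p q \<or> same_point q r \<or> same_point p r) \<and>
     (\<forall>p \<in> underpts D. p \<in> points D \<and>
        (\<exists>q \<in> points D. pos D q = pos D p \<and> \<not> same_point q p)) \<and>
     (\<forall>i t. (i, t + 1) \<in> underpts D \<longleftrightarrow> (i, t) \<in> underpts D) \<and>
     finite (crossings D)"


section \<open>The moves on blackboard framed diagrams\<close>

subsection \<open>Planar isotopy\<close>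

text \<open>
  \<open>H\<close> is an ambient \<open>C\<^sup>1\<close> isotopy of the plane with spatial derivative \<open>H'\<close>. Bijectivity of
  \<open>H t\<close> and of all \<open>H' t z\<close> makes every \<open>H t\<close> a diffeomorphism.
\<close>

definition ambient_isotopy :: "(real \<Rightarrow> complex \<Rightarrow> complex) \<Rightarrow> bool" where
  "ambient_isotopy H \<longleftrightarrow>
     (\<forall>z. H 0 z = z) \<and>
     continuous_on ({0..1} \<times> UNIV) (\<lambda>(t, z). H t z) \<and>
     (\<forall>t \<in> {0..1}. bij (H t)) \<and>
     (\<exists>H' :: real \<Rightarrow> complex \<Rightarrow> complex \<Rightarrow> complex.
        (\<forall>t \<in> {0..1}. \<forall>z. (H t has_derivative H' t z) (at z) \<and> bij (H' t z)) \<and>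
        (\<forall>w. continuous_on ({0..1} \<times> UNIV) (\<lambda>(t, z). H' t z w)))"

text \<open>
  Diagrams are considered up to relabelling of the components (\<open>\<pi>\<close>) and orientation preserving
  reparametrization of the circle (lifted to \<open>\<rho> i\<close>).
\<close>

definition planar_isotopic :: "link_diag \<Rightarrow> link_diag \<Rightarrow> bool" where
  "planar_isotopic D D' \<longleftrightarrow> ncomp D' = ncomp D \<and>
     (\<exists>H \<pi> \<rho>. ambient_isotopy H \<and> bij_betw \<pi> {..<ncomp D} {..<ncomp D} \<and>
        (\<forall>i < ncomp D.
           (\<forall>t. \<exists>d > 0. (\<rho> i has_real_derivative d) (at t)) \<and> (\<forall>t. \<rho> i (t + 1) = \<rho> i t + 1) \<and>
           (\<forall>t. curve D' i t = H 1 (curve D (\<pi> i) (\<rho> i t)) \<and>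
                ((i, t) \<in> underpts D' \<longleftrightarrow> (\<pi> i, \<rho> i t) \<in> underpts D))))"

subsection \<open>Local moves\<close>

text \<open>
  Since planar isotopies are available separately, it suffices to perform the local moves inside
  the fixed square \<open>Q = [-1,1]\<^sup>2\<close>, where the diagram consists of explicitly given strands
  \<open>S k : [-1,1] \<rightarrow> Q\<close> that are replaced by strands \<open>S' k\<close>. The strand number \<open>k < m\<close> occupies
  the parameters \<open>place c a r k t\<close>, \<open>t \<in> [-1,1]\<close>; it is traversed from left to right if
  \<open>r k > 0\<close> and from right to left if \<open>r k < 0\<close>, so all orientations of the strands occur.
\<close>

definition square :: "complex set" where
  "square = {z. \<bar>Re z\<bar> \<le> 1 \<and> \<bar>Im z\<bar> \<le> 1}"

definition place ::
  "(nat \<Rightarrow> nat) \<Rightarrow> (nat \<Rightarrow> real) \<Rightarrow> (nat \<Rightarrow> real) \<Rightarrow> nat \<Rightarrow> real \<Rightarrow> nat \<times> real" where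
  "place c a r k t = (c k, a k + r k * t)"

definition replaces_strands ::
  "link_diag \<Rightarrow> link_diag \<Rightarrow> nat \<Rightarrow> (nat \<Rightarrow> real \<Rightarrow> complex) \<Rightarrow> (nat \<Rightarrow> real \<Rightarrow> complex) \<Rightarrow>
   (nat \<Rightarrow> nat) \<Rightarrow> (nat \<Rightarrow> real) \<Rightarrow> (nat \<Rightarrow> real) \<Rightarrow> bool" where
  "replaces_strands D D' m S S' c a r \<longleftrightarrow> ncomp D' = ncomp D \<and>
     (\<forall>k < m. c k < ncomp D \<and> r k \<noteq> 0) \<and>
     (\<forall>k < m. \<forall>t \<in> {-1..1}. pos D (place c a r k t) = S k t \<and> pos D' (place c a r k t) = S' k t) \<and>
     (\<forall>p \<in> points D. (\<nexists>k t. k < m \<and> t \<in> {-1..1} \<and> same_point p (place c a r k t)) \<longrightarrow>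
        pos D p \<notin> square \<and> pos D' p = pos D p \<and> (p \<in> underpts D' \<longleftrightarrow> p \<in> underpts D))"

text \<open>The strands inside the square lie at different heights: at every crossing of two of them the
  strand of smaller height passes under.\<close>

definition layered ::
  "link_diag \<Rightarrow> nat \<Rightarrow> (nat \<Rightarrow> nat) \<Rightarrow> (nat \<Rightarrow> real) \<Rightarrow> (nat \<Rightarrow> real) \<Rightarrow> (nat \<Rightarrow> nat) \<Rightarrow> bool" where
  "layered D m c a r height \<longleftrightarrow> inj_on height {..<m} \<and>
     (\<forall>k < m. \<forall>l < m. \<forall>s \<in> {-1..1}. \<forall>t \<in> {-1..1}.
        height k < height l \<and> pos D (place c a r k s) = pos D (place c a r l t) \<longrightarrow>
        place c a r k s \<in> underpts D)"

text \<open>\<open>bump\<close> vanishes to first order at \<open>-1\<close> and \<open>1\<close>, so that all replacements below keep the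
  curves continuously differentiable.\<close>

definition bump :: "real \<Rightarrow> real" where
  "bump t = (1 - t\<^sup>2)\<^sup>2"

text \<open>Type II: two parallel horizontal strands are pushed across each other (they then cross at
  the two points where \<open>bump t = 1/2\<close>).\<close>

definition R2_before :: "nat \<Rightarrow> real \<Rightarrow> complex" where
  "R2_before k t = (if k = 0 then Complex t (1/2) else Complex t (-1/2))"

definition R2_after :: "nat \<Rightarrow> real \<Rightarrow> complex" where
  "R2_after k t = (if k = 0 then Complex t (1/2 - bump t) else Complex t (-1/2 + bump t))"

definition Reidemeister_II :: "link_diag \<Rightarrow> link_diag \<Rightarrow> bool" where
  "Reidemeister_II D D' \<longleftrightarrow> (\<exists>c a r height.
     replaces_strands D D' 2 R2_before R2_after c a r \<and> layered D' 2 c a r height)"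

text \<open>Type III: strand 2 is moved from above to below the crossing of the strands 0 and 1. The
  heights are arbitrary, so the moving strand may be the top, middle or bottom one.\<close>

definition R3_before :: "nat \<Rightarrow> real \<Rightarrow> complex" where
  "R3_before k t = (if k = 0 then Complex t (t/2) else if k = 1 then Complex t (-t/2)
     else Complex t (bump t / 2))"

definition R3_after :: "nat \<Rightarrow> real \<Rightarrow> complex" where
  "R3_after k t = (if k = 0 then Complex t (t/2) else if k = 1 then Complex t (-t/2)
     else Complex t (- bump t / 2))"

definition Reidemeister_III :: "link_diag \<Rightarrow> link_diag \<Rightarrow> bool" where
  "Reidemeister_III D D' \<longleftrightarrow> (\<exists>c a r height.
     replaces_strands D D' 3 R3_before R3_after c a r \<and>
     layered D 3 c a r height \<and> layered D' 3 c a r height)"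

text \<open>
  \<open>kink \<sigma>\<close> for \<open>\<sigma> = \<plusminus>1\<close> is a curve from \<open>-1\<close> to \<open>1\<close> with one small loop, above or below the
  axis according to \<open>\<sigma>\<close>; its only double point is attained where \<open>bump t = 1/2\<close>.
  \<open>two_kinks\<close> places two half-size kinks next to each other. Both choices of \<open>\<sigma>\<close> for each of the
  kinks and both choices of over/under with opposite crossing signs are allowed.
\<close>

definition positive_crossing :: "link_diag \<Rightarrow> (nat \<times> real) \<times> (nat \<times> real) \<Rightarrow> bool" where
  "positive_crossing D \<tau> \<longleftrightarrow> plane_det (velocity D (fst \<tau>)) (velocity D (snd \<tau>)) > 0"

definition kink :: "real \<Rightarrow> real \<Rightarrow> complex" where
  "kink \<sigma> t = Complex (t - 2 * t * bump t) (\<sigma> * bump t)"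

definition two_kinks :: "real \<Rightarrow> real \<Rightarrow> real \<Rightarrow> complex" where
  "two_kinks \<sigma> \<sigma>' t =
     (if t \<le> 0 then -1/2 + kink \<sigma> (2 * t + 1) / 2 else 1/2 + kink \<sigma>' (2 * t - 1) / 2)"

definition cancelation_move :: "link_diag \<Rightarrow> link_diag \<Rightarrow> bool" where
  "cancelation_move D D' \<longleftrightarrow> (\<exists>c a r. \<exists>\<sigma> \<in> {-1, 1}. \<exists>\<sigma>' \<in> {-1, 1}.
     replaces_strands D D' 1 (\<lambda>_ t. Complex t 0) (\<lambda>_. two_kinks \<sigma> \<sigma>') c a r \<and>
     (\<forall>\<tau> \<in> crossings D'. \<forall>\<tau>' \<in> crossings D'.
        pos D' (fst \<tau>) \<in> square \<and> pos D' (fst \<tau>') \<in> square \<and> \<tau> \<noteq> \<tau>' \<longrightarrow>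
        (positive_crossing D' \<tau> \<longleftrightarrow> \<not> positive_crossing D' \<tau>')))"

definition framed_move :: "link_diag \<Rightarrow> link_diag \<Rightarrow> bool" where
  "framed_move D D' \<longleftrightarrow> link_diagram D \<and> link_diagram D' \<and>
     (planar_isotopic D D' \<or> Reidemeister_II D D' \<or> Reidemeister_III D D' \<or> cancelation_move D D')"

definition same_framed_link :: "link_diag \<Rightarrow> link_diag \<Rightarrow> bool" where
  "same_framed_link D D' \<longleftrightarrow> link_diagram D \<and> link_diagram D' \<and> equivclp framed_move D D'"


section \<open>Colorings and the heap invariant\<close>

text \<open>
  The arc through a parameter point that is not an under-point: all points of the component that
  can be reached along the curve without meeting an under-point. If the component has no
  under-crossing, this is the whole component.
\<close>

definition arc_of :: "link_diag \<Rightarrow> nat \<times> real \<Rightarrow> (nat \<times> real) set" where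
  "arc_of D p = {(fst p, s) | s. \<exists>k \<in> \<int>. \<forall>r \<in> closed_segment (snd p) (s + k). (fst p, r) \<notin> underpts D}"

definition arcs :: "link_diag \<Rightarrow> (nat \<times> real) set set" where
  "arcs D = arc_of D ` (points D - underpts D)"

definition arc_in :: "link_diag \<Rightarrow> nat \<times> real \<Rightarrow> (nat \<times> real) set" where
  "arc_in D q = (THE \<alpha>. \<alpha> \<in> arcs D \<and> (\<forall>\<^sub>F t in at_left (snd q). (fst q, t) \<in> \<alpha>))"

definition arc_out :: "link_diag \<Rightarrow> nat \<times> real \<Rightarrow> (nat \<times> real) set" where
  "arc_out D q = (THE \<alpha>. \<alpha> \<in> arcs D \<and> (\<forall>\<^sub>F t in at_right (snd q). (fst q, t) \<in> \<alpha>))"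

text \<open>The under-strand runs from the right to the left of the over-strand iff
  \<open>plane_det (over direction) (under direction) > 0\<close>, i.e. iff the crossing is positive.\<close>

definition over_arc :: "link_diag \<Rightarrow> (nat \<times> real) \<times> (nat \<times> real) \<Rightarrow> (nat \<times> real) set" where
  "over_arc D \<tau> = arc_of D (fst \<tau>)"

definition right_arc :: "link_diag \<Rightarrow> (nat \<times> real) \<times> (nat \<times> real) \<Rightarrow> (nat \<times> real) set" where
  "right_arc D \<tau> = (if positive_crossing D \<tau> then arc_in D (snd \<tau>) else arc_out D (snd \<tau>))"

definition left_arc :: "link_diag \<Rightarrow> (nat \<times> real) \<times> (nat \<times> real) \<Rightarrow> (nat \<times> real) set" where
  "left_arc D \<tau> = (if positive_crossing D \<tau> then arc_out D (snd \<tau>) else arc_in D (snd \<tau>))"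

text \<open>
  The boundary strings of the ribbon diagram are the pairs \<open>(\<alpha>, l)\<close> of an arc and \<open>l = 0\<close>
  (right string) or \<open>l = 1\<close> (left string). A string passing under from the right-hand side of the
  over-arc meets its right string first and its left string second. Passing in the opposite
  direction gives the same condition, since \<open>y = x - u + v\<close> is equivalent to \<open>x = y - v + u\<close>.
\<close>

definition colorings :: "link_diag \<Rightarrow> ((nat \<times> real) set \<times> nat \<Rightarrow> 'x::group_add) set" where
  "colorings D = {C \<in> (arcs D \<times> {0, 1}) \<rightarrow>\<^sub>E UNIV.
     \<forall>\<tau> \<in> crossings D. \<forall>l \<in> {0, 1}.
       C (left_arc D \<tau>, l) = heap (C (right_arc D \<tau>, l)) (C (over_arc D \<tau>, 0)) (C (over_arc D \<tau>, 1))}"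

definition boltzmann_weight ::
  "('x::group_add \<Rightarrow> 'x \<Rightarrow> 'x \<Rightarrow> 'a::ab_group_add) \<Rightarrow> link_diag \<Rightarrow> nat \<Rightarrow>
   ((nat \<times> real) set \<times> nat \<Rightarrow> 'x) \<Rightarrow> (nat \<times> real) \<times> (nat \<times> real) \<Rightarrow> 'a" where
  "boltzmann_weight \<psi> D l C \<tau> =
     (let w = \<psi> (C (right_arc D \<tau>, l)) (C (over_arc D \<tau>, 0)) (C (over_arc D \<tau>, 1))
      in if positive_crossing D \<tau> then w else - w)"

text \<open>The group ring of \<open>A \<times> A\<close> over the integers consists of the finitely supported integer
  valued functions on \<open>A \<times> A\<close>; the basis element \<open>(g, h)\<close>, corresponding to \<open>g \<otimes> h\<close>, is
  \<open>Poly_Mapping.single (g, h) 1\<close>.\<close>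

definition heap_invariant ::
  "('x::{group_add,finite} \<Rightarrow> 'x \<Rightarrow> 'x \<Rightarrow> 'a::ab_group_add) \<Rightarrow> link_diag \<Rightarrow> ('a \<times> 'a) \<Rightarrow>\<^sub>0 int" where
  "heap_invariant \<psi> D = (\<Sum>C \<in> colorings D.
     Poly_Mapping.single (\<Sum>\<tau> \<in> crossings D. boltzmann_weight \<psi> D 0 C \<tau>,
                          \<Sum>\<tau> \<in> crossings D. boltzmann_weight \<psi> D 1 C \<tau>) 1)"

end

theory Submission
  imports Defs
begin

text \<open>
  A coloring of the arcs amounts to a locally constant coloring of the parameter points, jumping at
  the under-points. In this form the colorings of two diagrams with the same parametrization can be
  compared directly. A local move changes nothing outside the square, so it suffices that the
  colors at the ends of the strands extend to the inside in both diagrams under the same conditions,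
  in a unique way and with the same total weight. For type II the two crossings have opposite signs
  and cancel. For type III, traversing all strands from left to right reduces all orientations and
  heights to the cocycle condition. That condition with \<open>(y, z) = (u, v)\<close> reads
  \<open>\<psi>(w, v, v - u + v) = \<psi>(w, u, v)\<close>, so the effect of a kink on the colors and its weight depend
  only on the sign of its crossing, and opposite kinks cancel. A planar isotopy preserves the
  signs of the crossings since its Jacobian determinant stays positive. Finally, if \<open>\<psi>\<close> is the
  coboundary of \<open>f\<close>, the weight of a crossing is the drop of \<open>f\<close> along the under-strand, and these
  drops add up to zero around every component.
\<close>

section \<open>Colors of a ribbon\<close>

text \<open>The arcs of two diagrams are different sets without a natural bijection: a move cuts and
  rejoins arcs, possibly connecting distant parts of a component. The parameter points survive a
  local move, which is why they carry the colors; the price is that a point of the link has a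
  parameter only up to integer translation, and that an under-point needs a conventional color.
  Orientations are the second obstacle, as a strand of a move may run in either direction. Reversing
  a passage under a ribbon undoes its color change and negates its weight
  (\<open>pass_weight_inverse\<close>), so a reversed strand changes only the common sign of its own
  contribution. Each move then becomes a statement about finitely many colors, one for each piece of
  a strand between under-crossings. The bijection of colorings is never written down: solutions are
  transferred in both directions, and their uniqueness for given end colors makes the two transfers
  inverse to each other.\<close>

text \<open>A pair is the color of the (right, left) boundary strings. The ribbon \<open>x\<close> passes under the
  ribbon \<open>w\<close>, from right to left if \<open>e\<close> and from left to right otherwise.\<close>

definition slide :: "bool \<Rightarrow> 'x::group_add \<times> 'x \<Rightarrow> 'x \<times> 'x \<Rightarrow> 'x \<times> 'x" where
  "slide e w x = (let d = if e then - fst w + snd w else - snd w + fst w in (fst x + d, snd x + d))"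

definition side :: "nat \<Rightarrow> 'x \<times> 'x \<Rightarrow> 'x" where
  "side l x = (if l = 0 then fst x else snd x)"

text \<open>The weight always reads the color of the under-ribbon on the right-hand side of
  \<open>w\<close>. In a passage from left to right this is the color after the crossing, and the
  crossing counts negatively for that direction of travel.\<close>

definition pass_weight ::
  "('x::group_add \<Rightarrow> 'x \<Rightarrow> 'x \<Rightarrow> 'a::ab_group_add) \<Rightarrow> bool \<Rightarrow> nat \<Rightarrow> 'x \<times> 'x \<Rightarrow> 'x \<times> 'x \<Rightarrow> 'a" where
  "pass_weight \<psi> e l w x =
     (if e then \<psi> (side l x) (fst w) (snd w) else - \<psi> (side l (slide False w x)) (fst w) (snd w))"

lemma fst_slide [simp]: "fst (slide e w x) = fst x + (if e then - fst w + snd w else - snd w + fst w)"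
  by (simp add: slide_def Let_def)

lemma snd_slide [simp]: "snd (slide e w x) = snd x + (if e then - fst w + snd w else - snd w + fst w)"
  by (simp add: slide_def Let_def)

lemma side_slide [simp]:
  "side l (slide e w x) = side l x + (if e then - fst w + snd w else - snd w + fst w)"
  by (simp add: side_def)

lemma slide_inverse [simp]: "slide (\<not> e) w (slide e w x) = x" "slide e w (slide (\<not> e) w x) = x"
  by (auto simp: slide_def Let_def add.assoc prod_eq_iff)

lemma slide_False_True [simp]: "slide False w (slide True w x) = x" "slide True w (slide False w x) = x"
  using slide_inverse[of True w x] by simp_all

lemma pass_weight_inverse: "pass_weight \<psi> (\<not> e) l w (slide e w x) = - pass_weight \<psi> e l w x"
  by (cases e) (simp_all add: pass_weight_def)

text \<open>The cocycle condition without minus signs: each side collects the weights of one order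
  of the crossings in a type III move.\<close>

lemma Z2_SD_D:
  assumes "\<psi> \<in> Z2_SD"
  shows "\<psi> x y z + \<psi> (x - y + z) u v = \<psi> x u v + \<psi> (x - u + v) (y - u + v) (z - u + v)"
proof -
  have "\<psi> x y z - \<psi> (x - u + v) (y - u + v) (z - u + v) - \<psi> x u v + \<psi> (x - y + z) u v = 0"
    using assms by (simp add: Z2_SD_def heap_def)
  then show ?thesis by (simp add: algebra_simps)
qed

lemma Z2_SD_shift:
  assumes "\<psi> \<in> Z2_SD"
  shows "\<psi> w v (v - u + v) = \<psi> w u v"
proof -
  \<comment> \<open>The first argument \<open>w - v + u\<close> is chosen so that passing under
    \<open>(u, v)\<close> leads to \<open>w\<close>; the term \<open>\<psi> (w - v + u) u v\<close>
    then occurs on both sides and cancels.\<close>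
  have "\<psi> (w - v + u) u v + \<psi> (w - v + u - u + v) u v
      = \<psi> (w - v + u) u v + \<psi> (w - v + u - u + v) (u - u + v) (v - u + v)"
    by (rule Z2_SD_D[OF assms])
  then show ?thesis by (simp add: diff_add_eq add.assoc)
qed

section \<open>Self-distributivity and the type III identity for ribbons\<close>

lemmas group_normal = diff_conv_add_uminus add.assoc minus_add

text \<open>Sliding under \<open>w\<close> translates both strings of \<open>m\<close> on the right
  by the same \<open>d\<close>, which conjugates the displacement of \<open>m\<close> by
  \<open>d\<close>; the resulting \<open>- d\<close> cancels the \<open>d\<close> that
  \<open>x\<close> has already acquired.\<close>

lemma slide_distrib:
  "slide f (slide e w m) (slide e w x) = slide e w (slide f m x)"
  by (auto simp: prod_eq_iff group_normal simp del: add_uminus_conv_diff)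

text \<open>On the left the ribbon \<open>x\<close> meets \<open>m\<close> and then
  \<open>w\<close>, on the right it meets \<open>w\<close> and then the continuation of
  \<open>m\<close> beyond \<open>w\<close>. If both passages go from right to left, this is the
  cocycle condition; the other directions are obtained by reading a passage backwards.\<close>

lemma pass_weight_R3:
  assumes "\<psi> \<in> Z2_SD"
  shows "pass_weight \<psi> f l m x + pass_weight \<psi> e l w (slide f m x)
       = pass_weight \<psi> e l w x + pass_weight \<psi> f l (slide e w m) (slide e w x)"
proof -
  obtain u v where w: "w = (u, v)" by force
  note Z = Z2_SD_D[OF assms]
  have base: "pass_weight \<psi> f l m x + pass_weight \<psi> True l w (slide f m x)
       = pass_weight \<psi> True l w x + pass_weight \<psi> f l (slide True w m) (slide True w x)" for m x
  proof -
    obtain y z where m: "m = (y, z)" by force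
    define a where "a = side l x"
    show ?thesis
    proof (cases f)
      case True
      then show ?thesis
        using Z[of a y z u v] unfolding w m pass_weight_def
        by (simp add: a_def group_normal del: add_uminus_conv_diff)
    next
      case False
      \<comment> \<open>For a passage under \<open>m\<close> from left to right the cocycle
        condition is applied at the color \<open>a - z + y\<close> reached behind \<open>m\<close>,
        so the two terms of that passage change sides.\<close>
      have move: "- A + B = C + - D" if "A + C = B + D" for A B C D :: 'b
        using that by (simp add: algebra_simps)
      show ?thesis
        using False move[OF Z[of "a - z + y" y z u v]] unfolding w m pass_weight_def slide_distrib
        by (simp add: a_def group_normal del: add_uminus_conv_diff)
    qed
  qed
  show ?thesis
  proof (cases e)
    case True
    then show ?thesis using base by simp
  next
    case False
    \<comment> \<open>The base case at the colors behind \<open>w\<close>, solved for the passages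
      under \<open>w\<close>, covers the opposite direction.\<close>
    have "pass_weight \<psi> f l (slide False w m) (slide False w x) + pass_weight \<psi> True l w (slide f (slide False w m) (slide False w x))
       = pass_weight \<psi> True l w (slide False w x) + pass_weight \<psi> f l m x"
      using base[of "slide False w m" "slide False w x"] by simp
    then show ?thesis
      using False unfolding slide_distrib by (simp add: pass_weight_def algebra_simps)
  qed
qed

section \<open>Kinks: a ribbon passing under itself\<close>

definition kinked :: "bool \<Rightarrow> 'x::group_add \<times> 'x \<Rightarrow> 'x \<times> 'x" where
  "kinked e x = slide e x x"

text \<open>The displacement of \<open>x\<close> commutes with itself, so the kinked ribbon shifts
  \<open>x\<close> by the same amount as \<open>x\<close> does. Hence the color behind a kink does
  not depend on whether the ribbon first passes over or first passes under at the crossing.\<close>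

lemma slide_kinked [simp]: "slide e (kinked e x) x = kinked e x"
  by (auto simp: kinked_def prod_eq_iff group_normal simp del: add_uminus_conv_diff)

lemma kinked_inverse: "kinked (\<not> e) (kinked e x) = x"
  by (auto simp: kinked_def prod_eq_iff group_normal simp del: add_uminus_conv_diff)

text \<open>If the under-passage comes first, the over-ribbon has the outgoing color
  \<open>z\<close>, which is then given only implicitly. Reading the crossing backwards solves for
  it.\<close>

lemma eq_slide_self:
  assumes "z = slide e z x"
  shows "z = kinked e x"
proof -
  have "x = slide (\<not> e) z z" using assms by (metis slide_inverse(1))
  then show ?thesis by (metis kinked_def kinked_inverse slide_inverse)
qed

lemma pass_weight_kinked:
  assumes "\<psi> \<in> Z2_SD"
  shows "pass_weight \<psi> e l (kinked e x) x = pass_weight \<psi> e l x x"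
proof -
  obtain u v where x: "x = (u, v)" by force
  show ?thesis
    \<comment> \<open>The second instance serves \<open>e = False\<close>, where the kinked color is
      \<open>(u - v + u, u)\<close>; shifting it gives back \<open>(u, v)\<close>.\<close>
    using Z2_SD_shift[OF assms, where u=u and v=v] Z2_SD_shift[OF assms, where u="u - v + u" and v=u]
    by (simp add: x kinked_def pass_weight_def side_slide group_normal
        del: add_uminus_conv_diff)
qed

text \<open>The second kink leads from \<open>kinked e x\<close> back to \<open>x\<close>, so its
  passage is the reverse of a passage of \<open>x\<close> under the kinked color, and
  \<open>pass_weight_kinked\<close> replaces that color by \<open>x\<close>.\<close>

lemma pass_weight_kinks_cancel:
  assumes "\<psi> \<in> Z2_SD"
  shows "pass_weight \<psi> e l x x + pass_weight \<psi> (\<not> e) l (kinked e x) (kinked e x) = 0"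
proof -
  have "pass_weight \<psi> (\<not> e) l (kinked e x) (kinked e x) = - pass_weight \<psi> e l (kinked e x) x"
    using pass_weight_inverse[of \<psi> e l "kinked e x" x] by simp
  then show ?thesis by (simp add: pass_weight_kinked[OF assms])
qed

section \<open>One-sided neighborhoods and piecewise constant functions\<close>

definition at_side :: "bool \<Rightarrow> real \<Rightarrow> real filter" where
  "at_side b t = (if b then at_left t else at_right t)"

lemma at_side_not_bot [simp]: "at_side b t \<noteq> bot"
  by (simp add: at_side_def)

lemma eventually_at_imp_side: "eventually P (at t) \<Longrightarrow> eventually P (at_side b t)"
  by (simp add: at_side_def eventually_at_split)

lemma eventually_at_side_bound: "\<forall>\<^sub>F u in at_side b t. if b then u < t else t < u"
  by (cases b) (simp_all add: at_side_def eventually_at_filter)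

lemma eventually_at_side_interval: "p < t \<Longrightarrow> t < q \<Longrightarrow> \<forall>\<^sub>F u in at_side b t. p < u \<and> u < q"
  using eventually_at_in_open'[of "{p<..<q}" t] by (intro eventually_at_imp_side) simp

lemma eventually_same_on_interval:
  fixes f :: "real \<Rightarrow> 'b"
  assumes "s \<le> t" and f: "\<And>x b. s \<le> x \<Longrightarrow> x \<le> t \<Longrightarrow> \<forall>\<^sub>F u in at_side b x. f u = f x"
  shows "f s = f t"
proof -
  have "s \<le> s \<longrightarrow> t \<le> t \<longrightarrow> f s = f t"
    using \<open>s \<le> t\<close>
  proof (induction rule: Bolzano[where P = "\<lambda>a b. s \<le> a \<longrightarrow> b \<le> t \<longrightarrow> f a = f b"])
    case (local x)
    then have "\<forall>\<^sub>F u in at x. f u = f x"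
      using f[of x True] f[of x False] by (simp add: at_side_def eventually_at_split)
    then obtain d where d: "d > 0" "\<And>u. u \<noteq> x \<Longrightarrow> dist u x < d \<Longrightarrow> f u = f x"
      by (auto simp: eventually_at)
    have *: "f u = f x" if "\<bar>u - x\<bar> < d" for u
      using d(2)[of u] that by (cases "u = x") (auto simp: dist_real_def)
    have "f a = f b" if "a \<le> x \<and> x \<le> b \<and> b - a < d" for a b
    proof -
      have "\<bar>a - x\<bar> < d" "\<bar>b - x\<bar> < d" using that by linarith+
      with * have "f a = f x" "f b = f x" by blast+
      then show ?thesis by simp
    qed
    then show ?case using d(1) by blast
  qed auto
  then show ?thesis by simp
qed

text \<open>A telescoping sum, proved by bisection. The interval is half-open: the jump at
  \<open>a\<close> counts and the one at \<open>b\<close> does not. This is why both boundary terms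
  are left-hand values and why adjoining intervals add up.\<close>

lemma sum_jumps:
  fixes f :: "real \<Rightarrow> 'a::ab_group_add" and J :: "bool \<Rightarrow> real \<Rightarrow> 'a"
  assumes "a \<le> b"
    and J: "\<And>s x. \<forall>\<^sub>F u in at_side s x. f u = J s x"
    and eq: "\<And>x. x \<notin> P \<Longrightarrow> J True x = J False x"
    and fin: "\<And>a b. finite (P \<inter> {a..<b})"
  shows "(\<Sum>x \<in> P \<inter> {a..<b}. J False x - J True x) = J True b - J True a"
  using \<open>a \<le> b\<close>
proof (induction rule: Bolzano)
  case (trans a b c)
  have "P \<inter> {a..<c} = (P \<inter> {a..<b}) \<union> (P \<inter> {b..<c})"
    using trans by auto
  moreover have "(P \<inter> {a..<b}) \<inter> (P \<inter> {b..<c}) = {}" by auto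
  ultimately have "(\<Sum>x \<in> P \<inter> {a..<c}. J False x - J True x)
      = (\<Sum>x \<in> P \<inter> {a..<b}. J False x - J True x) + (\<Sum>x \<in> P \<inter> {b..<c}. J False x - J True x)"
    using fin by (simp add: sum.union_disjoint)
  then show ?case using trans by simp
next
  case (local x)
  obtain l where l: "l < x" "\<And>u. l < u \<Longrightarrow> u < x \<Longrightarrow> f u = J True x"
    using J[of True x] by (auto simp: at_side_def eventually_at_left_field)
  obtain r where r: "x < r" "\<And>u. x < u \<Longrightarrow> u < r \<Longrightarrow> f u = J False x"
    using J[of False x] by (auto simp: at_side_def eventually_at_right_field)
  have const: "J s u = c" if "p < u" "u < q" "\<And>v. p < v \<Longrightarrow> v < q \<Longrightarrow> f v = c" for s u p q c
  proof -
    have "\<forall>\<^sub>F v in at_side s u. J s u = c"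
      using J[of s u] eventually_at_side_interval[OF that(1,2), of s]
      by eventually_elim (use that(3) in auto)
    then show ?thesis by simp
  qed
  have left: "J s u = J True x" if "l < u" "u < x" for s u
    using that l by (intro const[of l _ x]) auto
  have right: "J s u = J False x" if "x < u" "u < r" for s u
    using that r by (intro const[of x _ r]) auto
  show ?case
  proof (intro exI[of _ "min (x - l) (r - x)"] conjI allI impI)
    fix a b
    assume ab: "a \<le> x \<and> x \<le> b \<and> b - a < min (x - l) (r - x)"
    have La: "J True a = J True x" using left[of a] ab by (cases "a = x") auto
    have zero: "J False u - J True u = 0" if "u \<in> {a..<b}" "u \<noteq> x" for u
      using that ab left[of u] right[of u] by (cases "u < x") auto
    show "(\<Sum>u \<in> P \<inter> {a..<b}. J False u - J True u) = J True b - J True a"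
    proof (cases "x = b")
      case True
      then show ?thesis using zero La by simp
    next
      case False
      have "(\<Sum>u \<in> P \<inter> {a..<b}. J False u - J True u) = (\<Sum>u \<in> P \<inter> {x}. J False u - J True u)"
        using ab False by (intro sum.mono_neutral_right fin ballI zero) auto
      also have "\<dots> = J False x - J True x"
        using eq[of x] by (cases "x \<in> P") auto
      also have "J False x = J True b" using right[of b] ab False by auto
      finally show ?thesis using La by simp
    qed
  qed (use l r in auto)
qed

section \<open>Changes of variable in one-sided neighborhoods\<close>

lemma eventually_at_side_strict_mono:
  fixes g :: "real \<Rightarrow> real"
  assumes g: "strict_mono g" "surj g"
  shows "eventually P (at_side b (g t)) \<longleftrightarrow> eventually (\<lambda>s. P (g s)) (at_side b t)"
proof -
  have ev: "eventually P (at_side b t) \<longleftrightarrow>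
      (\<exists>x. (if b then x < t else t < x) \<and> (\<forall>y. (if b then x < y \<and> y < t else t < y \<and> y < x) \<longrightarrow> P y))" for P t
    by (auto simp: at_side_def eventually_at_left_field eventually_at_right_field)
  have less: "g x < g y \<longleftrightarrow> x < y" for x y using g(1) by (rule strict_mono_less)
  define W where "W x \<longleftrightarrow> (if b then x < g t else g t < x) \<and>
    (\<forall>y. (if b then x < y \<and> y < g t else g t < y \<and> y < x) \<longrightarrow> P y)" for x
  have "W (g x) \<longleftrightarrow> (if b then x < t else t < x) \<and>
    (\<forall>y. (if b then x < y \<and> y < t else t < y \<and> y < x) \<longrightarrow> P (g y))" for x
  proof -
    have "(\<forall>y. R y) \<longleftrightarrow> (\<forall>y. R (g y))" for R using g(2) by (metis surj_def)
    from this[of "\<lambda>y. (if b then g x < y \<and> y < g t else g t < y \<and> y < g x) \<longrightarrow> P y"]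
    show ?thesis unfolding W_def by (simp only: less)
  qed
  moreover have "(\<exists>x. W x) \<longleftrightarrow> (\<exists>x. W (g x))" using g(2) by (metis surj_def)
  ultimately show ?thesis unfolding ev W_def[symmetric] by simp
qed

text \<open>A decreasing map exchanges left and right neighborhoods, hence the side
  \<open>b = (r > 0)\<close>.\<close>

lemma eventually_at_side_affine:
  assumes "(r::real) \<noteq> 0"
  shows "eventually P (at_side b (a + r * t)) \<longleftrightarrow> eventually (\<lambda>s. P (a + r * s)) (at_side (b = (r > 0)) t)"
proof -
  have pos: "eventually P (at_side b (a + r * t)) \<longleftrightarrow> eventually (\<lambda>s. P (a + r * s)) (at_side b t)"
    if "r > 0" for r t
  proof (rule eventually_at_side_strict_mono)
    show "strict_mono (\<lambda>s. a + r * s)" using that by (simp add: strict_mono_def)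
    show "surj (\<lambda>s. a + r * s)"
      using that by (intro surjI[of _ "\<lambda>y. (y - a) / r"]) simp
  qed
  have minus: "eventually Q (at_side b (- t)) \<longleftrightarrow> eventually (\<lambda>s. Q (- s)) (at_side (\<not> b) t)" for Q
    by (simp add: at_side_def at_left_minus[of "- t"] at_right_minus[of "- t"] eventually_filtermap)
  show ?thesis
    using pos[of r t] pos[of "- r" "- t"] minus assms by (cases "r > 0") auto
qed

lemma eventually_at_side_shift:
  "eventually P (at_side b (t + n)) \<longleftrightarrow> eventually (\<lambda>s. P (s + n)) (at_side b t)"
  using eventually_at_side_affine[of 1 P b n t] by (simp add: add.commute)

section \<open>Parameter points\<close>

lemma periodic_Ints:
  fixes f :: "real \<Rightarrow> 'b"
  assumes "\<And>t. f (t + 1) = f t" "s - t \<in> \<int>"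
  shows "f s = f t"
proof -
  have nat: "f (t + real n) = f t" for t n
    by (induction n) (auto simp: assms(1) add.assoc[symmetric] add.commute[of 1])
  obtain k where k: "s - t = of_int k" using assms(2) by (auto elim: Ints_cases)
  show ?thesis
  proof (cases "0 \<le> k")
    case True
    then have "s = t + real (nat k)" using k by simp
    then show ?thesis using nat by simp
  next
    case False
    then have "t = s + real (nat (- k))" using k by simp
    then show ?thesis using nat by metis
  qed
qed

lemma same_point_refl [simp]: "same_point p p"
  by (simp add: same_point_def)

lemma same_point_sym: "same_point p q \<Longrightarrow> same_point q p"
  unfolding same_point_def by (metis Ints_minus minus_diff_eq)

lemma same_point_trans: "same_point p q \<Longrightarrow> same_point q r \<Longrightarrow> same_point p r"
  unfolding same_point_def by (metis Ints_add diff_add_cancel add_diff_eq)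

lemma same_point_points: "same_point p q \<Longrightarrow> p \<in> points D \<longleftrightarrow> q \<in> points D"
  by (simp add: same_point_def points_def)

lemma same_point_unit_eq:
  assumes "same_point p q" "snd p \<in> {0..<1}" "snd q \<in> {0..<1}"
  shows "p = q"
proof -
  obtain k where k: "snd p - snd q = of_int k"
    using assms by (auto simp: same_point_def elim: Ints_cases)
  then have "\<bar>real_of_int k\<bar> < 1" using assms by auto
  then have "k = 0" by linarith
  then show ?thesis using k assms by (simp add: same_point_def prod_eq_iff)
qed

definition normal_point :: "nat \<times> real \<Rightarrow> nat \<times> real" where
  "normal_point p = (fst p, frac (snd p))"

lemma snd_normal_point [simp]: "0 \<le> snd (normal_point p)" "snd (normal_point p) < 1"
  by (simp_all add: normal_point_def frac_lt_1)

lemma same_point_normal [simp]: "same_point p (normal_point p)" "same_point (normal_point p) p"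
proof -
  show "same_point p (normal_point p)"
    by (simp add: same_point_def normal_point_def frac_def)
  then show "same_point (normal_point p) p" by (rule same_point_sym)
qed

lemma link_diagram_curve:
  assumes "link_diagram D" "i < ncomp D"
  shows "curve D i (t + 1) = curve D i t"
  using assms by (simp add: link_diagram_def)

lemma has_velocity:
  assumes "link_diagram D" "i < ncomp D"
  shows "(curve D i has_vector_derivative velocity D (i, t)) (at t)"
proof -
  have "curve D i C1_differentiable_on UNIV" using assms by (simp add: link_diagram_def)
  then have "curve D i differentiable at t"
    by (simp add: C1_differentiable_on_eq)
  then show ?thesis by (simp add: velocity_def vector_derivative_works)
qed

lemma pos_same_point:
  assumes "link_diagram D" "p \<in> points D" "same_point p q"
  shows "pos D p = pos D q"
  using assms periodic_Ints[of "curve D (fst p)" "snd p" "snd q"]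
  by (auto simp: pos_def same_point_def points_def link_diagram_curve)

lemma velocity_same_point:
  assumes "link_diagram D" "p \<in> points D" "same_point p q"
  shows "velocity D p = velocity D q"
proof -
  obtain i t where p: "p = (i, t)" by force
  then have i: "i < ncomp D" using assms by (simp add: points_def)
  have "velocity D (i, t + 1) = velocity D (i, t)" for t
  proof -
    have "((curve D i \<circ> (\<lambda>s. s + 1)) has_vector_derivative (1 *\<^sub>R velocity D (i, t + 1))) (at t)"
      by (rule vector_diff_chain_at)
        (auto intro!: derivative_eq_intros has_velocity assms i)
    moreover have "curve D i \<circ> (\<lambda>s. s + 1) = curve D i"
      using link_diagram_curve[OF assms(1) i] by auto
    ultimately show ?thesis
      using has_velocity[OF assms(1) i] by (metis vector_derivative_at scaleR_one)
  qed
  from periodic_Ints[of "\<lambda>t. velocity D (i, t)", OF this] show ?thesis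
    using assms(3) by (cases q) (auto simp: p same_point_def)
qed

lemma underpts_same_point:
  assumes "link_diagram D" "same_point p q"
  shows "p \<in> underpts D \<longleftrightarrow> q \<in> underpts D"
proof -
  have "(fst p, t + 1) \<in> underpts D \<longleftrightarrow> (fst p, t) \<in> underpts D" for t
    using assms unfolding link_diagram_def by blast
  from periodic_Ints[of "\<lambda>t. (fst p, t) \<in> underpts D", OF this] show ?thesis
    using assms(2) by (cases p; cases q) (auto simp: same_point_def)
qed

lemma underpts_points:
  assumes "link_diagram D" "q \<in> underpts D"
  shows "q \<in> points D"
  using assms unfolding link_diagram_def by blast

section \<open>Crossings\<close>

text \<open>Unlike in \<^const>\<open>crossings\<close>, the parameters need not be normalized.\<close>

definition crosses :: "link_diag \<Rightarrow> nat \<times> real \<Rightarrow> nat \<times> real \<Rightarrow> bool" where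
  "crosses D p q \<longleftrightarrow> p \<in> points D \<and> q \<in> underpts D \<and> pos D p = pos D q \<and> \<not> same_point p q"

text \<open>Unique only modulo integer translation, so every later use has to be insensitive to the
  representative.\<close>

definition over_point :: "link_diag \<Rightarrow> nat \<times> real \<Rightarrow> nat \<times> real" where
  "over_point D q = (SOME p. crosses D p q)"

definition unit_underpts :: "link_diag \<Rightarrow> (nat \<times> real) set" where
  "unit_underpts D = {q \<in> underpts D. snd q \<in> {0..<1}}"

lemma crosses_over_point:
  assumes "link_diagram D" "q \<in> underpts D"
  shows "crosses D (over_point D q) q"
proof -
  have "\<exists>p. crosses D p q"
    using assms unfolding link_diagram_def crosses_def by blast
  then show ?thesis unfolding over_point_def by (rule someI_ex)
qed

lemma crosses_not_under:
  assumes "link_diagram D" "crosses D p q"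
  shows "p \<notin> underpts D"
proof -
  have "q \<in> points D" using assms by (auto simp: crosses_def intro: underpts_points)
  then show ?thesis using assms unfolding link_diagram_def crosses_def by blast
qed

lemma crosses_det:
  assumes "link_diagram D" "crosses D p q"
  shows "plane_det (velocity D p) (velocity D q) \<noteq> 0"
proof -
  have "q \<in> points D" using assms by (auto simp: crosses_def intro: underpts_points)
  then show ?thesis using assms unfolding link_diagram_def crosses_def by blast
qed

lemma crosses_unique:
  assumes "link_diagram D" "crosses D p q" "crosses D p' q"
  shows "same_point p p'"
proof -
  have "q \<in> points D" using assms by (auto simp: crosses_def intro: underpts_points)
  moreover have "\<forall>p \<in> points D. \<forall>q \<in> points D. \<forall>r \<in> points D. pos D p = pos D q \<and> pos D q = pos D r \<longrightarrow>
        same_point p q \<or> same_point q r \<or> same_point p r"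
    using assms(1) unfolding link_diagram_def by blast
  ultimately show ?thesis
    using assms unfolding crosses_def by (metis same_point_sym)
qed

lemma crosses_same_point:
  assumes "link_diagram D" "crosses D p q" "same_point p p'" "same_point q q'"
  shows "crosses D p' q'"
proof -
  have "q \<in> points D" using assms by (auto simp: crosses_def intro: underpts_points)
  then show ?thesis
    using assms pos_same_point[of D p p'] pos_same_point[of D q q'] underpts_same_point[of D q q']
      same_point_points[of p p' D]
    unfolding crosses_def by (metis same_point_sym same_point_trans)
qed

lemma positive_crossing_same_point:
  assumes "link_diagram D" "p \<in> points D" "q \<in> points D" "same_point p p'" "same_point q q'"
  shows "positive_crossing D (p, q) = positive_crossing D (p', q')"
  using assms velocity_same_point[of D p p'] velocity_same_point[of D q q']
  by (simp add: positive_crossing_def)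

lemma positive_over_point:
  assumes "link_diagram D" "crosses D p q"
  shows "positive_crossing D (over_point D q, q) = positive_crossing D (p, q)"
proof -
  have q: "q \<in> underpts D" using assms by (simp add: crosses_def)
  have c: "crosses D (over_point D q) q" using crosses_over_point[OF assms(1) q] .
  then have "over_point D q \<in> points D" by (simp add: crosses_def)
  with crosses_unique[OF assms(1) c assms(2)] show ?thesis
    using underpts_points[OF assms(1) q]
    by (intro positive_crossing_same_point assms(1)) simp_all
qed

text \<open>Since no three strands meet in a point, a crossing is determined by its under-point.
  Sums over crossings become sums over the under-points of one period.\<close>

lemma crossings_eq:
  assumes "link_diagram D"
  shows "crossings D = (\<lambda>q. (normal_point (over_point D q), q)) ` unit_underpts D" (is "_ = ?R")
proof
  show "crossings D \<subseteq> ?R"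
  proof
    fix \<tau> assume \<tau>: "\<tau> \<in> crossings D"
    obtain p q where pq: "\<tau> = (p, q)" by (cases \<tau>)
    have q: "q \<in> unit_underpts D" using \<tau> by (auto simp: pq crossings_def unit_underpts_def)
    have pu: "snd p \<in> {0..<1}" using \<tau> by (auto simp: pq crossings_def)
    have "crosses D p q"
      using \<tau> same_point_unit_eq[of p q] by (auto simp: pq crossings_def crosses_def)
    moreover have "crosses D (over_point D q) q"
      using crosses_over_point[OF assms] q by (auto simp: unit_underpts_def)
    ultimately have "same_point p (over_point D q)"
      using crosses_unique[OF assms] by blast
    then have "p = normal_point (over_point D q)"
      by (intro same_point_unit_eq[OF _ pu] same_point_trans[OF _ same_point_normal(1)]) simp_all
    then show "\<tau> \<in> ?R" using q pq by auto
  qed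
  show "?R \<subseteq> crossings D"
  proof
    fix \<tau> assume "\<tau> \<in> ?R"
    then obtain q where q: "q \<in> unit_underpts D" "\<tau> = (normal_point (over_point D q), q)" by auto
    have c: "crosses D (normal_point (over_point D q)) q"
      using crosses_over_point[OF assms, of q] q
      by (auto simp: unit_underpts_def intro: crosses_same_point[OF assms])
    then show "\<tau> \<in> crossings D"
      using q underpts_points[OF assms, of q] same_point_refl[of q] snd_normal_point[of "over_point D q"]
      unfolding q(2) crossings_def crosses_def unit_underpts_def
      by (auto simp del: same_point_refl snd_normal_point)
  qed
qed

lemma sum_crossings:
  assumes "link_diagram D"
  shows "(\<Sum>\<tau> \<in> crossings D. g \<tau>) = (\<Sum>q \<in> unit_underpts D. g (normal_point (over_point D q), q))"
  unfolding crossings_eq[OF assms] by (subst sum.reindex) (auto simp: inj_on_def)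

lemma finite_unit_underpts:
  assumes "link_diagram D"
  shows "finite (unit_underpts D)"
proof -
  have "finite (crossings D)" using assms by (simp add: link_diagram_def)
  moreover have "unit_underpts D = snd ` crossings D"
    unfolding crossings_eq[OF assms] by (simp add: image_image)
  ultimately show ?thesis by simp
qed

lemma finite_underpts_interval:
  assumes "link_diagram D"
  shows "finite {t \<in> {a..b}. (i, t) \<in> underpts D}"
proof -
  have "{t \<in> {a..b}. (i, t) \<in> underpts D}
      \<subseteq> (\<lambda>(q, k). snd q + of_int k) ` (unit_underpts D \<times> {\<lfloor>a\<rfloor>..\<lfloor>b\<rfloor>})"
  proof
    fix t assume t: "t \<in> {t \<in> {a..b}. (i, t) \<in> underpts D}"
    have "normal_point (i, t) \<in> unit_underpts D"
      using t underpts_same_point[OF assms same_point_normal(1), of "(i, t)"]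
      by (auto simp: unit_underpts_def)
    moreover have "\<lfloor>t\<rfloor> \<in> {\<lfloor>a\<rfloor>..\<lfloor>b\<rfloor>}" using t by (auto intro: floor_mono)
    moreover have "t = snd (normal_point (i, t)) + of_int \<lfloor>t\<rfloor>"
      by (simp add: normal_point_def frac_def)
    ultimately show "t \<in> (\<lambda>(q, k). snd q + of_int k) ` (unit_underpts D \<times> {\<lfloor>a\<rfloor>..\<lfloor>b\<rfloor>})"
      by (intro image_eqI[of _ _ "(normal_point (i, t), \<lfloor>t\<rfloor>)"]) auto
  qed
  then show ?thesis
    by (rule finite_subset) (use finite_unit_underpts[OF assms] in auto)
qed

lemma eventually_not_under:
  assumes "link_diagram D"
  shows "\<forall>\<^sub>F s in at t. (i, s) \<notin> underpts D"
proof -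
  define F where "F = {s \<in> {t - 1..t + 1}. (i, s) \<in> underpts D} - {t}"
  have "finite F" unfolding F_def using finite_underpts_interval[OF assms] by simp
  then have "open (- F \<inter> {t - 1<..<t + 1})"
    by (intro open_Int open_Compl finite_imp_closed) auto
  moreover have "t \<in> - F \<inter> {t - 1<..<t + 1}" by (auto simp: F_def)
  ultimately have "\<forall>\<^sub>F s in at t. s \<in> - F \<inter> {t - 1<..<t + 1}"
    by (intro eventually_at_topological[THEN iffD2]) blast
  moreover have "\<forall>\<^sub>F s in at t. s \<noteq> t" by (simp add: eventually_at_filter)
  ultimately show ?thesis by eventually_elim (auto simp: F_def)
qed

section \<open>Colorings of parameter points\<close>

text \<open>A coloring of the arcs is encoded by the color of every parameter point; an under-point gets
  the color found on the right-hand side of the over-strand, whatever the direction of the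
  under-strand. The coloring condition then becomes a local condition at every point: the color on
  side \<open>b\<close> of \<open>q\<close> (before \<open>q\<close> if \<open>b\<close>, after \<open>q\<close> otherwise) is given by the following function.\<close>

definition side_color ::
  "bool \<Rightarrow> link_diag \<Rightarrow> (nat \<times> real \<Rightarrow> 'x::group_add \<times> 'x) \<Rightarrow> nat \<times> real \<Rightarrow> 'x \<times> 'x" where
  "side_color b D c q = (if q \<in> underpts D \<and> b \<noteq> positive_crossing D (over_point D q, q)
     then slide True (c (over_point D q)) (c q) else c q)"

definition periodic_on :: "link_diag \<Rightarrow> (nat \<times> real \<Rightarrow> 'b) \<Rightarrow> bool" where
  "periodic_on D c \<longleftrightarrow> (\<forall>p q. p \<in> points D \<longrightarrow> same_point p q \<longrightarrow> c p = c q)"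

text \<open>The crossing relation is contained in \<open>side_color\<close>, as a relation between
  the two one-sided limits at an under-point. The value \<open>undefined\<close> off the diagram
  makes these functions correspond one-to-one to the extensional arc colorings.\<close>

definition point_colorings :: "link_diag \<Rightarrow> (nat \<times> real \<Rightarrow> 'x::group_add \<times> 'x) set" where
  "point_colorings D = {c. (\<forall>p. p \<notin> points D \<longrightarrow> c p = undefined) \<and> periodic_on D c \<and>
     (\<forall>b i t. i < ncomp D \<longrightarrow> (\<forall>\<^sub>F s in at_side b t. c (i, s) = side_color b D c (i, t)))}"

definition point_weight ::
  "('x::group_add \<Rightarrow> 'x \<Rightarrow> 'x \<Rightarrow> 'a::ab_group_add) \<Rightarrow> link_diag \<Rightarrow> nat \<Rightarrow>
   (nat \<times> real \<Rightarrow> 'x \<times> 'x) \<Rightarrow> nat \<times> real \<Rightarrow> 'a" where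
  "point_weight \<psi> D l c q =
     (let w = \<psi> (side l (c q)) (fst (c (over_point D q))) (snd (c (over_point D q)))
      in if positive_crossing D (over_point D q, q) then w else - w)"

lemma periodic_onD: "periodic_on D c \<Longrightarrow> p \<in> points D \<Longrightarrow> same_point p q \<Longrightarrow> c p = c q"
  unfolding periodic_on_def by blast

lemma point_colorings_undefined: "c \<in> point_colorings D \<Longrightarrow> p \<notin> points D \<Longrightarrow> c p = undefined"
  and point_colorings_periodic: "c \<in> point_colorings D \<Longrightarrow> periodic_on D c"
  and point_colorings_local: "c \<in> point_colorings D \<Longrightarrow> i < ncomp D \<Longrightarrow>
    \<forall>\<^sub>F s in at_side b t. c (i, s) = side_color b D c (i, t)"
  unfolding point_colorings_def by blast+

lemma periodic_over_point:
  assumes "link_diagram D" "periodic_on D c" "crosses D p q"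
  shows "c (over_point D q) = c p"
proof (rule periodic_onD[OF assms(2)])
  have "crosses D (over_point D q) q"
    using assms by (intro crosses_over_point) (auto simp: crosses_def)
  then show "over_point D q \<in> points D" "same_point (over_point D q) p"
    using assms by (auto simp: crosses_def intro: crosses_unique)
qed

text \<open>Replaces the arbitrarily chosen \<open>over_point D q\<close> by any over-point of the
  crossing at \<open>q\<close>.\<close>

lemma colors_crosses:
  assumes "link_diagram D" "periodic_on D c" "crosses D p q"
  shows "side_color b D c q = (if b = positive_crossing D (p, q) then c q else slide True (c p) (c q))"
    and "point_weight \<psi> D l c q = (if positive_crossing D (p, q)
      then \<psi> (side l (c q)) (fst (c p)) (snd (c p)) else - \<psi> (side l (c q)) (fst (c p)) (snd (c p)))"
  using positive_over_point[OF assms(1,3)] periodic_over_point[OF assms] assms(3)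
  by (auto simp: side_color_def point_weight_def crosses_def)

lemma colors_not_under: "q \<notin> underpts D \<Longrightarrow> side_color b D c q = c q"
  by (simp add: side_color_def)

lemma colors_same_point:
  assumes D: "link_diagram D" and c: "periodic_on D c" and q: "q \<in> points D" "same_point q q'"
  shows "side_color b D c q = side_color b D c q'"
    "q \<in> underpts D \<Longrightarrow> point_weight \<psi> D l c q = point_weight \<psi> D l c q'"
proof -
  have cq: "c q = c q'" using periodic_onD[OF c q] .
  have *: "side_color b D c q = side_color b D c q' \<and> point_weight \<psi> D l c q = point_weight \<psi> D l c q'"
    if "q \<in> underpts D"
  proof -
    define p where "p = over_point D q"
    have p: "crosses D p q" unfolding p_def by (rule crosses_over_point[OF D that])
    then have p': "crosses D p q'" using crosses_same_point[OF D _ same_point_refl q(2)] by blast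
    have "positive_crossing D (p, q) = positive_crossing D (p, q')"
      using p q by (intro positive_crossing_same_point[OF D]) (auto simp: crosses_def)
    then show ?thesis by (simp add: colors_crosses[OF D c p] colors_crosses[OF D c p'] cq)
  qed
  show "side_color b D c q = side_color b D c q'"
    using * colors_not_under underpts_same_point[OF D q(2)] cq by metis
  show "q \<in> underpts D \<Longrightarrow> point_weight \<psi> D l c q = point_weight \<psi> D l c q'"
    using * by blast
qed

lemma point_colorings_const:
  assumes "c \<in> point_colorings D" "i < ncomp D"
    and "\<forall>r \<in> closed_segment s t. (i, r) \<notin> underpts D"
  shows "c (i, s) = c (i, t)"
proof -
  have *: "c (i, s) = c (i, t)" if "s \<le> t" "\<forall>r \<in> {s..t}. (i, r) \<notin> underpts D" for s t
  proof (rule eventually_same_on_interval[OF that(1)])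
    show "\<forall>\<^sub>F u in at_side b x. c (i, u) = c (i, x)" if "s \<le> x" "x \<le> t" for x b
      using point_colorings_local[OF assms(1,2), of b x] that \<open>\<forall>r \<in> {s..t}. (i, r) \<notin> underpts D\<close>
      by (simp add: colors_not_under)
  qed
  show ?thesis
  proof (cases "s \<le> t")
    case True
    then show ?thesis using assms(3) by (intro *) (simp_all add: closed_segment_eq_real_ivl)
  next
    case False
    then show ?thesis
      using assms(3) by (intro *[symmetric]) (simp_all add: closed_segment_eq_real_ivl)
  qed
qed

section \<open>Arcs\<close>

definition linked :: "link_diag \<Rightarrow> nat \<Rightarrow> real \<Rightarrow> real \<Rightarrow> bool" where
  "linked D i s t \<longleftrightarrow> (\<forall>r \<in> closed_segment s t. (i, r) \<notin> underpts D)"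

lemma arc_of_eq: "arc_of D (i, t) = {(i, s) | s. \<exists>k \<in> \<int>. linked D i t (s + k)}"
  by (simp add: arc_of_def linked_def)

lemma linked_sym: "linked D i s t \<Longrightarrow> linked D i t s"
  by (simp add: linked_def closed_segment_commute)

lemma linked_trans: "linked D i s t \<Longrightarrow> linked D i t u \<Longrightarrow> linked D i s u"
  by (auto simp: linked_def closed_segment_eq_real_ivl split: if_splits)

lemma linked_shift:
  assumes "link_diagram D" "k \<in> \<int>" "linked D i s t"
  shows "linked D i (s + k) (t + k)"
  unfolding linked_def
proof
  fix r assume "r \<in> closed_segment (s + k) (t + k)"
  then have "r - k \<in> closed_segment s t"
    by (auto simp: closed_segment_eq_real_ivl split: if_splits)
  then have "(i, r - k) \<notin> underpts D" using assms by (simp add: linked_def)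
  moreover have "same_point (i, r - k) (i, r)" using assms by (simp add: same_point_def)
  ultimately show "(i, r) \<notin> underpts D" using underpts_same_point[OF assms(1)] by blast
qed

text \<open>Being connected, up to a period, by a stretch free of under-points is an equivalence
  relation, and the arcs are its classes on the points that do not pass under.\<close>

lemma arc_of_cong:
  assumes "link_diagram D" "q \<in> arc_of D p"
  shows "arc_of D q = arc_of D p"
proof -
  obtain i t where p: "p = (i, t)" by force
  obtain s k where s: "q = (i, s)" "k \<in> \<int>" "linked D i t (s + k)"
    using assms(2) unfolding p arc_of_eq by blast
  have 1: "\<exists>j \<in> \<int>. linked D i t (x + j)" if x: "j \<in> \<int>" "linked D i s (x + j)" for x j
  proof (intro bexI)
    show "linked D i t (x + (j + k))"
      using linked_trans[OF s(3) linked_shift[OF assms(1) s(2) x(2)]] by (simp add: add.assoc)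
  qed (use x s in auto)
  have 2: "\<exists>j \<in> \<int>. linked D i s (x + j)" if x: "j \<in> \<int>" "linked D i t (x + j)" for x j
  proof (intro bexI)
    have "- k \<in> \<int>" using s by simp
    from linked_shift[OF assms(1) this linked_trans[OF linked_sym[OF s(3)] x(2)]]
    show "linked D i s (x + (j - k))" by (simp add: add_diff_eq)
  qed (use x s in auto)
  show ?thesis unfolding p s(1) arc_of_eq using 1 2 by blast
qed

lemma arc_of_linked:
  assumes "link_diagram D" "linked D i s t"
  shows "arc_of D (i, s) = arc_of D (i, t)"
proof (rule arc_of_cong[OF assms(1)])
  have "linked D i t (s + 0)" using assms linked_sym by auto
  then show "(i, s) \<in> arc_of D (i, t)" unfolding arc_of_eq using Ints_0 by blast
qed

lemma in_arc_of: "p \<notin> underpts D \<Longrightarrow> p \<in> arc_of D p"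
  by (cases p) (auto simp: arc_of_eq linked_def intro!: bexI[of _ 0])

lemma arc_of_not_under:
  assumes "link_diagram D" "q \<in> arc_of D p"
  shows "q \<notin> underpts D" "fst q = fst p" "p \<notin> underpts D"
proof -
  obtain i t where p: "p = (i, t)" by force
  obtain s k where s: "q = (i, s)" "k \<in> \<int>" "linked D i t (s + k)"
    using assms(2) unfolding p arc_of_eq by blast
  have "(i, s + k) \<notin> underpts D" using s(3) by (simp add: linked_def)
  moreover have "same_point (i, s + k) (i, s)" using s by (simp add: same_point_def)
  ultimately show "q \<notin> underpts D" using underpts_same_point[OF assms(1)] s by blast
  show "p \<notin> underpts D" using s(3) by (simp add: linked_def p)
  show "fst q = fst p" by (simp add: s p)
qed

lemma arc_of_same_point:
  assumes "link_diagram D" "same_point p q"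
  shows "arc_of D p = arc_of D q"
proof (cases "q \<in> underpts D")
  case True
  then have "p \<in> underpts D" using assms underpts_same_point by blast
  then show ?thesis using True arc_of_not_under(3)[OF assms(1)] by blast
next
  case False
  obtain i s t where p: "p = (i, s)" "q = (i, t)" "s - t \<in> \<int>"
    using assms by (cases p; cases q) (auto simp: same_point_def)
  have "- (s - t) \<in> \<int>" using p by (simp only: Ints_minus)
  moreover have "linked D i t (s + - (s - t))" using False by (simp add: linked_def p)
  ultimately have "p \<in> arc_of D q" unfolding p arc_of_eq by blast
  then show ?thesis using assms arc_of_cong by blast
qed

definition arc_side :: "bool \<Rightarrow> link_diag \<Rightarrow> nat \<times> real \<Rightarrow> (nat \<times> real) set" where
  "arc_side b D q = (if b then arc_in D q else arc_out D q)"

text \<open>Resolves the definite description: two arcs that both contain all points close to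
  \<open>t\<close> on one side share a point and hence coincide.\<close>

lemma arc_side_eqI:
  assumes D: "link_diagram D" and \<alpha>: "\<alpha> \<in> arcs D" "\<forall>\<^sub>F s in at_side b t. (i, s) \<in> \<alpha>"
  shows "arc_side b D (i, t) = \<alpha>"
proof -
  have "arc_side b D (i, t) = (THE \<alpha>. \<alpha> \<in> arcs D \<and> (\<forall>\<^sub>F s in at_side b t. (i, s) \<in> \<alpha>))"
    by (simp add: arc_side_def at_side_def arc_in_def arc_out_def)
  also have "\<dots> = \<alpha>"
  proof (rule the_equality)
    fix \<beta> assume \<beta>: "\<beta> \<in> arcs D \<and> (\<forall>\<^sub>F s in at_side b t. (i, s) \<in> \<beta>)"
    then have "\<forall>\<^sub>F s in at_side b t. (i, s) \<in> \<beta> \<and> (i, s) \<in> \<alpha>"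
      using \<alpha> by (simp add: eventually_conj_iff)
    from eventually_happens'[OF at_side_not_bot this]
    obtain s where "(i, s) \<in> \<beta>" "(i, s) \<in> \<alpha>" by blast
    moreover obtain p q where "\<alpha> = arc_of D p" "\<beta> = arc_of D q"
      using \<alpha>(1) \<beta> unfolding arcs_def by blast
    ultimately show "\<beta> = \<alpha>" using arc_of_cong[OF D] by metis
  qed (use \<alpha> in simp)
  finally show ?thesis .
qed

lemma arc_side_props:
  assumes D: "link_diagram D" "i < ncomp D"
  shows "arc_side b D (i, t) \<in> arcs D"
    and "\<forall>\<^sub>F s in at_side b t. (i, s) \<notin> underpts D \<and> arc_of D (i, s) = arc_side b D (i, t)"
    and "(i, t) \<notin> underpts D \<Longrightarrow> arc_side b D (i, t) = arc_of D (i, t)"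
proof -
  obtain d where d: "d > 0" "\<And>s. s \<noteq> t \<Longrightarrow> \<bar>s - t\<bar> < d \<Longrightarrow> (i, s) \<notin> underpts D"
    using eventually_not_under[OF D(1), of i t] by (auto simp: eventually_at dist_real_def)
  \<comment> \<open>The radius \<open>d\<close> separates \<open>t\<close> from all other
    under-points, so \<open>near\<close> is a one-sided interval inside a single arc.\<close>
  define near where "near s \<longleftrightarrow> \<bar>s - t\<bar> < d \<and> (if b then s < t else t < s)" for s
  have near: "\<forall>\<^sub>F s in at_side b t. near s"
    using eventually_at_side_bound eventually_at_side_interval[of "t - d" t "t + d" b] d(1)
    unfolding near_def by (auto simp: eventually_conj_iff abs_less_iff elim: eventually_mono)
  then obtain u where u: "near u" using eventually_happens'[OF at_side_not_bot] by blast
  have under: "(i, s) \<notin> underpts D" if "near s" for s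
    using that d(2)[of s] by (auto simp: near_def split: if_splits)
  have arc: "arc_of D (i, u) \<in> arcs D" using under[OF u] D by (auto simp: arcs_def points_def)
  have eq: "arc_of D (i, s) = arc_of D (i, u)" if s: "near s" for s
  proof (rule arc_of_linked[OF D(1)])
    have "near r" if "r \<in> closed_segment s u" for r
      using that s u by (auto simp: near_def closed_segment_eq_real_ivl split: if_splits)
    then show "linked D i s u" using under by (simp add: linked_def)
  qed
  have mem: "(i, s) \<in> arc_of D (i, u)" if "near s" for s
    using in_arc_of[OF under[OF that]] eq[OF that] by simp
  have as: "arc_side b D (i, t) = arc_of D (i, u)"
    by (rule arc_side_eqI[OF D(1) arc eventually_mono[OF near mem]])
  show "arc_side b D (i, t) \<in> arcs D" using arc as by simp
  show "\<forall>\<^sub>F s in at_side b t. (i, s) \<notin> underpts D \<and> arc_of D (i, s) = arc_side b D (i, t)"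
    using near by eventually_elim (simp add: under eq as)
  show "arc_side b D (i, t) = arc_of D (i, t)" if "(i, t) \<notin> underpts D"
    unfolding as
  proof (rule arc_of_linked[OF D(1)])
    have "(i, r) \<notin> underpts D" if "r \<in> closed_segment u t" for r
      using under[of r] u that \<open>(i, t) \<notin> underpts D\<close>
      by (cases "r = t") (auto simp: near_def closed_segment_eq_real_ivl split: if_splits)
    then show "linked D i u t" by (simp add: linked_def)
  qed
qed

lemma arc_side_same_point:
  assumes D: "link_diagram D" and p: "p \<in> points D" "same_point p q"
  shows "arc_side b D p = arc_side b D q"
proof -
  obtain i s t where st: "p = (i, s)" "q = (i, t)" "s - t \<in> \<int>"
    using p by (cases p; cases q) (auto simp: same_point_def)
  have i: "i < ncomp D" using p st by (simp add: points_def)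
  have "\<forall>\<^sub>F r in at_side b t. (i, r + (s - t)) \<in> arc_side b D (i, t)"
    using arc_side_props(2)[OF D i, of b t]
  proof eventually_elim
    case (elim r)
    have r: "same_point (i, r + (s - t)) (i, r)" using st(3) by (simp add: same_point_def)
    then have "(i, r + (s - t)) \<notin> underpts D" using underpts_same_point[OF D] elim by blast
    then show ?case using in_arc_of arc_of_same_point[OF D r] elim by metis
  qed
  then have "\<forall>\<^sub>F r in at_side b (t + (s - t)). (i, r) \<in> arc_side b D (i, t)"
    unfolding eventually_at_side_shift .
  then show ?thesis
    unfolding st by (intro arc_side_eqI D arc_side_props(1) i) simp
qed

lemma crossing_arcs: "right_arc D \<tau> = arc_side (positive_crossing D \<tau>) D (snd \<tau>)"
  "left_arc D \<tau> = arc_side (\<not> positive_crossing D \<tau>) D (snd \<tau>)"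
  by (simp_all add: right_arc_def left_arc_def arc_side_def)

section \<open>Arc colorings and colorings of parameter points\<close>

definition arc_pair :: "((nat \<times> real) set \<times> nat \<Rightarrow> 'x) \<Rightarrow> (nat \<times> real) set \<Rightarrow> 'x \<times> 'x" where
  "arc_pair C \<alpha> = (C (\<alpha>, 0), C (\<alpha>, 1))"

text \<open>An under-point lies on no arc; it receives the color of the arc on the right of the
  over-strand, the convention built into \<open>side_color\<close>.\<close>

definition spread :: "link_diag \<Rightarrow> ((nat \<times> real) set \<times> nat \<Rightarrow> 'x) \<Rightarrow> nat \<times> real \<Rightarrow> 'x \<times> 'x" where
  "spread D C p = (if p \<notin> points D then undefined
     else arc_pair C (if p \<in> underpts D then right_arc D (over_point D p, p) else arc_of D p))"

text \<open>For a point coloring the choice of the point is immaterial, since the color is constant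
  along each arc.\<close>

definition gather :: "link_diag \<Rightarrow> (nat \<times> real \<Rightarrow> 'x \<times> 'x) \<Rightarrow> (nat \<times> real) set \<times> nat \<Rightarrow> 'x" where
  "gather D c = restrict (\<lambda>(\<alpha>, l). side l (c (SOME p. p \<in> \<alpha>))) (arcs D \<times> {0, 1})"

lemma side_arc_pair: "l \<in> {0, 1} \<Longrightarrow> side l (arc_pair C \<alpha>) = C (\<alpha>, l)"
  by (auto simp: side_def arc_pair_def)

lemma crossing_arcs_same_point:
  assumes "link_diagram D" "crosses D p q" "same_point p p'" "same_point q q'"
  shows "right_arc D (p, q) = right_arc D (p', q')" "left_arc D (p, q) = left_arc D (p', q')"
    "over_arc D (p, q) = over_arc D (p', q')" "positive_crossing D (p, q) = positive_crossing D (p', q')"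
proof -
  have pts: "p \<in> points D" "q \<in> points D"
    using assms by (auto simp: crosses_def intro: underpts_points)
  show pos: "positive_crossing D (p, q) = positive_crossing D (p', q')"
    using assms pts by (intro positive_crossing_same_point)
  show "right_arc D (p, q) = right_arc D (p', q')" "left_arc D (p, q) = left_arc D (p', q')"
    using arc_side_same_point[OF assms(1) pts(2) assms(4)] by (simp_all add: crossing_arcs pos)
  show "over_arc D (p, q) = over_arc D (p', q')"
    using arc_of_same_point assms by (simp add: over_arc_def)
qed

text \<open>\<open>colorings\<close> imposes its condition at normalized parameters only; here it is
  carried over to all integer translates.\<close>

lemma coloring_crosses:
  assumes D: "link_diagram D" and C: "C \<in> colorings D" and pq: "crosses D p q"
  shows "arc_pair C (left_arc D (p, q)) =
    slide True (arc_pair C (arc_of D p)) (arc_pair C (right_arc D (p, q)))"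
proof -
  have q: "normal_point q \<in> unit_underpts D"
    using pq underpts_same_point[OF D same_point_normal(1)]
    by (auto simp: unit_underpts_def crosses_def)
  define p' where "p' = normal_point (over_point D (normal_point q))"
  have "(p', normal_point q) \<in> crossings D"
    unfolding crossings_eq[OF D] p'_def using q by blast
  moreover have "crosses D p' (normal_point q)"
    unfolding p'_def using q crosses_over_point[OF D, of "normal_point q"]
    by (intro crosses_same_point[OF D _ same_point_normal(1) same_point_refl]) (simp add: unit_underpts_def)
  moreover have "crosses D p (normal_point q)"
    using crosses_same_point[OF D pq same_point_refl same_point_normal(1)] .
  ultimately have "same_point p p'" "(p', normal_point q) \<in> crossings D"
    using crosses_unique[OF D] by blast+
  from crossing_arcs_same_point[OF D pq this(1) same_point_normal(1)] this
  have "\<forall>l \<in> {0, 1}. C (left_arc D (p, q), l) =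
     heap (C (right_arc D (p, q), l)) (C (over_arc D (p, q), 0)) (C (over_arc D (p, q), 1))"
    using C by (simp add: colorings_def)
  then show ?thesis
    by (simp add: arc_pair_def over_arc_def heap_def prod_eq_iff group_normal del: add_uminus_conv_diff)
qed

lemma spread_over_point:
  assumes D: "link_diagram D" and q: "q \<in> underpts D"
  shows "spread D C (over_point D q) = arc_pair C (arc_of D (over_point D q))"
  using crosses_not_under[OF D crosses_over_point[OF D q]] crosses_over_point[OF D q]
  by (simp add: spread_def crosses_def)

text \<open>At an under-point one of the sides has the right color by convention, the other one by
  the crossing relation.\<close>

lemma spread_side_color:
  assumes D: "link_diagram D" and C: "C \<in> colorings D" and q: "q \<in> points D"
  shows "side_color b D (spread D C) q = arc_pair C (arc_side b D q)"
proof (cases "q \<in> underpts D")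
  case True
  let ?p = "over_point D q"
  have "spread D C q = arc_pair C (right_arc D (?p, q))"
    using True q by (simp add: spread_def)
  then show ?thesis
    using True coloring_crosses[OF D C crosses_over_point[OF D True]] spread_over_point[OF D True, of C]
    by (cases b; cases "positive_crossing D (?p, q)") (simp_all add: side_color_def crossing_arcs)
next
  case False
  then show ?thesis
    using arc_side_props(3)[OF D, of "fst q" "snd q"] q
    by (simp add: side_color_def spread_def points_def)
qed

lemma spread_point_colorings:
  assumes D: "link_diagram D" and C: "C \<in> colorings D"
  shows "spread D C \<in> point_colorings D"
  unfolding point_colorings_def
proof (intro CollectI conjI allI impI)
  fix p assume "p \<notin> points D" then show "spread D C p = undefined" by (simp add: spread_def)
next
  show "periodic_on D (spread D C)"
    unfolding periodic_on_def
  proof (intro allI impI)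
    fix p q assume p: "p \<in> points D" and pq: "same_point p q"
    have q: "q \<in> points D" using p pq same_point_points by blast
    have u: "p \<in> underpts D \<longleftrightarrow> q \<in> underpts D" using underpts_same_point[OF D pq] .
    show "spread D C p = spread D C q"
    proof (cases "p \<in> underpts D")
      case True
      have cp: "crosses D (over_point D p) p" using crosses_over_point[OF D True] .
      have cq: "crosses D (over_point D q) q" using crosses_over_point[OF D] True u by blast
      have "same_point (over_point D p) (over_point D q)"
        using crosses_same_point[OF D cp same_point_refl pq] cq crosses_unique[OF D] by blast
      from crossing_arcs_same_point(1)[OF D cp this pq] show ?thesis
        using True u p q by (simp add: spread_def)
    next
      case False
      then show ?thesis using u p q arc_of_same_point[OF D pq] by (simp add: spread_def)
    qed
  qed
next
  fix b i t assume i: "i < ncomp D"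
  then have "(i, t) \<in> points D" by (simp add: points_def)
  note eq = spread_side_color[OF D C this]
  show "\<forall>\<^sub>F s in at_side b t. spread D C (i, s) = side_color b D (spread D C) (i, t)"
    using arc_side_props(2)[OF D i, of b t]
    by eventually_elim (use i in \<open>simp add: eq spread_def points_def\<close>)
qed

lemma point_colorings_arc:
  assumes D: "link_diagram D" and c: "c \<in> point_colorings D"
    and p: "p \<in> points D" "q \<in> arc_of D p"
  shows "c q = c p"
proof -
  obtain i t where it: "p = (i, t)" "i < ncomp D" using p by (cases p) (auto simp: points_def)
  obtain s k where s: "q = (i, s)" "k \<in> \<int>" "linked D i t (s + k)"
    using p(2) unfolding it arc_of_eq by blast
  have "c (i, t) = c (i, s + k)"
    using point_colorings_const[OF c it(2)] s by (simp add: linked_def)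
  also have "\<dots> = c (i, s)"
    using it s by (intro periodic_onD[OF point_colorings_periodic[OF c]]) (auto simp: points_def same_point_def)
  finally show ?thesis using it s by simp
qed

lemma gather_arc_of:
  assumes D: "link_diagram D" and c: "c \<in> point_colorings D"
    and p: "p \<in> points D" "p \<notin> underpts D"
  shows "arc_pair (gather D c) (arc_of D p) = c p"
proof -
  have "(SOME q. q \<in> arc_of D p) \<in> arc_of D p" using in_arc_of[OF p(2)] by (rule someI)
  then have "c (SOME q. q \<in> arc_of D p) = c p" by (rule point_colorings_arc[OF D c p(1)])
  moreover have "arc_of D p \<in> arcs D" using p by (simp add: arcs_def)
  ultimately show ?thesis by (simp add: arc_pair_def gather_def side_def)
qed

lemma gather_side_color:
  assumes D: "link_diagram D" and c: "c \<in> point_colorings D" and q: "q \<in> points D"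
  shows "arc_pair (gather D c) (arc_side b D q) = side_color b D c q"
proof -
  obtain i t where it: "q = (i, t)" "i < ncomp D" using q by (cases q) (auto simp: points_def)
  have pts: "(i, s) \<in> points D" for s using it by (simp add: points_def)
  have "\<forall>\<^sub>F s in at_side b t. arc_pair (gather D c) (arc_side b D q) = side_color b D c q"
    using arc_side_props(2)[OF D it(2), of b t] point_colorings_local[OF c it(2), of b t]
    by eventually_elim (metis gather_arc_of[OF D c pts] it(1))
  \<comment> \<open>The equation does not involve \<open>s\<close> and the filter is nontrivial, so
    holding eventually means holding.\<close>
  then show ?thesis by simp
qed

lemma gather_colorings:
  assumes D: "link_diagram D" and c: "c \<in> point_colorings D"
  shows "gather D c \<in> colorings D"
  unfolding colorings_def
proof (intro CollectI conjI ballI)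
  show "gather D c \<in> arcs D \<times> {0, 1} \<rightarrow>\<^sub>E UNIV" by (auto simp: gather_def)
next
  fix \<tau> and l :: nat assume \<tau>: "\<tau> \<in> crossings D" and l: "l \<in> {0, 1}"
  obtain q where q: "q \<in> underpts D" "\<tau> = (normal_point (over_point D q), q)"
    using \<tau> unfolding crossings_eq[OF D] unit_underpts_def by blast
  define p where "p = normal_point (over_point D q)"
  have pq: "crosses D p q"
    unfolding p_def by (intro crosses_same_point[OF D crosses_over_point[OF D q(1)]]) simp_all
  have pts: "p \<in> points D" "p \<notin> underpts D" "q \<in> points D"
    using pq crosses_not_under[OF D pq] underpts_points[OF D q(1)] by (auto simp: crosses_def)
  let ?g = "arc_pair (gather D c)"
  have "?g (left_arc D (p, q)) = slide True (?g (arc_of D p)) (?g (right_arc D (p, q)))"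
    using gather_side_color[OF D c pts(3)] gather_arc_of[OF D c pts(1,2)]
    by (simp add: crossing_arcs colors_crosses[OF D point_colorings_periodic[OF c] pq])
  then have "side l (?g (left_arc D (p, q))) = side l (slide True (?g (arc_of D p)) (?g (right_arc D (p, q))))"
    by simp
  then show "gather D c (left_arc D \<tau>, l) = heap (gather D c (right_arc D \<tau>, l))
       (gather D c (over_arc D \<tau>, 0)) (gather D c (over_arc D \<tau>, 1))"
    unfolding side_slide side_arc_pair[OF l] q(2) p_def[symmetric]
    by (simp add: over_arc_def heap_def arc_pair_def group_normal del: add_uminus_conv_diff)
qed

lemma spread_gather:
  assumes D: "link_diagram D" and c: "c \<in> point_colorings D"
  shows "spread D (gather D c) = c"
proof
  fix p
  show "spread D (gather D c) p = c p"
  proof (cases "p \<in> points D \<and> p \<in> underpts D")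
    case True
    then show ?thesis
      by (simp add: spread_def crossing_arcs gather_side_color[OF D c] side_color_def)
  next
    case False
    then show ?thesis
      using gather_arc_of[OF D c, of p] point_colorings_undefined[OF c, of p] by (cases "p \<in> points D") (simp_all add: spread_def)
  qed
qed

lemma gather_spread:
  assumes D: "link_diagram D" and C: "C \<in> colorings D"
  shows "gather D (spread D C) = C"
proof
  fix z
  show "gather D (spread D C) z = C z"
  proof (cases "z \<in> arcs D \<times> {0, 1}")
    case True
    then obtain p l where z: "z = (arc_of D p, l)" "p \<in> points D" "p \<notin> underpts D" "l \<in> {0, 1}"
      by (auto simp: arcs_def)
    have "side l (arc_pair (gather D (spread D C)) (arc_of D p)) = side l (spread D C p)"
      using gather_arc_of[OF D spread_point_colorings[OF D C] z(2,3)] by simp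
    then show ?thesis using z by (simp only: side_arc_pair) (simp add: spread_def side_arc_pair)
  next
    case False
    have "C \<in> extensional (arcs D \<times> {0, 1})"
      using C unfolding colorings_def PiE_def by blast
    then have "C z = undefined" using False by (rule extensional_arb)
    moreover have "gather D (spread D C) z = undefined" using False by (simp add: gather_def)
    ultimately show ?thesis by simp
  qed
qed

lemma sum_boltzmann_weight:
  assumes D: "link_diagram D" and C: "C \<in> colorings D" and l: "l \<in> {0, 1}"
  shows "(\<Sum>\<tau> \<in> crossings D. boltzmann_weight \<psi> D l C \<tau>) =
    (\<Sum>q \<in> unit_underpts D. point_weight \<psi> D l (spread D C) q)"
  unfolding sum_crossings[OF D]
proof (rule sum.cong[OF refl])
  fix q assume "q \<in> unit_underpts D"
  then have q: "q \<in> underpts D" by (simp add: unit_underpts_def)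
  let ?p = "over_point D q"
  note eq = crossing_arcs_same_point[OF D crosses_over_point[OF D q] same_point_normal(1) same_point_refl]
  have "spread D C q = arc_pair C (right_arc D (?p, q))"
    using q underpts_points[OF D q] by (simp add: spread_def)
  moreover note spread_over_point[OF D q, of C]
  ultimately show "boltzmann_weight \<psi> D l C (normal_point ?p, q) = point_weight \<psi> D l (spread D C) q"
    unfolding boltzmann_weight_def point_weight_def
    by (simp add: eq[symmetric] side_arc_pair[OF l]) (simp add: over_arc_def arc_pair_def)
qed

definition total_weight ::
  "('x::group_add \<Rightarrow> 'x \<Rightarrow> 'x \<Rightarrow> 'a::ab_group_add) \<Rightarrow> link_diag \<Rightarrow> nat \<Rightarrow>
   (nat \<times> real \<Rightarrow> 'x \<times> 'x) \<Rightarrow> 'a" where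
  "total_weight \<psi> D l c = (\<Sum>q \<in> unit_underpts D. point_weight \<psi> D l c q)"

text \<open>\<open>spread\<close> and \<open>gather\<close> are inverse to each other and preserve
  the weights. Arcs do not occur in the rest of the proof.\<close>

theorem heap_invariant_eq:
  assumes D: "link_diagram D"
  shows "heap_invariant \<psi> D = (\<Sum>c \<in> point_colorings D.
     Poly_Mapping.single (total_weight \<psi> D 0 c, total_weight \<psi> D 1 c) 1)"
  unfolding heap_invariant_def
  by (rule sum.reindex_bij_witness[of _ "gather D" "spread D"])
    (simp_all add: D gather_spread spread_gather spread_point_colorings gather_colorings
      sum_boltzmann_weight total_weight_def)

section \<open>Coboundaries\<close>

text \<open>At a positive crossing the right-hand side comes before the under-point, at a negative
  one after it. The sign of the weight compensates for this, so the value is always \<open>f\<close>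
  before minus \<open>f\<close> after.\<close>

lemma point_weight_coboundary:
  assumes "\<And>x y z. \<psi> x y z = f x - f (heap x y z)" "q \<in> underpts D"
  shows "point_weight \<psi> D l c q = f (side l (side_color True D c q)) - f (side l (side_color False D c q))"
  using assms by (simp add: point_weight_def side_color_def heap_def group_normal Let_def
      del: add_uminus_conv_diff)

lemma unit_underpts_eq:
  assumes "link_diagram D"
  shows "unit_underpts D = Sigma {..<ncomp D} (\<lambda>i. {t. (i, t) \<in> underpts D} \<inter> {0..<1})"
  using underpts_points[OF assms] by (force simp: unit_underpts_def points_def)

lemma total_weight_coboundary:
  fixes \<psi> :: "'x::group_add \<Rightarrow> 'x \<Rightarrow> 'x \<Rightarrow> 'a::ab_group_add"
  assumes D: "link_diagram D" and c: "c \<in> point_colorings D"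
    and \<psi>: "\<And>x y z. \<psi> x y z = f x - f (heap x y z)"
  shows "total_weight \<psi> D l c = 0"
proof -
  let ?J = "\<lambda>b q. f (side l (side_color b D c q))"
  have fin: "finite ({t. (i, t) \<in> underpts D} \<inter> {a..<b})" for i a b
    by (rule finite_subset[OF _ finite_underpts_interval[OF D, of a b i]]) auto
  have "total_weight \<psi> D l c = (\<Sum>q \<in> unit_underpts D. ?J True q - ?J False q)"
    unfolding total_weight_def
    by (intro sum.cong refl point_weight_coboundary \<psi>) (simp add: unit_underpts_def)
  also have "\<dots> = - (\<Sum>q \<in> unit_underpts D. ?J False q - ?J True q)"
    by (simp add: sum_negf[symmetric])
  also have "(\<Sum>q \<in> unit_underpts D. ?J False q - ?J True q) =
      (\<Sum>i<ncomp D. \<Sum>t \<in> {t. (i, t) \<in> underpts D} \<inter> {0..<1}. ?J False (i, t) - ?J True (i, t))"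
    unfolding unit_underpts_eq[OF D] using fin by (simp add: sum.Sigma)
  also have "\<dots> = 0"
  proof (rule sum.neutral, intro ballI)
    fix i assume "i \<in> {..<ncomp D}"
    then have i: "i < ncomp D" by simp
    have "(\<Sum>t \<in> {t. (i, t) \<in> underpts D} \<inter> {0..<1}. ?J False (i, t) - ?J True (i, t)) = ?J True (i, 1) - ?J True (i, 0)"
    proof (rule sum_jumps[where f = "\<lambda>t. f (side l (c (i, t)))" and J = "\<lambda>b t. ?J b (i, t)"])
      show "\<forall>\<^sub>F u in at_side b x. f (side l (c (i, u))) = ?J b (i, x)" for b x
        using point_colorings_local[OF c i, of b x] by eventually_elim simp
    qed (use fin in \<open>auto simp: colors_not_under\<close>)
    \<comment> \<open>After one full turn the component is back at the same point of the link, so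
      the boundary terms agree.\<close>
    moreover have "side_color True D c (i, 1) = side_color True D c (i, 0)"
      using i by (intro colors_same_point(1)[OF D point_colorings_periodic[OF c]])
        (auto simp: points_def same_point_def)
    ultimately show "(\<Sum>t \<in> {t. (i, t) \<in> underpts D} \<inter> {0..<1}. ?J False (i, t) - ?J True (i, t)) = 0"
      by simp
  qed
  also have "- 0 = (0 :: 'a)" by simp
  finally show ?thesis .
qed

theorem heap_invariant_coboundary:
  fixes \<psi> :: "'x::{group_add,finite} \<Rightarrow> 'x \<Rightarrow> 'x \<Rightarrow> 'a::ab_group_add"
  assumes "\<psi> \<in> B2_SD" "link_diagram D"
  shows "\<exists>n::int. heap_invariant \<psi> D = Poly_Mapping.single (0, 0) n"
proof -
  obtain f where f: "\<And>x y z. \<psi> x y z = f x - f (heap x y z)"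
    using assms(1) by (auto simp: B2_SD_def)
  \<comment> \<open>All colorings contribute the same basis element, so the integer is the number of
    colorings; for an infinite \<open>S\<close> both sides vanish.\<close>
  have sum: "(\<Sum>c \<in> S. Poly_Mapping.single (0::'a, 0::'a) (1::int)) = Poly_Mapping.single (0, 0) (int (card S))"
    for S :: "(nat \<times> real \<Rightarrow> 'x \<times> 'x) set"
    by (induction S rule: infinite_finite_induct) (simp_all flip: single_add del: sum_constant)
  have "heap_invariant \<psi> D = (\<Sum>c \<in> (point_colorings D :: (nat \<times> real \<Rightarrow> 'x \<times> 'x) set). Poly_Mapping.single (0, 0) 1)"
    unfolding heap_invariant_eq[OF assms(2)]
    by (intro sum.cong refl) (simp add: total_weight_coboundary[OF assms(2) _ f])
  then show ?thesis unfolding sum by blast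
qed

text \<open>The weights are additive in the cocycle, so the difference of the total weights is the
  total weight of a coboundary.\<close>

theorem heap_invariant_cohomologous:
  fixes \<phi> \<psi> :: "'x::{group_add,finite} \<Rightarrow> 'x \<Rightarrow> 'x \<Rightarrow> 'a::ab_group_add"
  assumes D: "link_diagram D" and "(\<phi>, \<psi>) \<in> cohomologous"
  shows "heap_invariant \<phi> D = heap_invariant \<psi> D"
proof -
  obtain f where f: "\<And>x y z. \<phi> x y z - \<psi> x y z = f x - f (heap x y z)"
    using assms(2) by (auto simp: cohomologous_def B2_SD_def)
  have "total_weight \<phi> D l c = total_weight \<psi> D l c" if "c \<in> point_colorings D" for l c
  proof -
    have "total_weight \<phi> D l c - total_weight \<psi> D l c = total_weight (\<lambda>x y z. \<phi> x y z - \<psi> x y z) D l c"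
      unfolding total_weight_def sum_subtractf[symmetric]
      by (intro sum.cong refl) (simp add: point_weight_def Let_def)
    also have "\<dots> = 0" by (rule total_weight_coboundary[OF D that f])
    finally show ?thesis by simp
  qed
  then show ?thesis unfolding heap_invariant_eq[OF D] by simp
qed

lemma cohomology_class_eqD:
  assumes "\<phi> \<in> Z2_SD" "\<psi> \<in> Z2_SD" "cohomology_class \<phi> = cohomology_class \<psi>"
  shows "(\<phi>, \<psi>) \<in> cohomologous"
proof -
  have "(\<lambda>x y z. \<psi> x y z - \<psi> x y z) \<in> B2_SD" by (auto simp: B2_SD_def intro!: exI[of _ "\<lambda>_. 0"])
  then have "\<psi> \<in> cohomology_class \<psi>" using assms by (simp add: cohomology_class_def cohomologous_def)
  then have "\<psi> \<in> cohomology_class \<phi>" by (simp only: assms(3))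
  then show ?thesis by (simp add: cohomology_class_def)
qed

section \<open>Reparametrization and planar isotopy\<close>

text \<open>Retains of a planar isotopy only what colorings and weights can see: which points meet,
  which of them pass under, and the signs of the crossings, all transported along
  \<open>\<pi>\<close> and \<open>\<rho>\<close>.\<close>

locale reparametrization =
  fixes D D' :: link_diag and \<pi> :: "nat \<Rightarrow> nat" and \<rho> :: "nat \<Rightarrow> real \<Rightarrow> real"
  assumes D: "link_diagram D" and D': "link_diagram D'"
    and ncomp: "ncomp D' = ncomp D"
    and \<pi>: "bij_betw \<pi> {..<ncomp D} {..<ncomp D}"
    and \<rho>: "\<And>i. i < ncomp D \<Longrightarrow> strict_mono (\<rho> i)" "\<And>i. i < ncomp D \<Longrightarrow> surj (\<rho> i)"
      "\<And>i t. i < ncomp D \<Longrightarrow> \<rho> i (t + 1) = \<rho> i t + 1"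
    and under: "\<And>i t. i < ncomp D \<Longrightarrow> (i, t) \<in> underpts D' \<longleftrightarrow> (\<pi> i, \<rho> i t) \<in> underpts D"
    and meet: "\<And>i j s t. i < ncomp D \<Longrightarrow> j < ncomp D \<Longrightarrow>
      pos D' (i, s) = pos D' (j, t) \<longleftrightarrow> pos D (\<pi> i, \<rho> i s) = pos D (\<pi> j, \<rho> j t)"
    and sign: "\<And>i j s t. i < ncomp D \<Longrightarrow> j < ncomp D \<Longrightarrow> crosses D' (i, s) (j, t) \<Longrightarrow>
      positive_crossing D' ((i, s), (j, t)) \<longleftrightarrow> positive_crossing D ((\<pi> i, \<rho> i s), (\<pi> j, \<rho> j t))"
begin

definition \<Theta> :: "nat \<times> real \<Rightarrow> nat \<times> real" where
  "\<Theta> p = (\<pi> (fst p), \<rho> (fst p) (snd p))"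

lemma points_D': "points D' = points D"
  by (simp add: points_def ncomp)

text \<open>\<open>\<rho> i t - t\<close> has period 1, so integer differences are preserved
  exactly; injectivity of \<open>\<rho> i\<close> gives the converse.\<close>

lemma \<rho>_Ints:
  assumes "i < ncomp D"
  shows "\<rho> i s - \<rho> i t \<in> \<int> \<longleftrightarrow> s - t \<in> \<int>"
proof -
  have int: "s - t \<in> \<int> \<Longrightarrow> \<rho> i s - s = \<rho> i t - t" for s t
    by (rule periodic_Ints[of "\<lambda>t. \<rho> i t - t"]) (simp_all add: \<rho>(3)[OF assms])
  show ?thesis
  proof
    assume "\<rho> i s - \<rho> i t \<in> \<int>"
    then obtain k where k: "\<rho> i s - \<rho> i t = of_int k" by (auto elim: Ints_cases)
    have "\<rho> i (t + of_int k) = \<rho> i t + of_int k" using int[of "t + of_int k" t] by simp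
    then have "\<rho> i s = \<rho> i (t + of_int k)" using k by simp
    then have "s = t + of_int k" using strict_mono_eq[OF \<rho>(1)[OF assms]] by blast
    then show "s - t \<in> \<int>" by simp
  next
    assume st: "s - t \<in> \<int>"
    then have "\<rho> i s - \<rho> i t = s - t" using int by fastforce
    then show "\<rho> i s - \<rho> i t \<in> \<int>" using st by simp
  qed
qed

lemma \<pi>_eq: "i < ncomp D \<Longrightarrow> j < ncomp D \<Longrightarrow> \<pi> i = \<pi> j \<longleftrightarrow> i = j"
  using \<pi> by (auto simp: bij_betw_def inj_on_def)

lemma \<pi>_less: "i < ncomp D \<Longrightarrow> \<pi> i < ncomp D"
  using \<pi> by (auto simp: bij_betw_def)

lemma \<Theta>_same_point:
  assumes "p \<in> points D" "q \<in> points D"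
  shows "same_point (\<Theta> p) (\<Theta> q) \<longleftrightarrow> same_point p q"
  using assms \<pi>_eq[of "fst p" "fst q"] \<rho>_Ints[of "fst q"]
  by (auto simp: same_point_def \<Theta>_def points_def)

lemma \<Theta>_bij: "bij_betw \<Theta> (points D) (points D)"
proof (rule bij_betwI')
  fix p q assume pq: "p \<in> points D" "q \<in> points D"
  show "\<Theta> p = \<Theta> q \<longleftrightarrow> p = q"
    using pq \<pi>_eq[of "fst p" "fst q"] strict_mono_eq[OF \<rho>(1)[of "fst q"]]
    by (auto simp: \<Theta>_def points_def prod_eq_iff)
next
  fix p assume "p \<in> points D"
  then show "\<Theta> p \<in> points D" using \<pi>_less by (simp add: \<Theta>_def points_def)
next
  fix q assume "q \<in> points D"
  then have "fst q \<in> \<pi> ` {..<ncomp D}" using \<pi> by (simp add: bij_betw_def points_def)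
  then obtain i where i: "i < ncomp D" "\<pi> i = fst q" by auto
  obtain t where "\<rho> i t = snd q" using \<rho>(2)[OF i(1)] by (metis surj_def)
  then show "\<exists>p \<in> points D. q = \<Theta> p"
    using i by (intro bexI[of _ "(i, t)"]) (auto simp: \<Theta>_def points_def)
qed

lemma \<Theta>_points: "p \<in> points D \<Longrightarrow> \<Theta> p \<in> points D"
  using \<Theta>_bij by (auto simp: bij_betw_def)

lemma \<Theta>_under: "p \<in> points D \<Longrightarrow> p \<in> underpts D' \<longleftrightarrow> \<Theta> p \<in> underpts D"
  using under[of "fst p" "snd p"] by (simp add: \<Theta>_def points_def)

lemma \<Theta>_crosses:
  assumes "p \<in> points D" "q \<in> points D"
  shows "crosses D' p q \<longleftrightarrow> crosses D (\<Theta> p) (\<Theta> q)"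
  using assms meet[of "fst p" "fst q" "snd p" "snd q"] \<Theta>_under[of q] \<Theta>_same_point[of p q] \<Theta>_points[of p]
  by (auto simp: crosses_def points_D') (simp_all add: \<Theta>_def points_def)

lemma \<Theta>_sign:
  assumes "p \<in> points D" "q \<in> points D" "crosses D' p q"
  shows "positive_crossing D' (p, q) \<longleftrightarrow> positive_crossing D (\<Theta> p, \<Theta> q)"
  using assms sign[of "fst p" "fst q" "snd p" "snd q"] by (simp add: \<Theta>_def points_def)

context
  fixes c c' :: "nat \<times> real \<Rightarrow> 'x::group_add \<times> 'x"
  assumes cc': "\<And>p. p \<in> points D \<Longrightarrow> c' p = c (\<Theta> p)"
    and ext: "\<And>p. p \<notin> points D \<Longrightarrow> c p = undefined" "\<And>p. p \<notin> points D \<Longrightarrow> c' p = undefined"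
begin

lemma periodic_pull: "periodic_on D c \<longleftrightarrow> periodic_on D' c'"
proof
  assume "periodic_on D c"
  then show "periodic_on D' c'"
    unfolding periodic_on_def points_D'
    using cc' \<Theta>_same_point \<Theta>_points same_point_points by metis
next
  assume c': "periodic_on D' c'"
  show "periodic_on D c"
    unfolding periodic_on_def
  proof (intro allI impI)
    fix p q assume pq: "p \<in> points D" "same_point p q"
    then have "q \<in> points D" using same_point_points by blast
    then obtain p' q' where "p' \<in> points D" "q' \<in> points D" "p = \<Theta> p'" "q = \<Theta> q'"
      using pq \<Theta>_bij by (metis bij_betw_imp_surj_on imageE)
    then show "c p = c q"
      using c' pq cc' \<Theta>_same_point unfolding periodic_on_def points_D' by metis
  qed
qed

lemma colors_pull:
  assumes c: "periodic_on D c" and q: "q \<in> points D"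
  shows "side_color b D' c' q = side_color b D c (\<Theta> q)"
    "q \<in> underpts D' \<Longrightarrow> point_weight \<psi> D' l c' q = point_weight \<psi> D l c (\<Theta> q)"
proof -
  have c': "periodic_on D' c'" using c periodic_pull by simp
  have *: "side_color b D' c' q = side_color b D c (\<Theta> q) \<and>
    point_weight \<psi> D' l c' q = point_weight \<psi> D l c (\<Theta> q)" if u: "q \<in> underpts D'"
  proof -
    define p where "p = over_point D' q"
    have p: "crosses D' p q" unfolding p_def by (rule crosses_over_point[OF D' u])
    then have pp: "p \<in> points D" by (simp add: crosses_def points_D')
    have "crosses D (\<Theta> p) (\<Theta> q)" using p \<Theta>_crosses[OF pp q] by simp
    from colors_crosses(1)[OF D c this] colors_crosses(1)[OF D' c' p] \<Theta>_sign[OF pp q p]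
      colors_crosses(2)[OF D c this, where \<psi>=\<psi>] colors_crosses(2)[OF D' c' p, where \<psi>=\<psi>]
    show ?thesis using cc' pp q by simp
  qed
  show "side_color b D' c' q = side_color b D c (\<Theta> q)"
    using * \<Theta>_under[OF q] cc'[OF q] colors_not_under by metis
  show "q \<in> underpts D' \<Longrightarrow> point_weight \<psi> D' l c' q = point_weight \<psi> D l c (\<Theta> q)"
    using * by blast
qed

lemma point_colorings_pull: "c \<in> point_colorings D \<longleftrightarrow> c' \<in> point_colorings D'"
proof (cases "periodic_on D c")
  case True
  have eq: "c' (i, s) = c (\<pi> i, \<rho> i s)" if "i < ncomp D" for i s
    using cc'[of "(i, s)"] that by (simp add: \<Theta>_def points_def)
  have "(\<forall>\<^sub>F s in at_side b t. c' (i, s) = side_color b D' c' (i, t)) \<longleftrightarrow>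
      (\<forall>\<^sub>F s in at_side b (\<rho> i t). c (\<pi> i, s) = side_color b D c (\<pi> i, \<rho> i t))" if "i < ncomp D" for b i t
    using colors_pull(1)[OF True, of "(i, t)"] eventually_at_side_strict_mono[OF \<rho>(1,2)[OF that]] that
    by (simp add: eq) (simp add: \<Theta>_def points_def)
  moreover have "(\<forall>i t. i < ncomp D \<longrightarrow> Q (\<pi> i) (\<rho> i t)) \<longleftrightarrow> (\<forall>i t. i < ncomp D \<longrightarrow> Q i t)" for Q
  proof -
    have "(\<forall>p \<in> points D. case_prod Q (\<Theta> p)) \<longleftrightarrow> (\<forall>p \<in> \<Theta> ` points D. case_prod Q p)" by simp
    also have "\<Theta> ` points D = points D" using \<Theta>_bij by (simp add: bij_betw_def)
    finally have "(\<forall>p \<in> points D. case_prod Q (\<Theta> p)) \<longleftrightarrow> (\<forall>p \<in> points D. case_prod Q p)" .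
    then show ?thesis by (simp add: points_def \<Theta>_def)
  qed
  note this[of "\<lambda>i t. \<forall>\<^sub>F s in at_side b t. c (i, s) = side_color b D c (i, t)" for b]
  ultimately show ?thesis
    using True periodic_pull ext unfolding point_colorings_def points_D' ncomp by simp
next
  case False
  then show ?thesis using periodic_pull by (simp add: point_colorings_def)
qed

text \<open>\<open>\<Theta>\<close> need not map the period \<open>{0..<1}\<close> to itself, so the
  under-points are normalized again after \<open>\<Theta>\<close> and after its inverse.\<close>

lemma total_weight_pull:
  assumes c: "periodic_on D c"
  shows "total_weight \<psi> D' l c' = total_weight \<psi> D l c"
  unfolding total_weight_def
proof (rule sum.reindex_bij_witness[of _ "\<lambda>q. normal_point (inv_into (points D) \<Theta> q)" "\<lambda>q. normal_point (\<Theta> q)"])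
  have unit: "normal_point q \<in> unit_underpts E \<longleftrightarrow> q \<in> underpts E" if "link_diagram E" for q E
    using underpts_same_point[OF that same_point_normal(1), of q]
    by (simp add: unit_underpts_def)
  have under: "q \<in> underpts E \<Longrightarrow> normal_point q = q" if "q \<in> unit_underpts E" for q E
    using that by (intro same_point_unit_eq) (simp_all add: unit_underpts_def)
  have normal: "normal_point p = normal_point q" if "same_point p q" for p q
    using same_point_trans[OF same_point_normal(2) same_point_trans[OF that same_point_normal(1)]]
    by (intro same_point_unit_eq) simp_all
  let ?inv = "inv_into (points D) \<Theta>"
  have inv: "?inv q \<in> points D" "\<Theta> (?inv q) = q" if "q \<in> points D" for q
    using that \<Theta>_bij by (auto simp: bij_betw_def inv_into_into f_inv_into_f)
  have np: "normal_point q \<in> points D \<longleftrightarrow> q \<in> points D" for q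
    by (simp add: points_def normal_point_def)
  show "normal_point (?inv (normal_point (\<Theta> q))) = q" if "q \<in> unit_underpts D'" for q
  proof -
    have q: "q \<in> points D" "\<Theta> q \<in> points D"
      using that underpts_points[OF D'] \<Theta>_points by (auto simp: unit_underpts_def points_D')
    then have n: "normal_point (\<Theta> q) \<in> points D" using np by simp
    have "same_point (\<Theta> (?inv (normal_point (\<Theta> q)))) (\<Theta> q)" using inv(2)[OF n] by simp
    then have "same_point (?inv (normal_point (\<Theta> q))) q"
      by (rule \<Theta>_same_point[OF inv(1)[OF n] q(1), THEN iffD1])
    from normal[OF this] show ?thesis using under[of q D'] that by (simp add: unit_underpts_def)
  qed
  show "normal_point (\<Theta> q) \<in> unit_underpts D" if "q \<in> unit_underpts D'" for q
    using that \<Theta>_under underpts_points[OF D', of q] unit[OF D] by (simp add: unit_underpts_def points_D')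
  show "normal_point (\<Theta> (normal_point (?inv q))) = q" if "q \<in> unit_underpts D" for q
  proof -
    have q: "q \<in> points D" using that underpts_points[OF D] by (auto simp: unit_underpts_def)
    have "same_point (\<Theta> (normal_point (?inv q))) (\<Theta> (?inv q))"
      using np inv(1)[OF q] by (intro \<Theta>_same_point[THEN iffD2] same_point_normal(2)) simp_all
    from normal[OF this] show ?thesis using under[of q D] that inv q by (simp add: unit_underpts_def)
  qed
  show "normal_point (?inv q) \<in> unit_underpts D'" if "q \<in> unit_underpts D" for q
    using that \<Theta>_under inv[of q] underpts_points[OF D, of q] unit[OF D'] by (simp add: unit_underpts_def)
  show "point_weight \<psi> D l c (normal_point (\<Theta> q)) = point_weight \<psi> D' l c' q" if "q \<in> unit_underpts D'" for q
  proof -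
    have q: "q \<in> points D" "q \<in> underpts D'"
      using that underpts_points[OF D'] by (auto simp: unit_underpts_def points_D')
    then have u: "\<Theta> q \<in> points D" "\<Theta> q \<in> underpts D" using \<Theta>_under \<Theta>_points by blast+
    show ?thesis
      by (metis colors_same_point(2)[OF D c u(1) same_point_normal(1) u(2)] colors_pull(2)[OF c q])
  qed
qed

end

lemma heap_invariant_reparametrization:
  fixes \<psi> :: "'a::{group_add,finite} \<Rightarrow> 'a \<Rightarrow> 'a \<Rightarrow> 'b::ab_group_add"
  shows "heap_invariant \<psi> D' = heap_invariant \<psi> D"
  unfolding heap_invariant_eq[OF D] heap_invariant_eq[OF D']
proof (rule sum.reindex_bij_witness[of _ "\<lambda>c p. if p \<in> points D then c (\<Theta> p) else undefined"
      "\<lambda>c p. if p \<in> points D then c (inv_into (points D) \<Theta> p) else undefined"])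
  let ?pull = "\<lambda>(c :: nat \<times> real \<Rightarrow> 'a \<times> 'a) p. if p \<in> points D then c (\<Theta> p) else undefined"
  let ?push = "\<lambda>(c :: nat \<times> real \<Rightarrow> 'a \<times> 'a) p. if p \<in> points D then c (inv_into (points D) \<Theta> p) else undefined"
  have inv: "inv_into (points D) \<Theta> q \<in> points D" "\<Theta> (inv_into (points D) \<Theta> q) = q"
    "inv_into (points D) \<Theta> (\<Theta> q) = q" if "q \<in> points D" for q
    using that \<Theta>_bij by (auto simp: bij_betw_def inv_into_into f_inv_into_f)
  note ext = point_colorings_undefined
  have push: "?push c \<in> point_colorings D \<longleftrightarrow> c \<in> point_colorings D'"
    if "\<And>p. p \<notin> points D \<Longrightarrow> c p = undefined" for c
    by (rule point_colorings_pull) (use inv that \<Theta>_points in auto)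
  have pull: "c \<in> point_colorings D \<longleftrightarrow> ?pull c \<in> point_colorings D'"
    if "\<And>p. p \<notin> points D \<Longrightarrow> c p = undefined" for c
    by (rule point_colorings_pull) (use that in auto)
  show "?pull (?push c) = c" if "c \<in> point_colorings D'" for c
    using inv ext[OF that] \<Theta>_points by (auto simp: points_D')
  show "?push c \<in> point_colorings D" if "c \<in> point_colorings D'" for c
    using push ext[OF that] that by (simp add: points_D')
  show "?push (?pull c) = c" if "c \<in> point_colorings D" for c
    using inv ext[OF that] by auto
  show "?pull c \<in> point_colorings D'" if "c \<in> point_colorings D" for c
    using pull ext[OF that] that by simp
  fix c :: "nat \<times> real \<Rightarrow> 'a \<times> 'a" assume c: "c \<in> point_colorings D'"
  then have "?push c \<in> point_colorings D" using push ext[OF c] by (simp add: points_D')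
  then have "periodic_on D (?push c)" by (rule point_colorings_periodic)
  then have "total_weight \<psi> D' l c = total_weight \<psi> D l (?push c)" for l
    by (intro total_weight_pull) (use inv ext[OF c] \<Theta>_points in \<open>auto simp: points_D'\<close>)
  then show "Poly_Mapping.single (total_weight \<psi> D 0 (?push c), total_weight \<psi> D 1 (?push c)) (1::int) =
    Poly_Mapping.single (total_weight \<psi> D' 0 c, total_weight \<psi> D' 1 c) 1" by simp
qed

end

section \<open>Ambient isotopies preserve the orientation of the plane\<close>

lemma plane_det_linear:
  assumes "linear (h :: complex \<Rightarrow> complex)"
  shows "plane_det (h v) (h w) = plane_det (h 1) (h \<i>) * plane_det v w"
proof -
  have eq: "h v = Re v *\<^sub>R h 1 + Im v *\<^sub>R h \<i>" for v
  proof -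
    have "v = Re v *\<^sub>R 1 + Im v *\<^sub>R \<i>" by (simp add: complex_eq_iff)
    then show ?thesis by (metis assms linear_add linear_scale)
  qed
  show ?thesis
    unfolding eq[of v] eq[of w] by (simp add: plane_det_def algebra_simps)
qed

text \<open>\<open>plane_det (h 1) (h \<i>)\<close> is the determinant of \<open>h\<close>. Along
  the isotopy it depends continuously on the time, equals 1 at time 0 and never vanishes, because
  the differentials are bijective.\<close>

lemma ambient_isotopy_derivative:
  assumes "ambient_isotopy H"
  obtains h where "(H 1 has_derivative h) (at z)" "plane_det (h 1) (h \<i>) > 0"
proof -
  obtain H' where H': "\<And>t z. t \<in> {0..1} \<Longrightarrow> (H t has_derivative H' t z) (at z)"
      "\<And>t z. t \<in> {0..1} \<Longrightarrow> bij (H' t z)"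
      "\<And>w. continuous_on ({0..1} \<times> UNIV) (\<lambda>(t, z). H' t z w)"
    using assms unfolding ambient_isotopy_def by blast
  define J where "J t = plane_det (H' t z 1) (H' t z \<i>)" for t
  have cont1: "continuous_on {0..1} (\<lambda>t. H' t z w)" for w
  proof -
    have "continuous_on {0..1} (\<lambda>t::real. (t, z))" by (intro continuous_intros)
    from continuous_on_compose2[OF H'(3)[of w] this] show ?thesis by auto
  qed
  have "continuous_on {0..1} J"
    unfolding J_def plane_det_def by (intro continuous_intros cont1)
  moreover have J0: "J 0 = 1"
  proof -
    have "H 0 = (\<lambda>z. z)" using assms by (auto simp: ambient_isotopy_def)
    then have "(H 0 has_derivative (\<lambda>z. z)) (at z)" by (simp add: has_derivative_ident)
    from has_derivative_unique[OF _ this, of "H' 0 z"] H'(1)[of 0 z] have "H' 0 z = (\<lambda>z. z)"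
      by simp
    then show ?thesis by (simp add: J_def plane_det_def)
  qed
  moreover have "J t \<noteq> 0" if "t \<in> {0..1}" for t
  proof
    assume "J t = 0"
    have lin: "linear (H' t z)" using H'(1)[OF that, of z] by (rule has_derivative_linear)
    \<comment> \<open>If the determinant vanished, all image vectors would be parallel, but
      \<open>1\<close> and \<open>\<i>\<close> both occur as images.\<close>
    have "plane_det (H' t z v) (H' t z w) = 0" for v w
      using plane_det_linear[OF lin, of v w] \<open>J t = 0\<close> by (simp add: J_def)
    moreover have "surj (H' t z)" using H'(2)[OF that, of z] by (simp add: bij_def)
    then obtain v w where "H' t z v = 1" "H' t z w = \<i>" by (metis surj_def)
    ultimately have "plane_det 1 \<i> = 0" by metis
    then show False by (simp add: plane_det_def)
  qed
  ultimately have "J 1 > 0"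
    using IVT2'[of J 1 0 0] by (force simp: not_less)
  then show ?thesis using that[of "H' 1 z"] H'(1)[of 1 z] by (simp add: J_def)
qed

lemma deriv_pos_strict_mono_surj:
  fixes \<rho> :: "real \<Rightarrow> real"
  assumes der: "\<And>t. \<exists>d > 0. (\<rho> has_real_derivative d) (at t)" and per: "\<And>t. \<rho> (t + 1) = \<rho> t + 1"
  shows "strict_mono \<rho>" "surj \<rho>"
proof -
  show "strict_mono \<rho>"
  proof (rule strict_monoI)
    fix x y :: real assume "x < y"
    then show "\<rho> x < \<rho> y" by (rule DERIV_pos_imp_increasing) (use der in blast)
  qed
  have int: "\<rho> s - s = \<rho> t - t" if "s - t \<in> \<int>" for s t
    by (rule periodic_Ints[of "\<lambda>t. \<rho> t - t"]) (simp_all add: per that)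
  have cont: "continuous_on UNIV \<rho>"
    using der by (meson DERIV_isCont continuous_at_imp_continuous_on)
  show "surj \<rho>"
  proof (unfold surj_def, intro allI)
    fix y
    \<comment> \<open>The values of \<open>\<rho>\<close> at \<open>n\<close> and
      \<open>n + 1\<close> exceed \<open>\<rho> 0\<close> by \<open>n\<close> and
      \<open>n + 1\<close>, so they enclose \<open>y\<close>.\<close>
    define n where "n = \<lfloor>y - \<rho> 0\<rfloor>"
    have "\<rho> (of_int n) = \<rho> 0 + of_int n" "\<rho> (of_int n + 1) = \<rho> 0 + of_int n + 1"
      using int[of "of_int n" 0] per[of "of_int n"] by auto
    moreover have "of_int n \<le> y - \<rho> 0" "y - \<rho> 0 \<le> of_int n + 1"
      by (simp_all add: n_def)
    ultimately have "\<exists>x \<ge> of_int n. x \<le> of_int n + 1 \<and> \<rho> x = y"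
      by (intro IVT') (auto intro: continuous_on_subset[OF cont])
    then show "\<exists>x. y = \<rho> x" by blast
  qed
qed

theorem heap_invariant_planar_isotopic:
  assumes D: "link_diagram D" and D': "link_diagram D'" and "planar_isotopic D D'"
  shows "heap_invariant \<psi> D' = heap_invariant \<psi> D"
proof -
  obtain H \<pi> \<rho> where n: "ncomp D' = ncomp D" and H: "ambient_isotopy H"
    and \<pi>: "bij_betw \<pi> {..<ncomp D} {..<ncomp D}"
    and \<rho>: "\<And>i t. i < ncomp D \<Longrightarrow> \<exists>d > 0. (\<rho> i has_real_derivative d) (at t)"
      "\<And>i t. i < ncomp D \<Longrightarrow> \<rho> i (t + 1) = \<rho> i t + 1"
    and cur: "\<And>i t. i < ncomp D \<Longrightarrow> curve D' i t = H 1 (curve D (\<pi> i) (\<rho> i t))"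
    and und: "\<And>i t. i < ncomp D \<Longrightarrow> (i, t) \<in> underpts D' \<longleftrightarrow> (\<pi> i, \<rho> i t) \<in> underpts D"
    using assms(3) unfolding planar_isotopic_def by blast
  have inj: "inj (H 1)" using H by (simp add: ambient_isotopy_def bij_def)
  have less: "\<pi> i < ncomp D" if "i < ncomp D" for i using \<pi> that by (auto simp: bij_betw_def)
  have vel: "\<exists>d > 0. velocity D' (i, t) = d *\<^sub>R h (velocity D (\<pi> i, \<rho> i t))"
    if i: "i < ncomp D" and h: "(H 1 has_derivative h) (at (pos D (\<pi> i, \<rho> i t)))" for i t h
  proof -
    obtain d where d: "d > 0" "(\<rho> i has_real_derivative d) (at t)" using \<rho>(1)[OF i] by blast
    have "(curve D (\<pi> i) \<circ> \<rho> i has_vector_derivative d *\<^sub>R velocity D (\<pi> i, \<rho> i t)) (at t)"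
      using d by (intro vector_diff_chain_at has_velocity[OF D less[OF i]])
        (simp add: has_real_derivative_iff_has_vector_derivative)
    then have "(curve D (\<pi> i) \<circ> \<rho> i has_derivative (\<lambda>s. s *\<^sub>R d *\<^sub>R velocity D (\<pi> i, \<rho> i t))) (at t)"
      by (simp add: has_vector_derivative_def)
    from diff_chain_at[OF this, of "H 1" h] h
    have "(H 1 \<circ> (curve D (\<pi> i) \<circ> \<rho> i) has_derivative h \<circ> (\<lambda>s. s *\<^sub>R d *\<^sub>R velocity D (\<pi> i, \<rho> i t))) (at t)"
      by (simp add: pos_def)
    moreover have "H 1 \<circ> (curve D (\<pi> i) \<circ> \<rho> i) = curve D' i" using cur[OF i] by auto
    moreover have "h \<circ> (\<lambda>s. s *\<^sub>R d *\<^sub>R velocity D (\<pi> i, \<rho> i t)) = (\<lambda>s. s *\<^sub>R d *\<^sub>R h (velocity D (\<pi> i, \<rho> i t)))"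
      using has_derivative_linear[OF h] by (auto simp: linear_scale)
    ultimately have "(curve D' i has_vector_derivative d *\<^sub>R h (velocity D (\<pi> i, \<rho> i t))) (at t)"
      by (simp add: has_vector_derivative_def)
    then have "velocity D' (i, t) = d *\<^sub>R h (velocity D (\<pi> i, \<rho> i t))"
      by (simp add: velocity_def vector_derivative_at)
    then show ?thesis using d by blast
  qed
  have meet: "pos D' (i, s) = pos D' (j, t) \<longleftrightarrow> pos D (\<pi> i, \<rho> i s) = pos D (\<pi> j, \<rho> j t)"
    if "i < ncomp D" "j < ncomp D" for i j s t
    using that inj by (simp add: pos_def cur inj_eq)
  have "reparametrization D D' \<pi> \<rho>"
  proof (unfold_locales, fact D, fact D', fact n, fact \<pi>)
    show "strict_mono (\<rho> i)" "surj (\<rho> i)" if "i < ncomp D" for i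
      using deriv_pos_strict_mono_surj[OF \<rho>[OF that]] .
    fix i j s t assume ij: "i < ncomp D" "j < ncomp D" and c: "crosses D' (i, s) (j, t)"
    define z where "z = pos D (\<pi> i, \<rho> i s)"
    \<comment> \<open>Both strands pass through the same point \<open>z\<close>, so a single
      differential \<open>h\<close> carries both velocities; the reparametrizations contribute
      positive factors \<open>d\<close> and \<open>e\<close>.\<close>
    have z: "z = pos D (\<pi> j, \<rho> j t)" using c meet[OF ij] by (simp add: z_def crosses_def)
    obtain h where h: "(H 1 has_derivative h) (at z)" "plane_det (h 1) (h \<i>) > 0"
      by (rule ambient_isotopy_derivative[OF H])
    obtain d e where d: "d > 0" "velocity D' (i, s) = d *\<^sub>R h (velocity D (\<pi> i, \<rho> i s))"
      and e: "e > 0" "velocity D' (j, t) = e *\<^sub>R h (velocity D (\<pi> j, \<rho> j t))"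
      using vel[OF ij(1)] vel[OF ij(2)] h(1) z z_def by metis
    let ?v = "velocity D (\<pi> i, \<rho> i s)" and ?w = "velocity D (\<pi> j, \<rho> j t)"
    have "plane_det (velocity D' (i, s)) (velocity D' (j, t)) = d * e * plane_det (h ?v) (h ?w)"
      unfolding d(2) e(2) by (simp add: plane_det_def algebra_simps)
    then have "plane_det (velocity D' (i, s)) (velocity D' (j, t)) = (d * e * plane_det (h 1) (h \<i>)) * plane_det ?v ?w"
      using plane_det_linear[OF has_derivative_linear[OF h(1)], of ?v ?w] by simp
    moreover have "0 < m * x \<longleftrightarrow> 0 < x" if "0 < m" for m x :: real
      using that by (simp add: zero_less_mult_iff)
    moreover have "0 < d * e * plane_det (h 1) (h \<i>)" using d e h by simp
    ultimately show "positive_crossing D' ((i, s), (j, t)) \<longleftrightarrow> positive_crossing D ((\<pi> i, \<rho> i s), (\<pi> j, \<rho> j t))"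
      by (simp add: positive_crossing_def)
  qed (use \<rho> und meet in auto)
  then show ?thesis by (rule reparametrization.heap_invariant_reparametrization)
qed

section \<open>Strands in the square\<close>

text \<open>Numbers the pieces of a strand that is cut at \<open>U\<close>. The inequality is
  strict, so a cut point is counted to the piece on its left.\<close>

definition below :: "real set \<Rightarrow> real \<Rightarrow> nat" where
  "below U t = card {u \<in> U. u < t}"

lemma eventually_below:
  assumes "finite U"
  shows "\<forall>\<^sub>F u in at_side b t. u \<notin> U \<and> below U u = (if t \<in> U \<and> \<not> b then Suc (below U t) else below U t)"
proof -
  have "\<forall>v \<in> U. \<forall>\<^sub>F u in at_side b t. v \<noteq> u \<and> (v < u \<longleftrightarrow> (if b then v < t else v \<le> t))"
  proof
    fix v
    have "\<forall>\<^sub>F u in at_side b t. (v < t \<longrightarrow> v < u) \<and> (t < v \<longrightarrow> u < v)"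
      by (intro eventually_conj) (cases v t rule: linorder_cases;
        auto intro: eventually_mono[OF eventually_at_side_interval[of v t "t + 1" b]]
          eventually_mono[OF eventually_at_side_interval[of "t - 1" t v b]])+
    then show "\<forall>\<^sub>F u in at_side b t. v \<noteq> u \<and> (v < u \<longleftrightarrow> (if b then v < t else v \<le> t))"
      using eventually_at_side_bound[of b t] by eventually_elim (auto split: if_splits)
  qed
  then have "\<forall>\<^sub>F u in at_side b t. \<forall>v \<in> U. v \<noteq> u \<and> (v < u \<longleftrightarrow> (if b then v < t else v \<le> t))"
    by (rule eventually_ball_finite[OF assms])
  then show ?thesis
  proof eventually_elim
    case (elim u)
    have "{v \<in> U. v < u} = {v \<in> U. if b then v < t else v \<le> t}"
      using elim by (intro Collect_cong) blast
    also have "\<dots> = (if t \<in> U \<and> \<not> b then insert t {v \<in> U. v < t} else {v \<in> U. v < t})"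
      by (cases b) (auto simp: order_le_less)
    finally have "below U u = (if t \<in> U \<and> \<not> b then Suc (below U t) else below U t)"
      using assms by (simp add: below_def)
    then show ?case using elim by blast
  qed
qed

lemma below_eq_imp_disjoint:
  assumes "finite U" "s \<le> t" "t \<notin> U" "below U s = below U t"
  shows "U \<inter> {s..t} = {}"
proof -
  have eq: "{u \<in> U. u < s} = {u \<in> U. u < t}"
    using assms by (intro card_subset_eq) (auto simp: below_def)
  have "u < s" if "u \<in> U" "u \<le> t" for u
  proof -
    have "u \<in> {u \<in> U. u < t}" using that assms(3) by (cases "u = t") auto
    then have "u \<in> {u \<in> U. u < s}" by (simp only: eq)
    then show ?thesis by simp
  qed
  then show ?thesis by fastforce
qed

lemma below_le_card: "finite U \<Longrightarrow> below U t \<le> card U"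
  by (auto simp: below_def intro: card_mono)

lemma Suc_below_le_card:
  assumes "finite U" "t \<in> U" shows "Suc (below U t) \<le> card U"
proof -
  have "card (insert t {u \<in> U. u < t}) \<le> card U" using assms by (intro card_mono) auto
  then show ?thesis using assms by (simp add: below_def)
qed

lemma below_0: "(\<And>u. u \<in> U \<Longrightarrow> t < u) \<Longrightarrow> below U t = 0"
proof -
  assume "\<And>u. u \<in> U \<Longrightarrow> t < u"
  then have "{u \<in> U. u < t} = {}" by (auto dest: less_asym)
  then show "below U t = 0" unfolding below_def by (simp only: card.empty)
qed

lemma below_all: "(\<And>u. u \<in> U \<Longrightarrow> u < t) \<Longrightarrow> below U t = card U"
  unfolding below_def by (rule arg_cong[of _ _ card]) auto

text \<open>A strand gives access to one parameter of each of its points; the local condition at the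
  other parameters follows by periodicity.\<close>

lemma local_coloring_shift:
  assumes D: "link_diagram D" and c: "periodic_on D c" and pq: "same_point (i, s) (i, t)" and i: "i < ncomp D"
    and ev: "\<forall>\<^sub>F u in at_side b s. c (i, u) = side_color b D c (i, s)"
  shows "\<forall>\<^sub>F u in at_side b t. c (i, u) = side_color b D c (i, t)"
proof -
  have pts: "(i, u) \<in> points D" for u using i by (simp add: points_def)
  have eq: "c (i, u + (s - t)) = c (i, u)" for u
    using pq by (intro periodic_onD[OF c pts]) (simp add: same_point_def)
  have "\<forall>\<^sub>F u in at_side b (t + (s - t)). c (i, u) = side_color b D c (i, s)" using ev by simp
  then show ?thesis
    unfolding eventually_at_side_shift eq using colors_same_point(1)[OF D c pts pq] by simp
qed

section \<open>A single diagram seen through the square\<close>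

type_synonym 'x segments = "nat \<Rightarrow> nat \<Rightarrow> 'x \<times> 'x"

text \<open>\<open>overlap\<close> states that different strand parameters are different points of
  the link, although one component may contain several strands; \<open>ends\<close> keeps the
  under-points in the interior of the strands. Both are derived from the explicit curves in
  \<open>tangle_pair_intro\<close>.\<close>

locale tangle =
  fixes D :: link_diag and m :: nat and S :: "nat \<Rightarrow> real \<Rightarrow> complex"
    and \<kappa> :: "nat \<Rightarrow> nat" and \<alpha> r :: "nat \<Rightarrow> real"
  assumes D: "link_diagram D"
    and comp: "\<And>k. k < m \<Longrightarrow> \<kappa> k < ncomp D" and r: "\<And>k. k < m \<Longrightarrow> r k \<noteq> 0"
    and pos: "\<And>k t. k < m \<Longrightarrow> t \<in> {-1..1} \<Longrightarrow> pos D (place \<kappa> \<alpha> r k t) = S k t"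
    and S: "\<And>k t. k < m \<Longrightarrow> t \<in> {-1..1} \<Longrightarrow> S k t \<in> square"
    and outside: "\<And>p. p \<in> points D \<Longrightarrow>
      (\<nexists>k t. k < m \<and> t \<in> {-1..1} \<and> same_point p (place \<kappa> \<alpha> r k t)) \<Longrightarrow> pos D p \<notin> square"
    and overlap: "\<And>k l s t. k < m \<Longrightarrow> l < m \<Longrightarrow> s \<in> {-1..1} \<Longrightarrow> t \<in> {-1..1} \<Longrightarrow>
      same_point (place \<kappa> \<alpha> r k s) (place \<kappa> \<alpha> r l t) \<Longrightarrow> k = l \<and> s = t"
    and ends: "\<And>k. k < m \<Longrightarrow> place \<kappa> \<alpha> r k (-1) \<notin> underpts D"
      "\<And>k. k < m \<Longrightarrow> place \<kappa> \<alpha> r k 1 \<notin> underpts D"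
begin

abbreviation pl :: "nat \<Rightarrow> real \<Rightarrow> nat \<times> real" where
  "pl \<equiv> place \<kappa> \<alpha> r"

definition U :: "nat \<Rightarrow> real set" where
  "U k = {t \<in> {-1..1}. pl k t \<in> underpts D}"

text \<open>The end points of the strands do not count as inner: their colors are shared by both
  diagrams and serve as boundary values.\<close>

definition inner :: "nat \<times> real \<Rightarrow> bool" where
  "inner p \<longleftrightarrow> (\<exists>k<m. \<exists>t. -1 < t \<and> t < 1 \<and> same_point p (pl k t))"

definition ov :: "nat \<Rightarrow> real \<Rightarrow> nat \<times> real" where
  "ov k t = (SOME z. fst z < m \<and> snd z \<in> {-1..1} \<and> crosses D (pl (fst z) (snd z)) (pl k t))"

text \<open>Whether strand \<open>k\<close>, traversed in the direction of its parameter (that is, from left to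
  right in the square), passes under from right to left at \<open>t\<close>.\<close>

definition rl :: "nat \<Rightarrow> real \<Rightarrow> bool" where
  "rl k t \<longleftrightarrow> (positive_crossing D (pl (fst (ov k t)) (snd (ov k t)), pl k t) \<longleftrightarrow> r k > 0)"

text \<open>The strands are described by \<open>y\<close>, where \<open>y k j\<close> is the color of piece \<open>j\<close> of strand \<open>k\<close>; the
  pieces are cut at the under-crossings and counted from the left, so that \<open>below (U k) t\<close> is the
  number of the piece ending at or containing \<open>t\<close>.\<close>

definition over_color :: "(nat \<Rightarrow> nat \<Rightarrow> 'b) \<Rightarrow> nat \<Rightarrow> real \<Rightarrow> 'b" where
  "over_color y k t = (case ov k t of (l, s) \<Rightarrow> y l (below (U l) s))"

definition sol :: "('x::group_add segments) \<Rightarrow> bool" where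
  "sol y \<longleftrightarrow> (\<forall>k<m. \<forall>t \<in> U k.
     y k (Suc (below (U k) t)) = slide (rl k t) (over_color y k t) (y k (below (U k) t)))"

text \<open>For \<open>r k < 0\<close> the strand is read against its orientation, which reverses
  every passage and so negates all its weights.\<close>

definition strand_weight ::
  "('x::group_add \<Rightarrow> 'x \<Rightarrow> 'x \<Rightarrow> 'a::ab_group_add) \<Rightarrow> nat \<Rightarrow> ('x segments) \<Rightarrow> 'a" where
  "strand_weight \<psi> n y = (\<Sum>k<m. \<Sum>t \<in> U k.
     let w = pass_weight \<psi> (rl k t) n (over_color y k t) (y k (below (U k) t))
     in if r k > 0 then w else - w)"

definition describes :: "(nat \<Rightarrow> nat \<Rightarrow> 'b) \<Rightarrow> (nat \<times> real \<Rightarrow> 'b) \<Rightarrow> bool" where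
  "describes y c \<longleftrightarrow> (\<forall>k<m. \<forall>t \<in> {-1..1}. t \<notin> U k \<longrightarrow> c (pl k t) = y k (below (U k) t))"

lemma pl_points [simp]: "k < m \<Longrightarrow> pl k t \<in> points D"
  by (simp add: place_def points_def comp)

lemma finite_U: 
  assumes "k < m" shows "finite (U k)"
proof (rule finite_subset)
  show "U k \<subseteq> (\<lambda>s. (s - \<alpha> k) / r k) ` {s \<in> {\<alpha> k - \<bar>r k\<bar>..\<alpha> k + \<bar>r k\<bar>}. (\<kappa> k, s) \<in> underpts D}"
  proof
    fix t assume t: "t \<in> U k"
    then have "\<bar>r k * t\<bar> \<le> \<bar>r k\<bar> * 1" unfolding abs_mult by (intro mult_left_mono) (auto simp: U_def)
    then show "t \<in> (\<lambda>s. (s - \<alpha> k) / r k) ` {s \<in> {\<alpha> k - \<bar>r k\<bar>..\<alpha> k + \<bar>r k\<bar>}. (\<kappa> k, s) \<in> underpts D}"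
      using t r[OF assms] by (intro image_eqI[of _ _ "\<alpha> k + r k * t"]) (auto simp: U_def place_def)
  qed
qed (use finite_underpts_interval[OF D] in blast)

lemma U_interior: "k < m \<Longrightarrow> t \<in> U k \<Longrightarrow> -1 < t \<and> t < 1"
proof -
  assume k: "k < m" and t: "t \<in> U k"
  have "t \<noteq> -1" "t \<noteq> 1" using ends[OF k] t by (auto simp: U_def)
  then show "-1 < t \<and> t < 1" using t by (simp add: U_def)
qed

text \<open>The over-strand at a crossing in the square cannot belong to the rest of the diagram,
  which avoids the square.\<close>

lemma crosses_strand:
  assumes "k < m" "t \<in> {-1..1}" "crosses D p (pl k t)"
  shows "\<exists>l<m. \<exists>s \<in> {-1..1}. same_point p (pl l s)"
  using assms outside[of p] pos[OF assms(1,2)] S[OF assms(1,2)] unfolding crosses_def by metis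

lemma ov:
  assumes "k < m" "t \<in> U k"
  shows "fst (ov k t) < m" "snd (ov k t) \<in> {-1..1}" "crosses D (pl (fst (ov k t)) (snd (ov k t))) (pl k t)"
    "snd (ov k t) \<notin> U (fst (ov k t))"
proof -
  have t: "t \<in> {-1..1}" "pl k t \<in> underpts D" using assms by (auto simp: U_def)
  obtain p where p: "crosses D p (pl k t)" using crosses_over_point[OF D t(2)] by blast
  obtain l s where ls: "l < m" "s \<in> {-1..1}" "same_point p (pl l s)"
    using crosses_strand[OF assms(1) t(1) p] by blast
  have "crosses D (pl l s) (pl k t)" using crosses_same_point[OF D p ls(3) same_point_refl] .
  then have "fst (l, s) < m \<and> snd (l, s) \<in> {-1..1} \<and> crosses D (pl (fst (l, s)) (snd (l, s))) (pl k t)"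
    using ls by simp
  then have *: "fst (ov k t) < m \<and> snd (ov k t) \<in> {-1..1} \<and> crosses D (pl (fst (ov k t)) (snd (ov k t))) (pl k t)"
    unfolding ov_def by (rule someI)
  then show "fst (ov k t) < m" "snd (ov k t) \<in> {-1..1}" "crosses D (pl (fst (ov k t)) (snd (ov k t))) (pl k t)"
    by auto
  then show "snd (ov k t) \<notin> U (fst (ov k t))"
    using crosses_not_under[OF D] by (auto simp: U_def)
qed

lemma ov_eqI:
  assumes "k < m" "t \<in> U k" "l < m" "s \<in> {-1..1}" "crosses D (pl l s) (pl k t)"
  shows "ov k t = (l, s)"
  using overlap[OF ov(1)[OF assms(1,2)] assms(3) ov(2)[OF assms(1,2)] assms(4)]
    crosses_unique[OF D ov(3)[OF assms(1,2)] assms(5)] by (simp add: prod_eq_iff)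

text \<open>Side \<open>b\<close> refers to the parameter of the strand, whereas
  \<open>side_color\<close> refers to the orientation; the two disagree when
  \<open>r k < 0\<close>.\<close>

definition strand_color :: "bool \<Rightarrow> (nat \<times> real \<Rightarrow> 'x::group_add \<times> 'x) \<Rightarrow> nat \<Rightarrow> real \<Rightarrow> 'x \<times> 'x" where
  "strand_color b c k t = side_color (b = (r k > 0)) D c (pl k t)"

lemma strand_local:
  assumes "k < m"
  shows "(\<forall>b. \<forall>\<^sub>F u in at_side b (snd (pl k t)). c (\<kappa> k, u) = side_color b D c (pl k t)) \<longleftrightarrow>
    (\<forall>b. \<forall>\<^sub>F u in at_side b t. c (pl k u) = strand_color b c k t)"
  by (cases "r k > 0")
    (auto simp: all_bool_eq strand_color_def place_def eventually_at_side_affine[OF r[OF assms]])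

lemma strand_colors:
  assumes c: "periodic_on D c" and k: "k < m"
  shows "t \<in> {-1..1} \<Longrightarrow> t \<notin> U k \<Longrightarrow> strand_color b c k t = c (pl k t)"
    and "t \<in> U k \<Longrightarrow> strand_color b c k t =
      (if b = rl k t then c (pl k t) else slide True (c (pl (fst (ov k t)) (snd (ov k t)))) (c (pl k t)))"
proof -
  show "strand_color b c k t = c (pl k t)" if "t \<in> {-1..1}" "t \<notin> U k"
    using that colors_not_under[of "pl k t" D b c] by (simp add: strand_color_def U_def side_color_def)
  show "strand_color b c k t =
      (if b = rl k t then c (pl k t) else slide True (c (pl (fst (ov k t)) (snd (ov k t)))) (c (pl k t)))"
    if "t \<in> U k"
    by (auto simp: strand_color_def rl_def colors_crosses(1)[OF D c ov(3)[OF k that]])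
qed

lemma strand_const:
  assumes c: "c \<in> point_colorings D" and k: "k < m" and st: "s \<in> {-1..1}" "t \<in> {-1..1}"
    and U: "s \<notin> U k" "t \<notin> U k" "below (U k) s = below (U k) t"
  shows "c (pl k s) = c (pl k t)"
proof -
  have *: "c (pl k s) = c (pl k t)" if st: "s \<le> t" "s \<in> {-1..1}" "t \<in> {-1..1}"
    and U: "s \<notin> U k" "t \<notin> U k" "below (U k) s = below (U k) t" for s t
    unfolding place_def
  proof (rule point_colorings_const[OF c comp[OF k]], intro ballI)
    have disj: "U k \<inter> {s..t} = {}" using below_eq_imp_disjoint finite_U[OF k] st U by blast
    fix x assume "x \<in> closed_segment (\<alpha> k + r k * s) (\<alpha> k + r k * t)"
    then obtain u where u: "0 \<le> u" "u \<le> 1" "x = (1 - u) * (\<alpha> k + r k * s) + u * (\<alpha> k + r k * t)"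
      by (auto simp: closed_segment_def)
    define v where "v = s + u * (t - s)"
    have "x = \<alpha> k + r k * v" unfolding u(3) v_def by (simp add: algebra_simps)
    moreover have "s \<le> v" using u st by (simp add: v_def)
    moreover have "v \<le> t" using u st mult_right_mono[of u 1 "t - s"] by (simp add: v_def)
    moreover from this have "v \<notin> U k" "v \<in> {-1..1}" using disj \<open>s \<le> v\<close> st by auto
    ultimately show "(\<kappa> k, x) \<notin> underpts D" by (simp add: U_def place_def)
  qed
  show ?thesis
  proof (cases "s \<le> t")
    case True
    then show ?thesis using st U by (intro *)
  next
    case False
    then show ?thesis using st U by (intro *[symmetric]) simp_all
  qed
qed

lemma describes_exists:
  assumes c: "c \<in> point_colorings D"
  obtains y where "describes y c"
proof -
  \<comment> \<open>Any point of piece \<open>j\<close> will do, since the coloring is constant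
    there by \<open>strand_const\<close>; for numbers that do not occur the value is
    arbitrary.\<close>
  define y where "y k j = c (pl k (SOME t. t \<in> {-1..1} \<and> t \<notin> U k \<and> below (U k) t = j))" for k j
  have "describes y c"
    unfolding describes_def
  proof (intro allI impI ballI)
    fix k t assume k: "k < m" and t: "t \<in> {-1..1}" "t \<notin> U k"
    let ?P = "\<lambda>u. u \<in> {-1..1} \<and> u \<notin> U k \<and> below (U k) u = below (U k) t"
    have "?P (SOME u. ?P u)" using t by (intro someI[of ?P t]) simp
    then show "c (pl k t) = y k (below (U k) t)"
      unfolding y_def using t by (intro strand_const[OF c k]) auto
  qed
  then show ?thesis by (rule that)
qed

lemma describes_ends:
  assumes "describes y c" "k < m"
  shows "c (pl k (-1)) = y k 0" "c (pl k 1) = y k (card (U k))"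
proof -
  have "below (U k) (-1) = 0" "below (U k) 1 = card (U k)"
    using U_interior[OF assms(2)] by (auto intro: below_0 below_all)
  moreover have "-1 \<notin> U k" "1 \<notin> U k" using U_interior[OF assms(2)] by blast+
  ultimately show "c (pl k (-1)) = y k 0" "c (pl k 1) = y k (card (U k))"
    using assms by (auto simp: describes_def)
qed

lemma eventually_strand:
  assumes "k < m" "-1 < t" "t < 1"
  shows "\<forall>\<^sub>F u in at_side b t. -1 < u \<and> u < 1 \<and> u \<notin> U k \<and>
    below (U k) u = (if t \<in> U k \<and> \<not> b then Suc (below (U k) t) else below (U k) t)"
  using eventually_below[OF finite_U[OF assms(1)], of t b] eventually_at_side_interval[OF assms(2,3), of b]
  by eventually_elim simp

lemma describes_strand_color:
  assumes c: "c \<in> point_colorings D" and y: "describes y c" and k: "k < m" and t: "t \<in> U k"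
  shows "strand_color b c k t = y k (if b then below (U k) t else Suc (below (U k) t))"
proof -
  note t' = U_interior[OF k t, THEN conjunct1] U_interior[OF k t, THEN conjunct2]
  have "\<forall>\<^sub>F u in at_side b t. c (pl k u) = strand_color b c k t"
    using strand_local[OF k, where c=c and t=t] point_colorings_local[OF c comp[OF k], of _ "snd (pl k t)"]
    by (simp add: place_def)
  then have "\<forall>\<^sub>F u in at_side b t. strand_color b c k t = y k (if b then below (U k) t else Suc (below (U k) t))"
    using eventually_strand[OF k t', of b]
    by eventually_elim (use y k t in \<open>force simp: describes_def\<close>)
  then show ?thesis by simp
qed

lemma describes_over_color:
  assumes "describes y c" "k < m" "t \<in> U k"
  shows "c (pl (fst (ov k t)) (snd (ov k t))) = over_color y k t"
  using assms ov[OF assms(2,3)] by (simp add: over_color_def describes_def split: prod.split)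

lemma describes_under:
  assumes c: "c \<in> point_colorings D" and y: "describes y c" and k: "k < m" and t: "t \<in> U k"
  shows "c (pl k t) = (if rl k t then y k (below (U k) t) else y k (Suc (below (U k) t)))"
  using strand_colors(2)[OF point_colorings_periodic[OF c] k t, of "rl k t"]
    describes_strand_color[OF assms, of "rl k t"]
  by (cases "rl k t") simp_all

lemma describes_sol:
  assumes c: "c \<in> point_colorings D" and y: "describes y c"
  shows "sol y"
  unfolding sol_def
proof (intro allI impI ballI)
  fix k t assume k: "k < m" and t: "t \<in> U k"
  show "y k (Suc (below (U k) t)) = slide (rl k t) (over_color y k t) (y k (below (U k) t))"
    using strand_colors(2)[OF point_colorings_periodic[OF c] k t, of True]
      strand_colors(2)[OF point_colorings_periodic[OF c] k t, of False] describes_over_color[OF y k t]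
      describes_strand_color[OF c y k t, of True] describes_strand_color[OF c y k t, of False]
    by (cases "rl k t") simp_all
qed

lemma point_weight_strand:
  assumes c: "c \<in> point_colorings D" and y: "describes y c" and k: "k < m" and t: "t \<in> U k"
  shows "point_weight \<psi> D n c (pl k t) =
    (let w = pass_weight \<psi> (rl k t) n (over_color y k t) (y k (below (U k) t))
     in if r k > 0 then w else - w)"
proof -
  note per = point_colorings_periodic[OF c]
  have s: "y k (Suc (below (U k) t)) = slide (rl k t) (over_color y k t) (y k (below (U k) t))"
    using describes_sol[OF c y] k t by (simp add: sol_def)
  show ?thesis
    unfolding colors_crosses(2)[OF D per ov(3)[OF k t]] describes_over_color[OF y k t]
      describes_under[OF c y k t] s
    by (auto simp: pass_weight_def rl_def Let_def)
qed

lemma colorings_eqI: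
  assumes c: "c \<in> point_colorings D" "c' \<in> point_colorings D"
    and y: "describes y c" "describes y' c'"
    and eq: "\<And>k j. k < m \<Longrightarrow> j \<le> card (U k) \<Longrightarrow> y k j = y' k j"
    and out: "\<And>p. p \<in> points D \<Longrightarrow> \<not> inner p \<Longrightarrow> c p = c' p"
  shows "c = c'"
proof
  fix p
  show "c p = c' p"
  proof (cases "p \<in> points D \<and> inner p")
    case True
    then obtain k t where k: "k < m" and t: "-1 < t" "t < 1" and p: "same_point p (pl k t)"
      by (auto simp: inner_def)
    have "c (pl k t) = c' (pl k t)"
    proof (cases "t \<in> U k")
      case True
      then show ?thesis
        using describes_under[OF c(1) y(1) k True] describes_under[OF c(2) y(2) k True]
          eq[OF k below_le_card[OF finite_U[OF k]]] eq[OF k Suc_below_le_card[OF finite_U[OF k] True]]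
        by simp
    next
      case False
      then show ?thesis
        using y k t eq[OF k below_le_card[OF finite_U[OF k]]] by (simp add: describes_def)
    qed
    then show ?thesis using p True c[THEN point_colorings_periodic, THEN periodic_onD] by metis
  next
    case False
    then show ?thesis using out c[THEN point_colorings_undefined] by metis
  qed
qed

lemma inner_same_point: "same_point p q \<Longrightarrow> inner p \<longleftrightarrow> inner q"
  unfolding inner_def by (meson same_point_sym same_point_trans)

lemma not_inner_ends:
  assumes "k < m" shows "\<not> inner (pl k (-1))" "\<not> inner (pl k 1)"
proof -
  have "\<not> inner (pl k s)" if "s \<in> {-1, 1}" for s
  proof
    assume "inner (pl k s)"
    then obtain l t where "l < m" "-1 < t" "t < 1" "same_point (pl k s) (pl l t)"
      unfolding inner_def by blast
    then show False using overlap[of k l s t] assms that by auto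
  qed
  then show "\<not> inner (pl k (-1))" "\<not> inner (pl k 1)" by simp_all
qed

text \<open>Colorings are compared through their systems of piece colors. If such a system is
  determined by its end colors, agreement outside the square forces equality.\<close>

lemma colorings_eqI_sol:
  fixes c c' :: "nat \<times> real \<Rightarrow> 'x::group_add \<times> 'x"
  assumes c: "c \<in> point_colorings D" "c' \<in> point_colorings D"
    and out: "\<And>p. p \<in> points D \<Longrightarrow> \<not> inner p \<Longrightarrow> c p = c' p"
    and unique: "\<And>(y :: 'x segments) y'. sol y \<Longrightarrow> sol y' \<Longrightarrow>
      \<forall>k<m. y k 0 = y' k 0 \<and> y k (card (U k)) = y' k (card (U k)) \<Longrightarrow>
      \<forall>k<m. \<forall>j \<le> card (U k). y k j = y' k j"
  shows "c = c'"
proof -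
  obtain y where y: "describes y c" by (rule describes_exists[OF c(1)])
  obtain y' where y': "describes y' c'" by (rule describes_exists[OF c(2)])
  have "\<forall>k<m. y k 0 = y' k 0 \<and> y k (card (U k)) = y' k (card (U k))"
    using describes_ends[OF y] describes_ends[OF y'] not_inner_ends out pl_points by metis
  from unique[OF describes_sol[OF c(1) y] describes_sol[OF c(2) y'] this]
  show ?thesis using colorings_eqI[OF c y y' _ out] by blast
qed

text \<open>The under-points are split into inner and other ones; modulo 1, the inner ones
  correspond bijectively to the cuts of the strands.\<close>

lemma total_weight_tangle:
  assumes c: "c \<in> point_colorings D" and y: "describes y c"
  shows "total_weight \<psi> D n c =
    (\<Sum>q \<in> {q \<in> unit_underpts D. \<not> inner q}. point_weight \<psi> D n c q) + strand_weight \<psi> n y"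
proof -
  note per = point_colorings_periodic[OF c]
  define Q where "Q = (\<lambda>(k, t). normal_point (pl k t)) ` Sigma {..<m} U"
  have "unit_underpts D = {q \<in> unit_underpts D. \<not> inner q} \<union> Q"
  proof (intro equalityI subsetI)
    fix q assume q: "q \<in> unit_underpts D"
    show "q \<in> {q \<in> unit_underpts D. \<not> inner q} \<union> Q"
    proof (cases "inner q")
      case True
      then obtain k t where k: "k < m" "-1 < t" "t < 1" "same_point q (pl k t)"
        by (auto simp: inner_def)
      have "pl k t \<in> underpts D" using q k underpts_same_point[OF D k(4)] by (simp add: unit_underpts_def)
      moreover have "q = normal_point (pl k t)"
        using q k same_point_trans[OF k(4) same_point_normal(1)]
        by (intro same_point_unit_eq) (simp_all add: unit_underpts_def)
      ultimately show ?thesis using k by (auto simp: Q_def U_def)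
    qed (use q in auto)
  next
    fix q assume q: "q \<in> {q \<in> unit_underpts D. \<not> inner q} \<union> Q"
    show "q \<in> unit_underpts D"
    proof (cases "q \<in> Q")
      case True
      then obtain k t where "t \<in> U k" "q = normal_point (pl k t)" by (auto simp: Q_def)
      then show ?thesis
        using underpts_same_point[OF D same_point_normal(1), of "pl k t"]
        by (simp add: U_def unit_underpts_def)
    qed (use q in auto)
  qed
  moreover have "{q \<in> unit_underpts D. \<not> inner q} \<inter> Q = {}"
  proof -
    have "inner (normal_point (pl k t))" if "k < m" "t \<in> U k" for k t
      using U_interior[OF that] that same_point_normal(2) unfolding inner_def by blast
    then show ?thesis by (auto simp: Q_def)
  qed
  moreover have "finite Q" using finite_U by (auto simp: Q_def)
  moreover have "finite {q \<in> unit_underpts D. \<not> inner q}" using finite_unit_underpts[OF D] by simp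
  ultimately have "total_weight \<psi> D n c =
    (\<Sum>q \<in> {q \<in> unit_underpts D. \<not> inner q}. point_weight \<psi> D n c q) + (\<Sum>q \<in> Q. point_weight \<psi> D n c q)"
    unfolding total_weight_def by (metis (no_types, lifting) sum.union_disjoint)
  also have "inj_on (\<lambda>(k, t). normal_point (pl k t)) (Sigma {..<m} U)"
  proof (rule inj_onI, clarify)
    fix k t l s assume h: "k < m" "t \<in> U k" "l < m" "s \<in> U l" "normal_point (pl k t) = normal_point (pl l s)"
    have "same_point (pl k t) (pl l s)"
      using h(5) by (metis same_point_normal same_point_trans)
    from overlap[OF h(1,3) _ _ this] h(2,4) show "k = l \<and> t = s" by (simp add: U_def)
  qed
  then have "(\<Sum>q \<in> Q. point_weight \<psi> D n c q) = (\<Sum>(k, t) \<in> Sigma {..<m} U. point_weight \<psi> D n c (normal_point (pl k t)))"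
    unfolding Q_def by (subst sum.reindex) (auto simp: case_prod_unfold)
  also have "\<dots> = (\<Sum>k<m. \<Sum>t \<in> U k. point_weight \<psi> D n c (normal_point (pl k t)))"
    using finite_U by (subst sum.Sigma) auto
  also have "\<dots> = strand_weight \<psi> n y"
    unfolding strand_weight_def
  proof (intro sum.cong refl)
    fix k t assume "k \<in> {..<m}" and t: "t \<in> U k"
    then have k: "k < m" by simp
    have "point_weight \<psi> D n c (normal_point (pl k t)) = point_weight \<psi> D n c (pl k t)"
      by (rule colors_same_point(2)[OF D per pl_points[OF k] same_point_normal(1), symmetric])
        (use t in \<open>simp add: U_def\<close>)
    then show "point_weight \<psi> D n c (normal_point (pl k t)) =
      (let w = pass_weight \<psi> (rl k t) n (over_color y k t) (y k (below (U k) t)) in if r k > 0 then w else - w)"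
      using point_weight_strand[OF c y k t] by simp
  qed
  finally show ?thesis .
qed

end

section \<open>Two diagrams that differ only inside the square\<close>

lemma closed_square: "closed square"
proof -
  have eq: "square = {z. \<bar>Re z\<bar> \<le> 1} \<inter> {z. \<bar>Im z\<bar> \<le> 1}" by (auto simp: square_def)
  show ?thesis
    unfolding eq by (intro closed_Int closed_Collect_le continuous_intros)
qed

locale tangle_pair = T: tangle D m S \<kappa> \<alpha> r + T': tangle D' m S' \<kappa> \<alpha> r
  for D D' m S S' \<kappa> \<alpha> r +
  assumes ncomp: "ncomp D' = ncomp D"
    and off: "\<And>p. p \<in> points D \<Longrightarrow>
      (\<nexists>k t. k < m \<and> t \<in> {-1..1} \<and> same_point p (place \<kappa> \<alpha> r k t)) \<Longrightarrow>
      pos D' p = pos D p \<and> (p \<in> underpts D' \<longleftrightarrow> p \<in> underpts D)"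
begin

lemma points_eq: "points D' = points D"
  by (simp add: points_def ncomp)

text \<open>Lets statements proved from \<open>D\<close> to \<open>D'\<close> be reused in the other
  direction.\<close>

lemma flip: "tangle_pair D' D m S' S \<kappa> \<alpha> r"
proof (unfold_locales)
  show "ncomp D = ncomp D'" by (simp add: ncomp)
  show "pos D p = pos D' p \<and> (p \<in> underpts D \<longleftrightarrow> p \<in> underpts D')"
    if "p \<in> points D'" "\<nexists>k t. k < m \<and> t \<in> {-1..1} \<and> same_point p (T.pl k t)" for p
    using off[of p] that by (simp add: points_eq)
qed

lemma not_strand:
  assumes "p \<in> points D" "pos D p \<notin> square" "k < m" "t \<in> {-1..1}"
  shows "\<not> same_point p (T.pl k t)"
  using pos_same_point[OF T.D assms(1), of "T.pl k t"] T.pos[OF assms(3,4)] T.S[OF assms(3,4)] assms(2)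
  by auto

lemma off_square:
  assumes "p \<in> points D" "pos D p \<notin> square"
  shows "pos D' p = pos D p" "p \<in> underpts D' \<longleftrightarrow> p \<in> underpts D"
  using off[OF assms(1)] not_strand[OF assms] by blast+

text \<open>The square is closed, so the two curves agree in a neighborhood of the parameter and not
  merely at it.\<close>

lemma velocity_off:
  assumes "p \<in> points D" "pos D p \<notin> square"
  shows "velocity D' p = velocity D p"
proof -
  obtain i t where p: "p = (i, t)" by force
  have i: "i < ncomp D" using assms by (simp add: p points_def)
  have cont: "continuous_on UNIV (curve D i)"
    using has_velocity[OF T.D i] by (meson continuous_at_imp_continuous_on has_vector_derivative_continuous)
  define V where "V = {s. curve D i s \<notin> square}"
  have "open V"
    using open_vimage[OF open_Compl[OF closed_square] cont] by (simp add: V_def vimage_def Compl_eq)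
  moreover have "t \<in> V" using assms(2) by (simp add: V_def p pos_def)
  moreover have "curve D i s = curve D' i s" if "s \<in> V" for s
    using off_square(1)[of "(i, s)"] i that by (simp add: V_def pos_def points_def)
  ultimately have "(curve D' i has_vector_derivative velocity D (i, t)) (at t)"
    using has_vector_derivative_transform_within_open[OF has_velocity[OF T.D i]] by blast
  then show ?thesis
    by (simp add: p velocity_def vector_derivative_at)
qed

text \<open>The strand ends are not under-points, so an under-point on a strand would be
  inner.\<close>

lemma under_off:
  assumes "q \<in> underpts D" "\<not> T.inner q"
  shows "pos D q \<notin> square"
proof (rule T.outside)
  show "q \<in> points D" using assms underpts_points[OF T.D] by blast
  show "\<nexists>k t. k < m \<and> t \<in> {-1..1} \<and> same_point q (T.pl k t)"
  proof
    assume "\<exists>k t. k < m \<and> t \<in> {-1..1} \<and> same_point q (T.pl k t)"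
    then obtain k t where kt: "k < m" "t \<in> {-1..1}" "same_point q (T.pl k t)" by blast
    then have "t \<in> T.U k" using assms underpts_same_point[OF T.D kt(3)] by (simp add: T.U_def)
    then show False using T.U_interior[OF kt(1)] assms(2) kt unfolding T.inner_def by blast
  qed
qed

lemma crosses_off:
  assumes q: "q \<in> underpts D" "\<not> T.inner q" and pq: "crosses D p q"
  shows "crosses D' p q" "positive_crossing D' (p, q) = positive_crossing D (p, q)" "\<not> T.inner p"
proof -
  have qs: "pos D q \<notin> square" using under_off[OF q] .
  have p: "p \<in> points D" "pos D p = pos D q" "q \<in> points D"
    using pq underpts_points[OF T.D q(1)] by (auto simp: crosses_def)
  have ps: "pos D p \<notin> square" using qs p by simp
  show "crosses D' p q"
    using pq off_square[OF p(1) ps] off_square[OF p(3) qs] by (simp add: crosses_def points_eq)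
  show "positive_crossing D' (p, q) = positive_crossing D (p, q)"
    using velocity_off[OF p(1) ps] velocity_off[OF p(3) qs] by (simp add: positive_crossing_def)
  show "\<not> T.inner p" using not_strand[OF p(1) ps] unfolding T.inner_def by (auto simp: less_imp_le)
qed

lemma under_off_iff:
  assumes "q \<in> points D" "\<not> T.inner q"
  shows "q \<in> underpts D' \<longleftrightarrow> q \<in> underpts D"
proof
  assume "q \<in> underpts D"
  then show "q \<in> underpts D'" using off_square(2)[OF assms(1)] under_off assms(2) by blast
next
  assume q: "q \<in> underpts D'"
  interpret F: tangle_pair D' D m S' S \<kappa> \<alpha> r by (rule flip)
  show "q \<in> underpts D" using F.off_square(2)[of q] F.under_off[OF q] assms by (simp add: points_eq q)
qed

definition agree :: "(nat \<times> real \<Rightarrow> 'b) \<Rightarrow> (nat \<times> real \<Rightarrow> 'b) \<Rightarrow> bool" where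
  "agree c c' \<longleftrightarrow> (\<forall>p \<in> points D. \<not> T.inner p \<longrightarrow> c p = c' p)"

lemma colors_off:
  assumes c: "periodic_on D c" "periodic_on D' c'" and cc': "agree c c'"
    and q: "q \<in> points D" "\<not> T.inner q"
  shows "side_color b D' c' q = side_color b D c q"
    "q \<in> underpts D \<Longrightarrow> point_weight \<psi> D' n c' q = point_weight \<psi> D n c q"
proof -
  have cq: "c' q = c q" using cc' q by (simp add: agree_def)
  have *: "side_color b D' c' q = side_color b D c q \<and>
    point_weight \<psi> D' n c' q = point_weight \<psi> D n c q" if u: "q \<in> underpts D"
  proof -
    define p where "p = over_point D q"
    have p: "crosses D p q" unfolding p_def by (rule crosses_over_point[OF T.D u])
    note off = crosses_off[OF u q(2) p]
    have cp: "c' p = c p" using cc' p off(3) by (simp add: agree_def crosses_def)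
    show ?thesis
      unfolding colors_crosses[OF T.D c(1) p] colors_crosses[OF T'.D c(2) off(1)] cp cq off(2) by simp
  qed
  have nu: "q \<notin> underpts D'" if "q \<notin> underpts D" using under_off_iff[OF q] that by simp
  show "side_color b D' c' q = side_color b D c q"
    using * nu colors_not_under[of q D b c] colors_not_under[of q D' b c'] cq by (cases "q \<in> underpts D") simp_all
  show "q \<in> underpts D \<Longrightarrow> point_weight \<psi> D' n c' q = point_weight \<psi> D n c q" using * by blast
qed

definition same_ends :: "(nat \<Rightarrow> nat \<Rightarrow> 'b) \<Rightarrow> (nat \<Rightarrow> nat \<Rightarrow> 'b) \<Rightarrow> bool" where
  "same_ends y y' \<longleftrightarrow> (\<forall>k<m. y k 0 = y' k 0 \<and> y k (card (T.U k)) = y' k (card (T'.U k)))"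

text \<open>A uniform margin between the cuts and the strand ends. In \<open>extend\<close> it gives
  room near the ends in which no color changes.\<close>

lemma U_bound:
  obtains \<delta> where "0 < \<delta>" "\<delta> < 1" "\<And>k u. k < m \<Longrightarrow> u \<in> T.U k \<union> T'.U k \<Longrightarrow> \<bar>u\<bar> \<le> \<delta>"
proof -
  define W where "W = insert (1/2) (abs ` (\<Union>k<m. T.U k \<union> T'.U k))"
  have fin: "finite W" using T.finite_U T'.finite_U by (auto simp: W_def)
  have ne: "W \<noteq> {}" by (simp add: W_def)
  have W1: "w < 1" if "w \<in> W" for w
    using that T.U_interior T'.U_interior by (force simp: W_def)
  have "1/2 \<le> Max W" by (intro Max_ge fin) (simp add: W_def)
  moreover have "Max W < 1" using Max_in[OF fin ne] W1 by blast
  moreover have "\<bar>u\<bar> \<le> Max W" if "k < m" "u \<in> T.U k \<union> T'.U k" for k u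
    by (intro Max_ge fin) (use that in \<open>auto simp: W_def\<close>)
  ultimately show ?thesis using that[of "Max W"] by auto
qed

text \<open>Outside the square the coloring \<open>c\<close> is kept, inside it is replaced by the
  colors \<open>y'\<close>. At inner points the local condition is the system \<open>sol\<close>; at
  all other points it is inherited from \<open>c\<close>, for which the two descriptions must fit
  together near the strand ends.\<close>

lemma extend:
  fixes c :: "nat \<times> real \<Rightarrow> 'x::group_add \<times> 'x"
  assumes c: "c \<in> point_colorings D" and y: "T.describes y c"
    and y': "T'.sol y'" and ends: "same_ends y y'"
  obtains c' where "c' \<in> point_colorings D'" "agree c c'" "T'.describes y' c'"
proof -
  let ?pl = "T.pl"
  \<comment> \<open>At a cut the conventional color is the one on the right of the over-strand: the
    color before the cut if the strand passes from right to left, and the color after it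
    otherwise.\<close>
  define val where "val k t = (if t \<in> T'.U k \<and> \<not> T'.rl k t then y' k (Suc (below (T'.U k) t))
    else y' k (below (T'.U k) t))" for k t
  \<comment> \<open>An inner point is a translate of a strand parameter, and \<open>overlap\<close>
    makes the chosen value unique.\<close>
  define c' where "c' p = (if T.inner p
    then SOME v. \<exists>k t. k < m \<and> -1 < t \<and> t < 1 \<and> same_point p (?pl k t) \<and> v = val k t else c p)" for p
  have inner: "c' p = val k t" if k: "k < m" and t: "-1 < t" "t < 1" and p: "same_point p (?pl k t)" for p k t
  proof -
    have "v = val k t" if v: "\<exists>k t. k < m \<and> -1 < t \<and> t < 1 \<and> same_point p (?pl k t) \<and> v = val k t" for v
    proof -
      obtain l s where ls: "l < m" "-1 < s" "s < 1" "same_point p (?pl l s)" "v = val l s" using v by blast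
      have "same_point (?pl l s) (?pl k t)"
        by (rule same_point_trans[OF same_point_sym[OF ls(4)] p])
      then have "l = k \<and> s = t" by (rule T.overlap[rotated 4]) (use k t ls in auto)
      then show ?thesis using ls by simp
    qed
    moreover have "\<exists>l s. l < m \<and> -1 < s \<and> s < 1 \<and> same_point p (?pl l s) \<and> val k t = val l s"
      using k t p by blast
    ultimately have "(SOME v. \<exists>k t. k < m \<and> -1 < t \<and> t < 1 \<and> same_point p (?pl k t) \<and> v = val k t) = val k t"
      by (intro some_equality)
    moreover have "T.inner p" using k t p unfolding T.inner_def by blast
    ultimately show ?thesis by (simp add: c'_def)
  qed
  have not_inner: "c' p = c p" if "\<not> T.inner p" for p using that by (simp add: c'_def)
  have agree: "agree c c'" by (simp add: agree_def not_inner)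
  note per = point_colorings_periodic[OF c]
  have per': "periodic_on D' c'"
    unfolding periodic_on_def points_eq
  proof (intro allI impI)
    fix p q assume p: "p \<in> points D" and pq: "same_point p q"
    show "c' p = c' q"
    proof (cases "T.inner p")
      case True
      then obtain k t where kt: "k < m" "-1 < t" "t < 1" "same_point p (?pl k t)"
        unfolding T.inner_def by blast
      then have "same_point q (?pl k t)" using pq same_point_sym same_point_trans by blast
      then show ?thesis using inner kt by simp
    next
      case False
      then have "c' q = c q" using T.inner_same_point[OF pq] not_inner by simp
      moreover have "c p = c q" using per p pq unfolding periodic_on_def by blast
      ultimately show ?thesis using not_inner[OF False] by simp
    qed
  qed
  have desc: "T'.describes y' c'"
    unfolding T'.describes_def
  proof (intro allI impI ballI)
    fix k t assume k: "k < m" and t: "t \<in> {-1..1}" "t \<notin> T'.U k"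
    consider "t = -1" | "t = 1" | "-1 < t" "t < 1" using t by fastforce
    then show "c' (?pl k t) = y' k (below (T'.U k) t)"
    proof cases
      case 1
      have "below (T'.U k) (-1) = 0" using T'.U_interior[OF k] by (auto intro: below_0)
      then show ?thesis
        using 1 not_inner T.not_inner_ends(1)[OF k] T.describes_ends(1)[OF y k] ends k by (simp add: same_ends_def)
    next
      case 2
      have "below (T'.U k) 1 = card (T'.U k)" using T'.U_interior[OF k] by (auto intro: below_all)
      then show ?thesis
        using 2 not_inner T.not_inner_ends(2)[OF k] T.describes_ends(2)[OF y k] ends k by (simp add: same_ends_def)
    next
      case 3
      then show ?thesis using inner[OF k 3 same_point_refl] t by (simp add: val_def)
    qed
  qed
  have strand: "\<forall>\<^sub>F u in at_side b t. c' (T.pl k u) = T'.strand_color b c' k t"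
    if k: "k < m" and t: "-1 < t" "t < 1" for k t b
  proof -
    have eq: "T'.strand_color b c' k t =
      y' k (if t \<in> T'.U k \<and> \<not> b then Suc (below (T'.U k) t) else below (T'.U k) t)"
    proof (cases "t \<in> T'.U k")
      case True
      have "y' k (Suc (below (T'.U k) t)) = slide (T'.rl k t) (T'.over_color y' k t) (y' k (below (T'.U k) t))"
        using y' k True by (simp add: T'.sol_def)
      then show ?thesis
        using T'.strand_colors(2)[OF per' k True, of b] T'.describes_over_color[OF desc k True]
          inner[OF k t same_point_refl] True
        by (cases "T'.rl k t"; cases b) (simp_all add: val_def)
    next
      case False
      then show ?thesis
        using T'.strand_colors(1)[OF per' k _ False] inner[OF k t same_point_refl] t
        by (simp add: val_def)
    qed
    show ?thesis
      unfolding eq using T'.eventually_strand[OF k t, of b]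
      by eventually_elim (use desc k in \<open>auto simp: T'.describes_def\<close>)
  qed
  have local_inner: "\<forall>\<^sub>F s in at_side b x. c' (i, s) = side_color b D' c' (i, x)"
    if i: "i < ncomp D'" and inn: "T.inner (i, x)" for i x b
  proof -
    obtain k t where kt: "k < m" "-1 < t" "t < 1" "same_point (i, x) (T.pl k t)"
      using inn unfolding T.inner_def by blast
    have eq: "T.pl k t = (i, snd (T.pl k t))" "\<kappa> k = i" using kt(4) by (auto simp: place_def same_point_def)
    have "\<forall>\<^sub>F u in at_side b (snd (T.pl k t)). c' (i, u) = side_color b D' c' (i, snd (T.pl k t))"
      using T'.strand_local[OF kt(1), of c' t] strand[OF kt(1-3)] eq by simp
    moreover have "same_point (i, snd (T.pl k t)) (i, x)" using same_point_sym[OF kt(4)] eq(1) by simp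
    ultimately show ?thesis using local_coloring_shift[OF T'.D per' _ i] by blast
  qed
  have local_off: "\<forall>\<^sub>F s in at_side b x. c' (i, s) = side_color b D' c' (i, x)"
    if i: "i < ncomp D'" and ninn: "\<not> T.inner (i, x)" for i x b
  proof -
    obtain \<delta> where \<delta>: "0 < \<delta>" "\<delta> < 1" "\<And>k u. k < m \<Longrightarrow> u \<in> T.U k \<union> T'.U k \<Longrightarrow> \<bar>u\<bar> \<le> \<delta>"
      by (rule U_bound) blast
    \<comment> \<open>The part \<open>{-\<delta>..\<delta>}\<close> of a strand together with all
      its integer translates. As the sum of the integers and a compact set it is closed, and
      \<open>c'\<close> can differ from \<open>c\<close> only on these cores.\<close>
    define core where "core k = (\<Union>n \<in> \<int>. \<Union>s \<in> (\<lambda>t. \<alpha> k + r k * t) ` {-\<delta>..\<delta>}. {n + s})" for k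
    have "closed (core k)" for k
      unfolding core_def by (intro closed_compact_sums closed_Ints compact_continuous_image continuous_intros) simp
    then have op: "open (- (\<Union>k \<in> {k \<in> {..<m}. \<kappa> k = i}. core k))"
      by (intro open_Compl closed_UN) auto
    have in_core: "s \<in> core k" if "same_point (i, s) (?pl k t)" "\<bar>t\<bar> \<le> \<delta>" for s k t
    proof -
      have "s - (\<alpha> k + r k * t) \<in> \<int>" using that by (simp add: same_point_def place_def)
      moreover have "\<alpha> k + r k * t \<in> (\<lambda>t. \<alpha> k + r k * t) ` {-\<delta>..\<delta>}"
        using that(2) by (intro image_eqI[of _ _ t]) auto
      moreover have "s \<in> {(s - (\<alpha> k + r k * t)) + (\<alpha> k + r k * t)}" by simp
      ultimately show ?thesis unfolding core_def by blast
    qed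
    have core_inner: "T.inner (i, s)" if k: "k < m" "\<kappa> k = i" "s \<in> core k" for s k
    proof -
      obtain n t where "n \<in> \<int>" "\<bar>t\<bar> \<le> \<delta>" "s = n + (\<alpha> k + r k * t)"
      proof -
        obtain n w where nw: "n \<in> \<int>" "w \<in> (\<lambda>t. \<alpha> k + r k * t) ` {-\<delta>..\<delta>}" "s \<in> {n + w}"
          using k(3) unfolding core_def by blast
        then obtain t where "t \<in> {-\<delta>..\<delta>}" "w = \<alpha> k + r k * t" by blast
        then show thesis using that[of n t] nw by (simp add: abs_le_iff)
      qed
      then have "same_point (i, s) (?pl k t)" "-1 < t" "t < 1"
        using k(2) \<delta> by (auto simp: same_point_def place_def)
      then show ?thesis using k(1) unfolding T.inner_def by blast
    qed
    have eq: "c' (i, s) = c (i, s)" if s: "s \<notin> (\<Union>k \<in> {k \<in> {..<m}. \<kappa> k = i}. core k)" for s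
    proof (cases "T.inner (i, s)")
      case True
      then obtain k t where kt: "k < m" "-1 < t" "t < 1" "same_point (i, s) (?pl k t)"
        unfolding T.inner_def by blast
      have "\<kappa> k = i" using kt(4) by (simp add: same_point_def place_def)
      then have t: "\<not> \<bar>t\<bar> \<le> \<delta>" using in_core[OF kt(4)] s kt(1) by blast
      have nU: "t \<notin> T.U k" "t \<notin> T'.U k" using \<delta>(3)[OF kt(1)] t by auto
      have "c (i, s) = c (?pl k t)"
        using kt(4) i by (intro periodic_onD[OF per]) (simp_all add: points_def ncomp)
      also have "\<dots> = y k (below (T.U k) t)" using y kt nU by (simp add: T.describes_def)
      \<comment> \<open>Beyond \<open>\<delta>\<close> the parameter lies before the first or after
        the last cut in both diagrams, so \<open>same_ends\<close> applies to the first or the last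
        piece.\<close>
      also have "\<dots> = y' k (below (T'.U k) t)"
      proof (cases "t < 0")
        case True
        have "t < u" if "u \<in> T.U k \<union> T'.U k" for u using \<delta>(3)[OF kt(1) that] True t by auto
        then have "below (T.U k) t = 0" "below (T'.U k) t = 0" by (auto intro: below_0)
        then show ?thesis using ends kt by (simp add: same_ends_def)
      next
        case False
        have "u < t" if "u \<in> T.U k \<union> T'.U k" for u using \<delta>(3)[OF kt(1) that] False t by auto
        then have "below (T.U k) t = card (T.U k)" "below (T'.U k) t = card (T'.U k)" by (auto intro: below_all)
        then show ?thesis using ends kt by (simp add: same_ends_def)
      qed
      also have "\<dots> = c' (i, s)" using inner[OF kt] nU by (simp add: val_def)
      finally show ?thesis by simp
    qed (simp add: not_inner)
    \<comment> \<open>The point avoids all cores, whose complement is open, so \<open>c'\<close>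
      equals \<open>c\<close> in a whole neighborhood and inherits the local condition.\<close>
    have "x \<in> - (\<Union>k \<in> {k \<in> {..<m}. \<kappa> k = i}. core k)" using core_inner ninn by blast
    with op have "\<forall>\<^sub>F s in at x. s \<in> - (\<Union>k \<in> {k \<in> {..<m}. \<kappa> k = i}. core k)"
      by (rule eventually_at_in_open')
    then have ev: "\<forall>\<^sub>F s in at x. c' (i, s) = c (i, s)"
      by eventually_elim (rule eq, erule ComplD)
    have pt: "(i, x) \<in> points D" using i by (simp add: points_def ncomp)
    show ?thesis
      unfolding colors_off(1)[OF per per' agree pt ninn]
      using eventually_at_imp_side[OF ev] point_colorings_local[OF c i[unfolded ncomp], of b x]
      by eventually_elim simp
  qed
  have ext: "c' p = undefined" if "p \<notin> points D'" for p
  proof -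
    have "\<not> T.inner p"
      using that T.pl_points same_point_points[of p _ D] unfolding T.inner_def points_eq by blast
    then show ?thesis using point_colorings_undefined[OF c] that by (simp add: not_inner points_eq)
  qed
  have "c' \<in> point_colorings D'"
    unfolding point_colorings_def using ext per' local_inner local_off by blast
  then show ?thesis using agree desc by (rule that)
qed

lemma total_weight_off:
  assumes c: "c \<in> point_colorings D" "c' \<in> point_colorings D'" and cc': "agree c c'"
    and y: "T.describes y c" "T'.describes y' c'"
    and w: "T'.strand_weight \<psi> n y' = T.strand_weight \<psi> n y"
  shows "total_weight \<psi> D' n c' = total_weight \<psi> D n c"
proof -
  note per = point_colorings_periodic[OF c(1)] point_colorings_periodic[OF c(2)]
  have sub: "unit_underpts D \<subseteq> points D" "unit_underpts D' \<subseteq> points D"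
    using underpts_points[OF T.D] underpts_points[OF T'.D] by (auto simp: unit_underpts_def points_eq)
  have "{q \<in> unit_underpts D'. \<not> T.inner q} = {q \<in> unit_underpts D. \<not> T.inner q}"
    using sub under_off_iff by (auto simp: unit_underpts_def)
  moreover have "point_weight \<psi> D' n c' q = point_weight \<psi> D n c q"
    if "q \<in> {q \<in> unit_underpts D. \<not> T.inner q}" for q
    using that sub by (intro colors_off(2)[OF per cc']) (auto simp: unit_underpts_def)
  ultimately have "(\<Sum>q \<in> {q \<in> unit_underpts D'. \<not> T.inner q}. point_weight \<psi> D' n c' q) =
    (\<Sum>q \<in> {q \<in> unit_underpts D. \<not> T.inner q}. point_weight \<psi> D n c q)"
    by simp
  then show ?thesis
    unfolding T.total_weight_tangle[OF c(1) y(1)] T'.total_weight_tangle[OF c(2) y(2)] w by simp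
qed

lemma transfer:
  fixes \<psi> :: "'x::group_add \<Rightarrow> 'x \<Rightarrow> 'x \<Rightarrow> 'a::ab_group_add"
  assumes sol: "\<And>y :: 'x segments. T.sol y \<Longrightarrow>
      \<exists>y'. T'.sol y' \<and> same_ends y y' \<and> (\<forall>n. T'.strand_weight \<psi> n y' = T.strand_weight \<psi> n y)"
    and c: "c \<in> point_colorings D"
  shows "\<exists>c' \<in> point_colorings D'. agree c c' \<and> (\<forall>n. total_weight \<psi> D' n c' = total_weight \<psi> D n c)"
proof -
  obtain y where y: "T.describes y c" by (rule T.describes_exists[OF c])
  obtain y' where y': "T'.sol y'" "same_ends y y'" "\<And>n. T'.strand_weight \<psi> n y' = T.strand_weight \<psi> n y"
    using sol[OF T.describes_sol[OF c y]] by blast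
  obtain c' where c': "c' \<in> point_colorings D'" "agree c c'" "T'.describes y' c'"
    by (rule extend[OF c y y'(1,2)])
  then show ?thesis using total_weight_off[OF c c'(1,2) y c'(3) y'(3)] by blast
qed

text \<open>Reduces a local move to the finite color systems \<open>sol\<close> of its
  strands.\<close>

theorem heap_invariant_tangle_pair:
  fixes \<psi> :: "'x::{group_add,finite} \<Rightarrow> 'x \<Rightarrow> 'x \<Rightarrow> 'a::ab_group_add"
  assumes fwd: "\<And>y :: 'x segments. T.sol y \<Longrightarrow>
      \<exists>y'. T'.sol y' \<and> same_ends y y' \<and> (\<forall>n. T'.strand_weight \<psi> n y' = T.strand_weight \<psi> n y)"
    and bwd: "\<And>y' :: 'x segments. T'.sol y' \<Longrightarrow>
      \<exists>y. T.sol y \<and> same_ends y y' \<and> (\<forall>n. T'.strand_weight \<psi> n y' = T.strand_weight \<psi> n y)"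
    and unique: "\<And>(y :: 'x segments) y'. T.sol y \<Longrightarrow> T.sol y' \<Longrightarrow>
      \<forall>k<m. y k 0 = y' k 0 \<and> y k (card (T.U k)) = y' k (card (T.U k)) \<Longrightarrow>
      \<forall>k<m. \<forall>j \<le> card (T.U k). y k j = y' k j"
    and unique': "\<And>(y :: 'x segments) y'. T'.sol y \<Longrightarrow> T'.sol y' \<Longrightarrow>
      \<forall>k<m. y k 0 = y' k 0 \<and> y k (card (T'.U k)) = y' k (card (T'.U k)) \<Longrightarrow>
      \<forall>k<m. \<forall>j \<le> card (T'.U k). y k j = y' k j"
  shows "heap_invariant \<psi> D' = heap_invariant \<psi> D"
proof -
  interpret F: tangle_pair D' D m S' S \<kappa> \<alpha> r by (rule flip)
  let ?C = "point_colorings D :: (nat \<times> real \<Rightarrow> 'x \<times> 'x) set"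
  let ?C' = "point_colorings D' :: (nat \<times> real \<Rightarrow> 'x \<times> 'x) set"
  obtain j where j: "\<And>c. c \<in> ?C \<Longrightarrow> j c \<in> ?C'" "\<And>c. c \<in> ?C \<Longrightarrow> agree c (j c)"
    "\<And>c n. c \<in> ?C \<Longrightarrow> total_weight \<psi> D' n (j c) = total_weight \<psi> D n c"
    using transfer[OF fwd] by metis
  have "\<exists>y. T.sol y \<and> F.same_ends y' y \<and> (\<forall>n. T.strand_weight \<psi> n y = T'.strand_weight \<psi> n y')"
    if "T'.sol y'" for y' :: "'x segments"
    using bwd[OF that] unfolding same_ends_def F.same_ends_def by metis
  from F.transfer[OF this]
  obtain i where i: "\<And>c. c \<in> ?C' \<Longrightarrow> i c \<in> ?C" "\<And>c. c \<in> ?C' \<Longrightarrow> F.agree c (i c)"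
    "\<And>c n. c \<in> ?C' \<Longrightarrow> total_weight \<psi> D n (i c) = total_weight \<psi> D' n c"
    by metis
  show ?thesis
    unfolding heap_invariant_eq[OF T.D] heap_invariant_eq[OF T'.D]
  proof (rule sum.reindex_bij_witness[of _ j i])
    \<comment> \<open>Both sides agree outside the square, since each transfer keeps the colors
      there. Uniqueness of the solutions inside then makes the two choice functions inverse to each
      other.\<close>
    show "j (i c) = c" if "c \<in> ?C'" for c
      by (rule T'.colorings_eqI_sol[OF j(1)[OF i(1)[OF that]] that _ unique'])
        (use j(2)[OF i(1)[OF that]] i(2)[OF that] in \<open>simp_all add: agree_def F.agree_def points_eq\<close>)
    show "i (j c) = c" if "c \<in> ?C" for c
      by (rule T.colorings_eqI_sol[OF i(1)[OF j(1)[OF that]] that _ unique])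
        (use i(2)[OF j(1)[OF that]] j(2)[OF that] in \<open>simp_all add: agree_def F.agree_def points_eq\<close>)
  qed (simp_all add: i j)
qed

text \<open>The case of type II and cancelation moves, where the strands of \<open>D\<close> have no
  crossings: each strand has one color, and the strands of \<open>D'\<close> must restore that color
  at their far end.\<close>

lemma heap_invariant_crossingless:
  fixes \<psi> :: "'x::{group_add,finite} \<Rightarrow> 'x \<Rightarrow> 'x \<Rightarrow> 'a::ab_group_add"
  assumes U: "\<And>k. k < m \<Longrightarrow> T.U k = {}"
    and ex: "\<And>x :: nat \<Rightarrow> 'x \<times> 'x. \<exists>y'. T'.sol y' \<and> (\<forall>k<m. y' k 0 = x k)"
    and ends: "\<And>(y' :: 'x segments) k. T'.sol y' \<Longrightarrow> k < m \<Longrightarrow> y' k (card (T'.U k)) = y' k 0"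
    and weight: "\<And>y' n. T'.sol y' \<Longrightarrow> T'.strand_weight \<psi> n y' = 0"
    and unique: "\<And>(y :: 'x segments) y'. T'.sol y \<Longrightarrow> T'.sol y' \<Longrightarrow>
      \<forall>k<m. y k 0 = y' k 0 \<and> y k (card (T'.U k)) = y' k (card (T'.U k)) \<Longrightarrow>
      \<forall>k<m. \<forall>j \<le> card (T'.U k). y k j = y' k j"
  shows "heap_invariant \<psi> D' = heap_invariant \<psi> D"
proof (rule heap_invariant_tangle_pair[OF _ _ _ unique])
  have sol: "T.sol y" and w: "T.strand_weight \<psi> n y = 0" for y :: "'x segments" and n
    using U by (auto simp: T.sol_def T.strand_weight_def)
  fix y :: "'x segments"
  obtain y' where y': "T'.sol y'" "\<forall>k<m. y' k 0 = y k 0" using ex[of "\<lambda>k. y k 0"] by blast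
  then have "same_ends y y'" using ends[OF y'(1)] U by (simp add: same_ends_def)
  then show "\<exists>y'. T'.sol y' \<and> same_ends y y' \<and> (\<forall>n. T'.strand_weight \<psi> n y' = T.strand_weight \<psi> n y)"
    using y'(1) weight w by auto
next
  fix y' :: "'x segments" assume y': "T'.sol y'"
  have "same_ends (\<lambda>k _. y' k 0) y'" using ends[OF y'] U by (simp add: same_ends_def)
  then show "\<exists>y. T.sol y \<and> same_ends y y' \<and> (\<forall>n. T'.strand_weight \<psi> n y' = T.strand_weight \<psi> n y)"
    using y' weight U by (intro exI[of _ "\<lambda>k _. y' k 0"]) (simp add: T.sol_def T.strand_weight_def)
qed (simp_all add: U)

end

section \<open>Strands given by explicit curves\<close>

lemma strand_velocity:
  assumes D: "link_diagram D" and k: "\<kappa> k < ncomp D"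
    and pos: "\<And>t. t \<in> {-1..1} \<Longrightarrow> pos D (place \<kappa> \<alpha> r k t) = f t"
    and f: "(f has_vector_derivative v) (at t)" and t: "-1 < t" "t < 1"
  shows "r k *\<^sub>R velocity D (place \<kappa> \<alpha> r k t) = v"
proof -
  have "((\<lambda>t. \<alpha> k + r k * t) has_vector_derivative r k) (at t)"
    by (auto intro!: derivative_eq_intros simp flip: has_real_derivative_iff_has_vector_derivative)
  from vector_diff_chain_at[OF this has_velocity[OF D k]]
  have "(curve D (\<kappa> k) \<circ> (\<lambda>t. \<alpha> k + r k * t) has_vector_derivative r k *\<^sub>R velocity D (place \<kappa> \<alpha> r k t)) (at t)"
    by (simp add: place_def)
  then have "(f has_vector_derivative r k *\<^sub>R velocity D (place \<kappa> \<alpha> r k t)) (at t)"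
  proof (rule has_vector_derivative_transform_within_open[of _ _ _ "{-1<..<1}"])
    show "(curve D (\<kappa> k) \<circ> (\<lambda>t. \<alpha> k + r k * t)) s = f s" if "s \<in> {-1<..<1}" for s
      using pos[of s] that by (simp add: pos_def place_def)
  qed (use t in auto)
  then show ?thesis using f vector_derivative_unique_at by blast
qed

lemma has_vector_derivative_graph:
  assumes "(g has_real_derivative d) (at t)"
  shows "((\<lambda>t. Complex t (g t)) has_vector_derivative Complex 1 d) (at t)"
  using assms by (simp add: has_vector_derivative_complex_iff)

text \<open>The over-point of such a crossing would lie in the square, hence on a strand, and
  \<open>simple\<close> would identify it with the point itself.\<close>

lemma strand_end_not_under:
  assumes D: "link_diagram D"
    and comp: "\<And>k. k < m \<Longrightarrow> \<kappa> k < ncomp D"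
    and pos: "\<And>k t. k < m \<Longrightarrow> t \<in> {-1..1} \<Longrightarrow> pos D (place \<kappa> \<alpha> r k t) = S k t"
    and S: "\<And>k t. k < m \<Longrightarrow> t \<in> {-1..1} \<Longrightarrow> S k t \<in> square"
    and outside: "\<And>p. p \<in> points D \<Longrightarrow>
      (\<nexists>k t. k < m \<and> t \<in> {-1..1} \<and> same_point p (place \<kappa> \<alpha> r k t)) \<Longrightarrow> pos D p \<notin> square"
    and simple: "\<And>l s. l < m \<Longrightarrow> s \<in> {-1..1} \<Longrightarrow> S l s = S k t \<Longrightarrow> l = k \<and> s = t"
    and k: "k < m" and t: "t \<in> {-1..1}"
  shows "place \<kappa> \<alpha> r k t \<notin> underpts D"
proof
  assume u: "place \<kappa> \<alpha> r k t \<in> underpts D"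
  define p where "p = over_point D (place \<kappa> \<alpha> r k t)"
  have p: "crosses D p (place \<kappa> \<alpha> r k t)" unfolding p_def by (rule crosses_over_point[OF D u])
  then have "pos D p \<in> square" "p \<in> points D" using pos[OF k t] S[OF k t] by (auto simp: crosses_def)
  then obtain l s where ls: "l < m" "s \<in> {-1..1}" "same_point p (place \<kappa> \<alpha> r l s)"
    using outside by blast
  have "S l s = S k t"
    using pos_same_point[OF D \<open>p \<in> points D\<close> ls(3)] pos[OF ls(1,2)] pos[OF k t] p by (simp add: crosses_def)
  then have "l = k \<and> s = t" using simple ls by blast
  then show False using p ls(3) by (simp add: crosses_def)
qed

text \<open>Parameters of the same point of the link have equal positions in both diagrams.
  Disjointness of the strands may therefore be checked under coincidence both before and after the
  move.\<close>

lemma tangle_pair_intro: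
  assumes D: "link_diagram D" and D': "link_diagram D'"
    and rep: "replaces_strands D D' m S S' \<kappa> \<alpha> r"
    and S: "\<And>k t. k < m \<Longrightarrow> t \<in> {-1..1} \<Longrightarrow> S k t \<in> square"
    and S': "\<And>k t. k < m \<Longrightarrow> t \<in> {-1..1} \<Longrightarrow> S' k t \<in> square"
    and overlap: "\<And>k l s t. k < m \<Longrightarrow> l < m \<Longrightarrow> s \<in> {-1..1} \<Longrightarrow> t \<in> {-1..1} \<Longrightarrow>
      same_point (place \<kappa> \<alpha> r k s) (place \<kappa> \<alpha> r l t) \<Longrightarrow> S k s = S l t \<Longrightarrow> S' k s = S' l t \<Longrightarrow> k = l \<and> s = t"
    and simple: "\<And>k t l s. k < m \<Longrightarrow> t \<in> {-1, 1} \<Longrightarrow> l < m \<Longrightarrow> s \<in> {-1..1} \<Longrightarrow> S l s = S k t \<Longrightarrow> l = k \<and> s = t"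
      "\<And>k t l s. k < m \<Longrightarrow> t \<in> {-1, 1} \<Longrightarrow> l < m \<Longrightarrow> s \<in> {-1..1} \<Longrightarrow> S' l s = S' k t \<Longrightarrow> l = k \<and> s = t"
  shows "tangle_pair D D' m S S' \<kappa> \<alpha> r"
proof -
  have n: "ncomp D' = ncomp D" and comp: "\<And>k. k < m \<Longrightarrow> \<kappa> k < ncomp D" and r: "\<And>k. k < m \<Longrightarrow> r k \<noteq> 0"
    and pos: "\<And>k t. k < m \<Longrightarrow> t \<in> {-1..1} \<Longrightarrow> pos D (place \<kappa> \<alpha> r k t) = S k t"
      "\<And>k t. k < m \<Longrightarrow> t \<in> {-1..1} \<Longrightarrow> pos D' (place \<kappa> \<alpha> r k t) = S' k t"
    and off: "\<And>p. p \<in> points D \<Longrightarrow> (\<nexists>k t. k < m \<and> t \<in> {-1..1} \<and> same_point p (place \<kappa> \<alpha> r k t)) \<Longrightarrow>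
      pos D p \<notin> square \<and> pos D' p = pos D p \<and> (p \<in> underpts D' \<longleftrightarrow> p \<in> underpts D)"
    using rep unfolding replaces_strands_def by blast+
  have pts: "points D' = points D" by (simp add: points_def n)
  have pl: "place \<kappa> \<alpha> r k t \<in> points D" if "k < m" for k t
    using comp[OF that] by (simp add: points_def place_def)
  have ov: "k = l \<and> s = t" if "k < m" "l < m" "s \<in> {-1..1}" "t \<in> {-1..1}"
      "same_point (place \<kappa> \<alpha> r k s) (place \<kappa> \<alpha> r l t)" for k l s t
    using overlap[OF that] pos_same_point[OF D pl that(5)] pos_same_point[OF D' _ that(5)] pl pts pos that by simp
  have e: "place \<kappa> \<alpha> r k t \<notin> underpts D" "place \<kappa> \<alpha> r k t \<notin> underpts D'" if "k < m" "t \<in> {-1, 1}" for k t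
  proof -
    show "place \<kappa> \<alpha> r k t \<notin> underpts D"
      by (rule strand_end_not_under[OF D comp pos(1) S]) (use off that simple(1)[OF that] in auto)
    show "place \<kappa> \<alpha> r k t \<notin> underpts D'"
      by (rule strand_end_not_under[OF D' _ pos(2) S']) (use off that simple(2)[OF that] comp n pts in auto)
  qed
  show ?thesis
  proof (unfold_locales, fact D, fact comp, fact r, fact pos(1), fact S)
    show "pos D p \<notin> square" "pos D' p = pos D p \<and> (p \<in> underpts D' \<longleftrightarrow> p \<in> underpts D)"
      if "p \<in> points D" "\<nexists>k t. k < m \<and> t \<in> {-1..1} \<and> same_point p (place \<kappa> \<alpha> r k t)" for p
      using off[OF that] by auto
    show "pos D' p \<notin> square"
      if "p \<in> points D'" "\<nexists>k t. k < m \<and> t \<in> {-1..1} \<and> same_point p (place \<kappa> \<alpha> r k t)" for p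
      using off[of p] that by (simp add: pts)
  qed (use ov e D' n comp r pos S' in auto)
qed

context tangle
begin

lemma strand_crossing:
  assumes "k < m" "l < m" "s \<in> {-1..1}" "t \<in> {-1..1}" "S k s = S l t" "\<not> (k = l \<and> s = t)"
  shows "s \<in> U k \<longleftrightarrow> t \<notin> U l" "t \<in> U l \<Longrightarrow> crosses D (pl k s) (pl l t)"
proof -
  have p: "pos D (pl k s) = pos D (pl l t)" using assms pos by simp
  have ns: "\<not> same_point (pl k s) (pl l t)" using assms overlap by blast
  have "pl k s \<in> underpts D \<longleftrightarrow> pl l t \<notin> underpts D"
    using D p ns pl_points[OF assms(1)] pl_points[OF assms(2)] unfolding link_diagram_def by blast
  then show "s \<in> U k \<longleftrightarrow> t \<notin> U l" using assms by (simp add: U_def)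
  show "crosses D (pl k s) (pl l t)" if "t \<in> U l"
    using that p ns assms by (simp add: crosses_def U_def)
qed

lemma U_meets:
  assumes "k < m" "t \<in> U k"
  shows "S (fst (ov k t)) (snd (ov k t)) = S k t" "\<not> (fst (ov k t) = k \<and> snd (ov k t) = t)"
  using ov[OF assms] pos[OF ov(1,2)[OF assms]] pos[OF assms(1)] assms(2)
  by (auto simp: crosses_def U_def)

end

text \<open>Graphs over the horizontal coordinate meet only at equal parameters, and the direction
  of a crossing can be read off from the slopes \<open>dg\<close>.\<close>

locale graph_tangle = tangle +
  fixes g dg :: "nat \<Rightarrow> real \<Rightarrow> real" and height :: "nat \<Rightarrow> nat"
  assumes graph: "\<And>k t. k < m \<Longrightarrow> S k t = Complex t (g k t)"
    and dg: "\<And>k t. k < m \<Longrightarrow> (g k has_real_derivative dg k t) (at t)"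
    and layered: "layered D m \<kappa> \<alpha> r height"
begin

lemma height_eq: "k < m \<Longrightarrow> l < m \<Longrightarrow> height k = height l \<longleftrightarrow> k = l"
  using layered by (auto simp: layered_def inj_on_def)

lemma under_graph:
  assumes "k < m" "l < m" "t \<in> {-1..1}" "g k t = g l t" "height k < height l"
  shows "t \<in> U k" "ov k t = (l, t)"
proof -
  have "S k t = S l t" using graph assms by simp
  then have "pos D (pl k t) = pos D (pl l t)" using pos assms by simp
  then have "pl k t \<in> underpts D" using layered assms unfolding layered_def by blast
  then show t: "t \<in> U k" using assms by (simp add: U_def)
  show "ov k t = (l, t)"
    using strand_crossing(2)[of l k t t] t assms graph by (intro ov_eqI) auto
qed

lemma U_graph: "k < m \<Longrightarrow> U k = {t \<in> {-1..1}. \<exists>l<m. height k < height l \<and> g k t = g l t}"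
proof (intro equalityI subsetI)
  fix t assume k: "k < m" and t: "t \<in> U k"
  define l where "l = fst (ov k t)"
  have l: "l < m" "S l (snd (ov k t)) = S k t" "\<not> (l = k \<and> snd (ov k t) = t)" "t \<in> {-1..1}"
    using ov(1)[OF k t] U_meets[OF k t] t by (auto simp: l_def U_def)
  then have s: "snd (ov k t) = t" "g l t = g k t" using graph[of l] graph[of k] k by auto
  then have "l \<noteq> k" using l(3) by auto
  moreover have "\<not> height l < height k"
  proof
    assume "height l < height k"
    then have "t \<in> U l" using under_graph(1)[OF l(1) k l(4) s(2)] by blast
    then show False using strand_crossing(1)[OF l(1) k l(4,4)] t \<open>l \<noteq> k\<close> s graph l(1) k by auto
  qed
  ultimately have "height k < height l" using height_eq[OF k l(1)] by auto
  then show "t \<in> {t \<in> {-1..1}. \<exists>l<m. height k < height l \<and> g k t = g l t}" using l s by auto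
qed (use under_graph(1) in auto)

text \<open>The determinant of the velocities is \<open>(dg k t - dg l t) / (r l * r k)\<close>, and
  the sign of \<open>r k\<close> is absorbed by \<open>rl\<close>. The slopes differ because
  crossings of a diagram are transversal.\<close>

lemma rl_graph:
  assumes "k < m" "l < m" "t \<in> {-1..1}" "g k t = g l t" "height k < height l"
  shows "rl k t \<longleftrightarrow> (dg k t > dg l t \<longleftrightarrow> r l > 0)" "dg k t \<noteq> dg l t"
proof -
  note ut = under_graph[OF assms]
  have t: "-1 < t" "t < 1" using U_interior[OF assms(1) ut(1)] by auto
  have v: "r j *\<^sub>R velocity D (pl j t) = Complex 1 (dg j t)" if j: "j < m" for j
  proof (rule strand_velocity[where f = "\<lambda>t. Complex t (g j t)" and \<kappa>=\<kappa> and k=j, OF D comp[OF j] _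
        has_vector_derivative_graph[OF dg[OF j]] t])
    show "pos D (pl j s) = Complex s (g j s)" if "s \<in> {-1..1}" for s
      using pos[OF j that] graph[OF j] by simp
  qed
  have vel: "velocity D (pl j t) = Complex (1 / r j) (dg j t / r j)" if j: "j < m" for j
    using v[OF j] r[OF j] by (simp add: complex_eq_iff field_simps)
  have det: "plane_det (velocity D (pl l t)) (velocity D (pl k t)) = (dg k t - dg l t) / (r l * r k)"
    unfolding vel[OF assms(1)] vel[OF assms(2)] using r[OF assms(1)] r[OF assms(2)]
    by (simp add: plane_det_def field_simps)
  have "crosses D (pl l t) (pl k t)" using ov(3)[OF assms(1) ut(1)] ut(2) by simp
  from crosses_det[OF D this] show ne: "dg k t \<noteq> dg l t" unfolding det by auto
  show "rl k t \<longleftrightarrow> (dg k t > dg l t \<longleftrightarrow> r l > 0)"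
    using r[OF assms(1)] r[OF assms(2)] ne
    by (auto simp: rl_def ut(2) positive_crossing_def det zero_less_divide_iff zero_less_mult_iff mult_less_0_iff)
qed

end

section \<open>Reidemeister moves of type II\<close>

lemma has_derivative_bump: "(bump has_real_derivative - 4 * t * (1 - t\<^sup>2)) (at t)"
  unfolding bump_def by (auto intro!: derivative_eq_intros simp: algebra_simps power2_eq_square)

lemma bump_ends [simp]: "bump (-1) = 0" "bump 1 = 0"
  by (simp_all add: bump_def)

lemma bump_minus [simp]: "bump (- t) = bump t"
  by (simp add: bump_def)

lemma bump_bounds: "t \<in> {-1..1} \<Longrightarrow> 0 \<le> bump t \<and> bump t \<le> 1"
proof -
  assume t: "t \<in> {-1..1}"
  then have "t\<^sup>2 \<le> 1" by (simp add: abs_le_iff abs_square_le_1)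
  then show ?thesis by (simp add: bump_def power_le_one)
qed

lemma bump_half:
  obtains \<tau> :: real where "0 < \<tau>" "\<tau> < 1" "\<And>t. t \<in> {-1..1} \<Longrightarrow> bump t = 1/2 \<longleftrightarrow> t = \<tau> \<or> t = - \<tau>"
proof -
  \<comment> \<open>The positive solution of \<open>(1 - t\<^sup>2)\<^sup>2 = 1/2\<close> in the
    unit interval.\<close>
  define \<tau> where "\<tau> = sqrt (1 - sqrt (1/2))"
  have s: "0 < sqrt (1/2)" "sqrt (1/2) < (1::real)" by simp_all
  then have \<tau>: "0 < \<tau>" "\<tau> < 1" "\<tau>\<^sup>2 = 1 - sqrt (1/2)" by (simp_all add: \<tau>_def)
  have "bump t = 1/2 \<longleftrightarrow> t = \<tau> \<or> t = - \<tau>" if "t \<in> {-1..1}" for t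
  proof -
    have "t\<^sup>2 \<le> 1" using that by (simp add: abs_le_iff abs_square_le_1)
    then have "bump t = 1/2 \<longleftrightarrow> 1 - t\<^sup>2 = sqrt (1/2)"
      unfolding bump_def by (metis diff_ge_0_iff_ge real_sqrt_pow2 real_sqrt_unique zero_le_divide_1_iff zero_le_numeral)
    also have "\<dots> \<longleftrightarrow> t\<^sup>2 = \<tau>\<^sup>2" unfolding \<tau>(3) by auto
    also have "\<dots> \<longleftrightarrow> t = \<tau> \<or> t = - \<tau>" by (simp add: power2_eq_iff)
    finally show ?thesis .
  qed
  then show ?thesis using that \<tau> by blast
qed

lemma below_empty [simp]: "below {} t = 0"
  by (simp add: below_def)

lemma below_insert:
  assumes "finite U" "u \<notin> U"
  shows "below (insert u U) t = (if u < t then Suc (below U t) else below U t)"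
proof -
  have "{v \<in> insert u U. v < t} = (if u < t then insert u {v \<in> U. v < t} else {v \<in> U. v < t})" by auto
  then show ?thesis using assms by (simp add: below_def)
qed

theorem heap_invariant_Reidemeister_II:
  fixes \<psi> :: "'x::{group_add,finite} \<Rightarrow> 'x \<Rightarrow> 'x \<Rightarrow> 'a::ab_group_add"
  assumes D: "link_diagram D" and D': "link_diagram D'" and R: "Reidemeister_II D D'"
  shows "heap_invariant \<psi> D' = heap_invariant \<psi> D"
proof -
  obtain \<kappa> \<alpha> r height where rep: "replaces_strands D D' 2 R2_before R2_after \<kappa> \<alpha> r"
    and lay: "layered D' 2 \<kappa> \<alpha> r height"
    using R unfolding Reidemeister_II_def by blast
  define g where "g k t = (if k = 0 then 1/2 - bump t else -1/2 + bump t)" for k :: nat and t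
  define dg where "dg k t = (if k = 0 then 4 * t * (1 - t\<^sup>2) else - 4 * t * (1 - t\<^sup>2))" for k :: nat and t :: real
  have after: "R2_after k t = Complex t (g k t)" for k t by (simp add: R2_after_def g_def)
  interpret tangle_pair D D' 2 R2_before R2_after \<kappa> \<alpha> r
  proof (rule tangle_pair_intro[OF D D' rep])
    fix k l :: nat and s t :: real
    assume t: "t \<in> {-1..1}"
    show "R2_before k t \<in> square" using t by (auto simp: R2_before_def square_def)
    show "R2_after k t \<in> square" using t bump_bounds[OF t] by (auto simp: R2_after_def square_def)
  next
    fix k l :: nat and s t :: real
    assume kl: "k < 2" "l < 2" and eq: "R2_before k s = R2_before l t"
    then show "k = l \<and> s = t" by (auto simp: R2_before_def split: if_splits)
  next
    fix k l :: nat and s t :: real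
    assume kl: "k < 2" "l < 2" and eq: "R2_before l s = R2_before k t"
    then show "l = k \<and> s = t" by (auto simp: R2_before_def split: if_splits)
  next
    fix k l :: nat and s t :: real
    assume kl: "k < 2" "l < 2" "t \<in> {-1, 1}" and eq: "R2_after l s = R2_after k t"
    then show "l = k \<and> s = t" by (auto simp: R2_after_def split: if_splits)
  qed
  interpret G: graph_tangle D' 2 R2_after \<kappa> \<alpha> r g dg height
  proof (unfold_locales)
    show "(g k has_real_derivative dg k t) (at t)" for k t
      unfolding g_def dg_def
      by (cases "k = 0") (auto intro!: derivative_eq_intros has_derivative_bump[THEN DERIV_cong])
  qed (use after lay in auto)
  have UD: "T.U k = {}" if "k < 2" for k
  proof (rule equals0I)
    fix t assume t: "t \<in> T.U k"
    show False
      using T.U_meets[OF that t] T.ov(1)[OF that t] that by (auto simp: R2_before_def split: if_splits)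
  qed
  obtain \<tau> :: real where \<tau>: "0 < \<tau>" "\<tau> < 1" "\<And>t. t \<in> {-1..1} \<Longrightarrow> bump t = 1/2 \<longleftrightarrow> t = \<tau> \<or> t = - \<tau>"
    by (rule bump_half) blast
  \<comment> \<open>\<open>b\<close> is the lower and \<open>a\<close> the upper of the two
    strands.\<close>
  define b :: nat where "b = (if height 0 < height 1 then 0 else 1)"
  define a :: nat where "a = (if height 0 < height 1 then 1 else 0)"
  have h01: "height 0 \<noteq> height 1" using G.height_eq[of 0 1] by simp
  have b: "b < 2" "a < 2" "height b < height a" "b = 0 \<and> a = 1 \<or> b = 1 \<and> a = 0"
    using h01 by (auto simp: a_def b_def)
  have meet: "g b t = g a t \<longleftrightarrow> t = \<tau> \<or> t = - \<tau>" if "t \<in> {-1..1}" for t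
    using \<tau>(3)[OF that] b(4) by (auto simp: g_def)
  have Ub: "T'.U b = {- \<tau>, \<tau>}"
  proof -
    have "(\<exists>l<2. height b < height l \<and> g b t = g l t) \<longleftrightarrow> g b t = g a t" for t
      using b by (auto simp: less_2_cases_iff)
    then show ?thesis using G.U_graph[OF b(1)] meet \<tau> by auto
  qed
  have Ut: "T'.U a = {}"
  proof -
    have "l = b \<or> l = a" if "l < 2" for l using that b(4) by auto
    then have "\<not> (\<exists>l<2. height a < height l)" using b(3) by (metis less_asym less_irrefl)
    then show ?thesis using G.U_graph[OF b(2)] by auto
  qed
  have m1: "g b (- \<tau>) = g a (- \<tau>)" "g b \<tau> = g a \<tau>" using meet \<tau> by auto
  have tau: "- \<tau> \<in> {-1..1}" "\<tau> \<in> {-1..1}" using \<tau> by auto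
  have ov: "T'.ov b (- \<tau>) = (a, - \<tau>)" "T'.ov b \<tau> = (a, \<tau>)"
    using G.under_graph(2)[OF b(1,2) tau(1) m1(1) b(3)] G.under_graph(2)[OF b(1,2) tau(2) m1(2) b(3)] .
  define e where "e = T'.rl b (- \<tau>)"
  have e: "T'.rl b (- \<tau>) = e" by (simp add: e_def)
  \<comment> \<open>The difference of the slopes is an odd function that does not vanish at
    \<open>\<tau>\<close>, so the lower strand passes under in opposite directions at
    \<open>- \<tau>\<close> and \<open>\<tau>\<close>.\<close>
  have "0 < \<tau> * (1 - \<tau>\<^sup>2)" using \<tau> by (simp add: abs_square_less_1)
  then have e': "T'.rl b \<tau> = (\<not> e)"
    unfolding e_def G.rl_graph(1)[OF b(1,2) tau(1) m1(1) b(3)] G.rl_graph(1)[OF b(1,2) tau(2) m1(2) b(3)]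
    using b(4) by (auto simp: dg_def)
  have oc: "T'.over_color y b (- \<tau>) = y a 0" "T'.over_color y b \<tau> = y a 0"
    for y :: "'x segments"
    by (simp_all add: T'.over_color_def ov Ut)
  have bel: "below (T'.U b) (- \<tau>) = 0" "below (T'.U b) \<tau> = 1" "card (T'.U b) = 2"
    using \<tau> by (simp_all add: Ub below_insert)
  have ab: "a \<noteq> b" using b(4) by auto
  have lt2: "{..<2} = {b, a}" using b(4) by auto
  have sum2: "(\<Sum>k<2. f k) = f b + f a" for f :: "nat \<Rightarrow> 'a" unfolding lt2 using ab by simp
  have two: "k < 2 \<longleftrightarrow> k = b \<or> k = a" for k :: nat using b(4) by auto
  have sol: "T'.sol y \<longleftrightarrow> y b 1 = slide e (y a 0) (y b 0) \<and> y b 2 = slide (\<not> e) (y a 0) (y b 1)"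
    for y :: "'x segments"
    unfolding T'.sol_def two
    by (auto simp: Ut) (auto simp: Ub e e' oc bel[unfolded Ub] numeral_2_eq_2[symmetric])
  have sw: "T'.strand_weight \<psi> n y = 0" if "T'.sol y" for y :: "'x segments" and n
  proof -
    have y1: "y b 1 = slide e (y a 0) (y b 0)" using that by (simp add: sol)
    have "- \<tau> \<noteq> \<tau>" using \<tau> by simp
    then show ?thesis
      unfolding T'.strand_weight_def sum2
      by (simp add: Ut) (simp add: Ub e e' oc bel[unfolded Ub] Let_def y1[unfolded One_nat_def] pass_weight_inverse)
  qed
  show ?thesis
  proof (rule heap_invariant_crossingless)
    fix x :: "nat \<Rightarrow> 'x \<times> 'x"
    \<comment> \<open>Only the middle piece of the lower strand gets a new color; the second
      crossing restores the original one.\<close>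
    define y where "y k j = (if k = b \<and> j = 1 then slide e (x a) (x b) else x k)" for k j :: nat
    have "T'.sol y" using ab by (simp add: sol y_def)
    moreover have "\<forall>k<2. y k 0 = x k" by (simp add: y_def)
    ultimately show "\<exists>y. T'.sol y \<and> (\<forall>k<2. y k 0 = x k)" by blast
  next
    fix y :: "'x segments" and k :: nat
    assume "T'.sol y" "k < 2"
    then show "y k (card (T'.U k)) = y k 0" using bel(3) Ut by (auto simp: sol two)
  next
    fix y1 y2 :: "'x segments"
    assume s: "T'.sol y1" "T'.sol y2"
      and eq: "\<forall>k<2. y1 k 0 = y2 k 0 \<and> y1 k (card (T'.U k)) = y2 k (card (T'.U k))"
    have 0: "y1 a 0 = y2 a 0" "y1 b 0 = y2 b 0" using eq b by auto
    have "y1 b j = y2 b j" if "j \<le> 2" for j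
    proof -
      have "j = 0 \<or> j = 1 \<or> j = 2" using that by linarith
      then show ?thesis using s 0 by (elim disjE) (simp_all add: sol)
    qed
    then show "\<forall>k<2. \<forall>j \<le> card (T'.U k). y1 k j = y2 k j" using 0 bel(3) Ut by (auto simp: two)
  qed (fact UD, fact sw)
qed

section \<open>Reidemeister moves of type III\<close>

lemma bump_strict_antimono:
  assumes "0 \<le> s" "s < t" "t \<le> 1"
  shows "bump t < bump s"
proof -
  have "s\<^sup>2 < t\<^sup>2" "t\<^sup>2 \<le> 1" using assms by (auto intro: power_strict_mono power_le_one)
  then show ?thesis unfolding bump_def by (intro power_strict_mono) auto
qed

text \<open>Locates the meeting of the moving strand with strand 0 before a type III move. It is
  unique because \<open>bump\<close> decreases on the unit interval while the identity
  increases.\<close>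

lemma bump_fixed_point:
  obtains \<tau> :: real where "0 < \<tau>" "\<tau> < 1" "\<And>t. t \<in> {-1..1} \<Longrightarrow> bump t = t \<longleftrightarrow> t = \<tau>"
proof -
  have "\<exists>t \<ge> 0. t \<le> 1 \<and> t - bump t = 0"
    by (rule IVT') (auto simp: bump_def intro!: continuous_intros)
  then obtain \<tau> :: real where \<tau>: "0 \<le> \<tau>" "\<tau> \<le> 1" "bump \<tau> = \<tau>" by auto
  have "\<tau> \<noteq> 0" "\<tau> \<noteq> 1" using \<tau>(3) by (auto simp: bump_def)
  moreover have "t = \<tau>" if t: "t \<in> {-1..1}" "bump t = t" for t
  proof -
    have "0 \<le> t" using bump_bounds[OF t(1)] t by simp
    then show ?thesis
      using bump_strict_antimono[of t \<tau>] bump_strict_antimono[of \<tau> t] t \<tau> by (cases t \<tau> rule: linorder_cases) auto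
  qed
  ultimately show ?thesis using that[of \<tau>] \<tau> by force
qed

text \<open>From left to right, the bottom strand \<open>B\<close> meets the middle strand \<open>M\<close> before the top strand \<open>T\<close>
  iff \<open>F\<close>, and \<open>M\<close> meets \<open>T\<close> before \<open>B\<close> iff \<open>G\<close>. A move of type III negates both.\<close>

definition R3_system :: "nat \<Rightarrow> nat \<Rightarrow> nat \<Rightarrow> bool \<Rightarrow> bool \<Rightarrow> bool \<Rightarrow> bool \<Rightarrow> bool \<Rightarrow>
    ('x::group_add segments) \<Rightarrow> bool" where
  "R3_system T M B eMT eBT eBM F G y \<longleftrightarrow>
     y M 1 = slide eMT (y T 0) (y M 0) \<and>
     (if F then y B 1 = slide eBM (y M (if G then 1 else 0)) (y B 0) \<and> y B 2 = slide eBT (y T 0) (y B 1)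
      else y B 1 = slide eBT (y T 0) (y B 0) \<and> y B 2 = slide eBM (y M (if G then 1 else 0)) (y B 1))"

text \<open>Only the crossings of \<open>B\<close> are collected: \<open>M\<close> passes under
  \<open>T\<close> with the same colors before and after the move.\<close>

definition R3_bottom_weight ::
  "('x::group_add \<Rightarrow> 'x \<Rightarrow> 'x \<Rightarrow> 'a::ab_group_add) \<Rightarrow> nat \<Rightarrow> nat \<Rightarrow> nat \<Rightarrow> nat \<Rightarrow> bool \<Rightarrow> bool \<Rightarrow> bool \<Rightarrow> bool \<Rightarrow>
    ('x segments) \<Rightarrow> 'a" where
  "R3_bottom_weight \<psi> n T M B eBT eBM F G y =
     pass_weight \<psi> eBT n (y T 0) (y B (if F then 1 else 0)) +
     pass_weight \<psi> eBM n (y M (if G then 1 else 0)) (y B (if F then 0 else 1))"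

text \<open>The move recolors only the middle piece of \<open>B\<close>. The condition
  \<open>FG\<close> expresses that the strands form a triangle: the meeting point of
  \<open>B\<close> and \<open>M\<close> lies on one side of \<open>T\<close>, so they cross
  \<open>T\<close> in the same direction iff that point comes before \<open>T\<close> on both
  strands or after \<open>T\<close> on both.\<close>

lemma R3_system_move:
  fixes y :: "'x::group_add segments"
  assumes y: "R3_system T M B eMT eBT eBM F G y" and TMB: "T \<noteq> M" "T \<noteq> B" "M \<noteq> B"
    and FG: "(F \<longleftrightarrow> \<not> G) \<longleftrightarrow> (eBT \<longleftrightarrow> eMT)" and \<psi>: "\<psi> \<in> Z2_SD"
  obtains y' where "R3_system T M B eMT eBT eBM (\<not> F) (\<not> G) y'"
    "\<And>k j. k \<noteq> B \<or> j \<noteq> 1 \<Longrightarrow> y' k j = y k j"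
    "\<And>n. R3_bottom_weight \<psi> n T M B eBT eBM (\<not> F) (\<not> G) y' = R3_bottom_weight \<psi> n T M B eBT eBM F G y"
proof -
  define y' where "y' k j = (if k = B \<and> j = 1 then (if F then slide eBT (y T 0) (y B 0)
    else slide eBM (y M (if G then 0 else 1)) (y B 0)) else y k j)" for k j
  have yM: "y M 1 = slide eMT (y T 0) (y M 0)" using y by (simp add: R3_system_def)
  \<comment> \<open>\<open>m\<close> and \<open>m'\<close> are the pieces of \<open>M\<close> on the
    sides of \<open>T\<close> where \<open>B\<close> starts and ends. By \<open>FG\<close>, crossing
    \<open>T\<close> in the direction of \<open>B\<close> turns \<open>m\<close> into
    \<open>m'\<close>.\<close>
  define m where "m = y M (if F \<longleftrightarrow> G then 1 else 0)"
  define m' where "m' = y M (if F \<longleftrightarrow> G then 0 else 1)"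
  have m': "m' = slide eBT (y T 0) m"
    using FG yM slide_inverse(1)[of eMT "y T 0" "y M 0"]
    by (cases "F \<longleftrightarrow> G") (auto simp: m_def m'_def)
  note R3 = pass_weight_R3[OF \<psi>, of eBM _ m "y B 0" eBT "y T 0"]
  show ?thesis
  proof (rule that[of y'])
    show "y' k j = y k j" if "k \<noteq> B \<or> j \<noteq> 1" for k j using that by (auto simp: y'_def)
    have "y' T 0 = y T 0" "y' M j = y M j" "y' B 0 = y B 0" "y' B 2 = y B 2" for j
      using TMB by (auto simp: y'_def)
    note y'_simps = this
    show "R3_system T M B eMT eBT eBM (\<not> F) (\<not> G) y'"
    proof (cases F)
      case True
      then have "y B 2 = slide eBM m' (slide eBT (y T 0) (y B 0))"
        using y unfolding m' slide_distrib by (cases G) (simp_all add: R3_system_def m_def)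
      then show ?thesis
        using True yM unfolding R3_system_def y'_simps by (cases G) (simp_all add: y'_def m'_def)
    next
      case False
      then have "y B 2 = slide eBT (y T 0) (slide eBM m (y B 0))"
        using y m' slide_distrib[of eBM eBT "y T 0" m "y B 0"] by (cases G) (simp_all add: R3_system_def m'_def)
      then show ?thesis
        using False yM unfolding R3_system_def y'_simps by (cases G) (simp_all add: y'_def m_def)
    qed
    show "R3_bottom_weight \<psi> n T M B eBT eBM (\<not> F) (\<not> G) y' = R3_bottom_weight \<psi> n T M B eBT eBM F G y" for n
    proof (cases F)
      case True
      have "y' B 1 = slide eBT (y T 0) (y B 0)" "y B 1 = slide eBM m (y B 0)"
        using True y by (cases G; simp add: y'_def R3_system_def m_def)+
      then show ?thesis
        using R3[of n] True m' unfolding R3_bottom_weight_def y'_simps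
        by (cases G) (simp_all add: y'_simps m_def m'_def add.commute)
    next
      case False
      have "y B 1 = slide eBT (y T 0) (y B 0)" "y' B 1 = slide eBM m (y B 0)"
        using False y by (cases G; simp add: y'_def R3_system_def m_def)+
      then show ?thesis
        using R3[of n] False m' unfolding R3_bottom_weight_def y'_simps
        by (cases G) (simp_all add: y'_simps m_def m'_def add.commute)
    qed
  qed
qed

lemma R3_system_unique:
  assumes "R3_system T M B eMT eBT eBM F G y" "R3_system T M B eMT eBT eBM F G y'"
    and "y T 0 = y' T 0" "y M 0 = y' M 0" "y B 0 = y' B 0"
  shows "y M 1 = y' M 1" "y B 1 = y' B 1" "y B 2 = y' B 2"
  using assms by (auto simp: R3_system_def split: if_splits)

text \<open>\<open>x k l\<close> is the parameter at which strands \<open>k\<close> and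
  \<open>l\<close> meet, and \<open>T\<close>, \<open>M\<close>, \<open>B\<close> are the top,
  middle and bottom strand.\<close>

locale R3_tangle = graph_tangle D 3 S \<kappa> \<alpha> r g dg height
  for D S \<kappa> \<alpha> r g dg height +
  fixes x :: "nat \<Rightarrow> nat \<Rightarrow> real" and T M B :: nat
  assumes x: "\<And>k l t. k < 3 \<Longrightarrow> l < 3 \<Longrightarrow> k \<noteq> l \<Longrightarrow> t \<in> {-1..1} \<Longrightarrow> g k t = g l t \<longleftrightarrow> t = x k l"
    "\<And>k l. k < 3 \<Longrightarrow> l < 3 \<Longrightarrow> k \<noteq> l \<Longrightarrow> x k l \<in> {-1..1}"
    and TMB: "T < 3" "M < 3" "B < 3" "T \<noteq> M" "T \<noteq> B" "M \<noteq> B"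
    and heights: "height B < height M" "height M < height T"
    and distinct: "x B T \<noteq> x B M" "x M T \<noteq> x B M"
begin

definition e :: "nat \<Rightarrow> nat \<Rightarrow> bool" where
  "e k l \<longleftrightarrow> (dg k (x k l) > dg l (x k l) \<longleftrightarrow> r l > 0)"

abbreviation F :: bool where "F \<equiv> x B M < x B T"
abbreviation G :: bool where "G \<equiv> x M T < x B M"

lemma three: "k < 3 \<longleftrightarrow> k = T \<or> k = M \<or> k = B"
  using TMB by auto

lemma U_T: "U T = {}" and U_M: "U M = {x M T}" and U_B: "U B = {x B T, x B M}"
proof -
  have *: "U k = {t \<in> {-1..1}. \<exists>l<3. height k < height l \<and> t = x k l}" if "k < 3" for k
    unfolding U_graph[OF that] using x(1)[OF that] by auto
  show "U T = {}" "U M = {x M T}" "U B = {x B T, x B M}"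
    using *[OF TMB(1)] *[OF TMB(2)] *[OF TMB(3)] heights x(2) TMB by (auto simp: three)
qed

lemma crossing:
  assumes "k < 3" "l < 3" "height k < height l"
  shows "ov k (x k l) = (l, x k l)" "rl k (x k l) = e k l"
proof -
  have kl: "k \<noteq> l" using assms by auto
  have t: "x k l \<in> {-1..1}" using x(2)[OF assms(1,2) kl] .
  then have "g k (x k l) = g l (x k l)" using x(1)[OF assms(1,2) kl] by simp
  from under_graph(2)[OF assms(1,2) t this assms(3)] rl_graph[OF assms(1,2) t this assms(3)]
  show "ov k (x k l) = (l, x k l)" "rl k (x k l) = e k l" by (auto simp: e_def)
qed

lemma crossings_TMB:
  "ov M (x M T) = (T, x M T)" "rl M (x M T) = e M T"
  "ov B (x B T) = (T, x B T)" "rl B (x B T) = e B T"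
  "ov B (x B M) = (M, x B M)" "rl B (x B M) = e B M"
  using crossing[OF TMB(2,1) heights(2)] crossing[OF TMB(3,2) heights(1)]
    crossing[OF TMB(3,1) less_trans[OF heights]] by auto

lemma below_TMB:
  "below (U M) (x M T) = 0" "below (U M) (x B M) = (if G then 1 else 0)"
  "below (U B) (x B T) = (if F then 1 else 0)" "below (U B) (x B M) = (if F then 0 else 1)"
  "card (U T) = 0" "card (U M) = 1" "card (U B) = 2"
  using distinct by (auto simp: U_T U_M U_B below_insert)

lemma over_color_TMB:
  "over_color y M (x M T) = y T 0" "over_color y B (x B T) = y T 0"
  "over_color y B (x B M) = y M (if G then 1 else 0)"
  by (simp_all add: over_color_def crossings_TMB U_T below_TMB)

lemma sol_R3: "sol y \<longleftrightarrow> R3_system T M B (e M T) (e B T) (e B M) F G y"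
proof -
  have "sol y \<longleftrightarrow> (\<forall>t \<in> U M. y M (Suc (below (U M) t)) = slide (rl M t) (over_color y M t) (y M (below (U M) t))) \<and>
    (\<forall>t \<in> U B. y B (Suc (below (U B) t)) = slide (rl B t) (over_color y B t) (y B (below (U B) t)))"
    unfolding sol_def three using U_T by auto
  also have "\<dots> \<longleftrightarrow> y M (Suc (below (U M) (x M T))) = slide (rl M (x M T)) (over_color y M (x M T)) (y M (below (U M) (x M T))) \<and>
    y B (Suc (below (U B) (x B T))) = slide (rl B (x B T)) (over_color y B (x B T)) (y B (below (U B) (x B T))) \<and>
    y B (Suc (below (U B) (x B M))) = slide (rl B (x B M)) (over_color y B (x B M)) (y B (below (U B) (x B M)))"
    unfolding U_M[THEN eqset_imp_iff] U_B[THEN eqset_imp_iff] by (auto simp: U_M U_B)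
  finally show ?thesis
    unfolding below_TMB over_color_TMB crossings_TMB R3_system_def
    by (auto simp: numeral_2_eq_2)
qed

lemma sol_unique:
  assumes s: "sol y" "sol y'" and eq: "\<forall>k<3. y k 0 = y' k 0"
  shows "\<forall>k<3. \<forall>j \<le> card (U k). y k j = y' k j"
proof (intro allI impI)
  fix k j assume kj: "k < 3" "j \<le> card (U k)"
  have "y T 0 = y' T 0" "y M 0 = y' M 0" "y B 0 = y' B 0" using eq TMB by auto
  moreover have "j = 0 \<or> (k = M \<and> j = 1) \<or> (k = B \<and> (j = 1 \<or> j = 2))"
    using kj unfolding three by (auto simp: below_TMB)
  ultimately show "y k j = y' k j" using R3_system_unique[OF s[unfolded sol_R3]] eq kj(1) by auto
qed

lemma strand_weight_R3:
  fixes \<psi> :: "'x::group_add \<Rightarrow> 'x \<Rightarrow> 'x \<Rightarrow> 'a::ab_group_add"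
  shows "strand_weight \<psi> n y =
    (if r M > 0 then pass_weight \<psi> (e M T) n (y T 0) (y M 0) else - pass_weight \<psi> (e M T) n (y T 0) (y M 0)) +
    (if r B > 0 then R3_bottom_weight \<psi> n T M B (e B T) (e B M) F G y
     else - R3_bottom_weight \<psi> n T M B (e B T) (e B M) F G y)"
proof -
  have "{..<3} = {T, M, B}" using three by auto
  then have sum3: "(\<Sum>k<3. f k) = f T + (f M + f B)" for f :: "nat \<Rightarrow> 'a"
    using TMB by simp
  have sums: "(\<Sum>t \<in> U T. f t) = 0" "(\<Sum>t \<in> U M. f t) = f (x M T)" "(\<Sum>t \<in> U B. f t) = f (x B T) + f (x B M)"
    for f :: "real \<Rightarrow> 'a"
    using distinct by (simp_all add: U_T U_M U_B)
  show ?thesis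
    unfolding strand_weight_def sum3 sums below_TMB over_color_TMB crossings_TMB
    by (auto simp: Let_def R3_bottom_weight_def)
qed

end

theorem heap_invariant_Reidemeister_III:
  fixes \<psi> :: "'x::{group_add,finite} \<Rightarrow> 'x \<Rightarrow> 'x \<Rightarrow> 'a::ab_group_add"
  assumes D: "link_diagram D" and D': "link_diagram D'" and R: "Reidemeister_III D D'"
    and \<psi>: "\<psi> \<in> Z2_SD"
  shows "heap_invariant \<psi> D' = heap_invariant \<psi> D"
proof -
  obtain \<kappa> \<alpha> r height where rep: "replaces_strands D D' 3 R3_before R3_after \<kappa> \<alpha> r"
    and lay: "layered D 3 \<kappa> \<alpha> r height" "layered D' 3 \<kappa> \<alpha> r height"
    using R unfolding Reidemeister_III_def by blast
  \<comment> \<open>\<open>s = 1\<close> describes the strands before the move and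
    \<open>s = -1\<close> those after it.\<close>
  define g where "g s k t = (if k = 0 then t/2 else if k = 1 then -t/2 else s * bump t / 2)" for s :: real and k :: nat and t
  define dg where "dg s k t = (if k = 0 then 1/2 else if k = 1 then -1/2 else s * (- 2 * t * (1 - t\<^sup>2)))"
    for s :: real and k :: nat and t :: real
  have before: "R3_before k t = Complex t (g 1 k t)" for k t by (simp add: R3_before_def g_def)
  have after: "R3_after k t = Complex t (g (-1) k t)" for k t by (simp add: R3_after_def g_def)
  have dg: "(g s k has_real_derivative dg s k t) (at t)" for s k t
    unfolding g_def dg_def
    by (cases "k = 0"; cases "k = 1")
      (auto intro!: derivative_eq_intros has_derivative_bump[THEN DERIV_cong])
  obtain \<tau> :: real where \<tau>: "0 < \<tau>" "\<tau> < 1" "\<And>t. t \<in> {-1..1} \<Longrightarrow> bump t = t \<longleftrightarrow> t = \<tau>"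
    by (rule bump_fixed_point) blast
  have \<tau>': "bump t = - t \<longleftrightarrow> t = - \<tau>" if "t \<in> {-1..1}" for t
    using \<tau>(3)[of "- t"] that by auto
  \<comment> \<open>Meeting parameters before the move: strands 0 and 1 meet at the origin, the
    moving strand meets strand 0 at \<open>\<tau>\<close> and strand 1 at \<open>- \<tau>\<close>.
    After the move all of them change sign.\<close>
  define x :: "nat \<Rightarrow> nat \<Rightarrow> real" where
    "x k l = (if {k, l} = {0, 1} then 0 else if {k, l} = {0, 2} then \<tau> else - \<tau>)" for k l
  have k3: "k = 0 \<or> k = 1 \<or> k = 2" if "k < 3" for k :: nat using that by auto
  have xs: "x 0 (Suc 0) = 0" "x (Suc 0) 0 = 0" "x 0 2 = \<tau>" "x 2 0 = \<tau>" "x (Suc 0) 2 = - \<tau>" "x 2 (Suc 0) = - \<tau>"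
    by (auto simp: x_def doubleton_eq_iff)
  have meet: "g 1 k t = g 1 l t \<longleftrightarrow> t = x k l" "g (-1) k t = g (-1) l t \<longleftrightarrow> t = - x k l"
    if "k < 3" "l < 3" "k \<noteq> l" "t \<in> {-1..1}" for k l t
  proof -
    have mt: "- t \<in> {-1..1}" using that by auto
    have b: "bump t = t \<longleftrightarrow> t = \<tau>" "t = bump t \<longleftrightarrow> t = \<tau>" "bump t = - t \<longleftrightarrow> t = - \<tau>" "- t = bump t \<longleftrightarrow> t = - \<tau>"
      "t = - bump t \<longleftrightarrow> t = - \<tau>" "- bump t = t \<longleftrightarrow> t = - \<tau>"
      using \<tau>(3)[OF that(4)] \<tau>'[OF that(4)] by linarith+
    show "g 1 k t = g 1 l t \<longleftrightarrow> t = x k l"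
      using k3[OF that(1)] k3[OF that(2)] that(3) b by (elim disjE) (simp_all add: g_def xs)
    show "g (-1) k t = g (-1) l t \<longleftrightarrow> t = - x k l"
      using k3[OF that(1)] k3[OF that(2)] that(3) b by (elim disjE) (simp_all add: g_def xs)
  qed
  have x_bound: "x k l \<in> {-1..1}" "- x k l \<in> {-1..1}" for k l using \<tau> by (auto simp: x_def)
  have n: "ncomp D' = ncomp D" and comp: "\<And>k. k < 3 \<Longrightarrow> \<kappa> k < ncomp D"
    and pos: "\<And>k t. k < 3 \<Longrightarrow> t \<in> {-1..1} \<Longrightarrow> pos D (place \<kappa> \<alpha> r k t) = R3_before k t"
    using rep unfolding replaces_strands_def by blast+
  \<comment> \<open>The strands 0 and 1 meet at the origin both before and after the move; there the two
    parameter points are distinguished by the directions of the strands.\<close>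
  have cross01: "\<not> same_point (place \<kappa> \<alpha> r 0 0) (place \<kappa> \<alpha> r 1 0)"
  proof
    assume s: "same_point (place \<kappa> \<alpha> r 0 0) (place \<kappa> \<alpha> r 1 0)"
    have v: "r k *\<^sub>R velocity D (place \<kappa> \<alpha> r k 0) = Complex 1 (dg 1 k 0)" if "k < 3" for k
      by (rule strand_velocity[where f = "\<lambda>t. Complex t (g 1 k t)" and \<kappa>=\<kappa> and k=k, OF D comp[OF that]])
        (use pos[OF that] before dg has_vector_derivative_graph in auto)
    have "place \<kappa> \<alpha> r 0 0 \<in> points D" using comp[of 0] by (simp add: points_def place_def)
    from velocity_same_point[OF D this s] have "velocity D (place \<kappa> \<alpha> r 0 0) = velocity D (place \<kappa> \<alpha> r 1 0)" .
    then have "r 0 *\<^sub>R velocity D (place \<kappa> \<alpha> r 0 0) = Complex 1 (1/2)"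
      "r 1 *\<^sub>R velocity D (place \<kappa> \<alpha> r 0 0) = Complex 1 (- 1/2)"
      using v[of 0] v[of 1] by (simp_all add: dg_def)
    then have 1: "r 0 * Re (velocity D (place \<kappa> \<alpha> r 0 0)) = 1" "r 1 * Re (velocity D (place \<kappa> \<alpha> r 0 0)) = 1"
      and 2: "r 0 * Im (velocity D (place \<kappa> \<alpha> r 0 0)) = 1/2" "r 1 * Im (velocity D (place \<kappa> \<alpha> r 0 0)) = -1/2"
      by (simp_all add: complex_eq_iff)
    from 1 have "r 0 = r 1" by (metis mult_cancel_right mult_zero_right zero_neq_one)
    with 2 show False by simp
  qed
  interpret tangle_pair D D' 3 R3_before R3_after \<kappa> \<alpha> r
  proof (rule tangle_pair_intro[OF D D' rep])
    fix k :: nat and t :: real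
    assume t: "t \<in> {-1..1}"
    show "R3_before k t \<in> square" "R3_after k t \<in> square"
      using t bump_bounds[OF t] by (auto simp: R3_before_def R3_after_def square_def)
  next
    fix k l :: nat and s t :: real
    assume kl: "k < 3" "l < 3" and st: "s \<in> {-1..1}" "t \<in> {-1..1}"
      and sp: "same_point (place \<kappa> \<alpha> r k s) (place \<kappa> \<alpha> r l t)"
      and eq: "R3_before k s = R3_before l t" "R3_after k s = R3_after l t"
    have s: "s = t" "g 1 k t = g 1 l t" "g (-1) k t = g (-1) l t" using eq by (auto simp: before after)
    have "k = l"
    proof (rule ccontr)
      assume "k \<noteq> l"
      then have "t = x k l" "t = - x k l" using meet[OF kl _ st(2)] s by auto
      then have "x k l = 0" "t = 0" by auto
      then have "(k = 0 \<and> l = 1) \<or> (k = 1 \<and> l = 0)"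
        using \<tau> k3[OF kl(1)] k3[OF kl(2)] \<open>k \<noteq> l\<close> xs by (elim disjE) auto
      then show False using cross01 same_point_sym[OF sp] sp \<open>s = t\<close> \<open>t = 0\<close> by auto
    qed
    then show "k = l \<and> s = t" using s by simp
  next
    fix k l :: nat and s t :: real
    assume kl: "k < 3" "t \<in> {-1, 1}" "l < 3" and eq: "R3_before l s = R3_before k t"
    then show "l = k \<and> s = t" by (auto simp: R3_before_def split: if_splits)
  next
    fix k l :: nat and s t :: real
    assume kl: "k < 3" "t \<in> {-1, 1}" "l < 3" and eq: "R3_after l s = R3_after k t"
    then show "l = k \<and> s = t" by (auto simp: R3_after_def split: if_splits)
  qed
  interpret G: graph_tangle D 3 R3_before \<kappa> \<alpha> r "g 1" "dg 1" height
    by unfold_locales (use before dg lay in auto)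
  interpret G': graph_tangle D' 3 R3_after \<kappa> \<alpha> r "g (-1)" "dg (-1)" height
    by unfold_locales (use after dg lay in auto)
  obtain T M B :: nat where TMB: "T < 3" "M < 3" "B < 3" "T \<noteq> M" "T \<noteq> B" "M \<noteq> B"
    and heights: "height B < height M" "height M < height T"
  proof -
    have ne: "height 0 \<noteq> height 1" "height 0 \<noteq> height 2" "height 1 \<noteq> height 2"
      using G.height_eq[of 0 1] G.height_eq[of 0 2] G.height_eq[of 1 2] by auto
    then consider "height 0 < height 1" "height 1 < height 2" | "height 0 < height 2" "height 2 < height 1"
      | "height 1 < height 0" "height 0 < height 2" | "height 1 < height 2" "height 2 < height 0"
      | "height 2 < height 0" "height 0 < height 1" | "height 2 < height 1" "height 1 < height 0"
      by linarith
    then show thesis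
      by cases (rule that[of 2 1 0] that[of 1 2 0] that[of 2 0 1] that[of 0 2 1] that[of 1 0 2] that[of 0 1 2]; simp)+
  qed
  have perm: "T = 0 \<and> M = Suc 0 \<and> B = 2 \<or> T = 0 \<and> M = 2 \<and> B = Suc 0 \<or> T = Suc 0 \<and> M = 0 \<and> B = 2 \<or>
    T = Suc 0 \<and> M = 2 \<and> B = 0 \<or> T = 2 \<and> M = 0 \<and> B = Suc 0 \<or> T = 2 \<and> M = Suc 0 \<and> B = 0"
    using TMB by presburger
  have distinct: "x B T \<noteq> x B M" "x M T \<noteq> x B M"
    using perm \<tau>(1) by (elim disjE conjE; simp add: xs)+
  interpret R: R3_tangle D R3_before \<kappa> \<alpha> r "g 1" "dg 1" height x T M B
    by unfold_locales (use meet x_bound TMB heights distinct in auto)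
  interpret R': R3_tangle D' R3_after \<kappa> \<alpha> r "g (-1)" "dg (-1)" height "\<lambda>k l. - x k l" T M B
    by unfold_locales (use meet x_bound TMB heights distinct in auto)
  have \<tau>2: "0 < \<tau> * (1 - \<tau>\<^sup>2)" using \<tau> by (simp add: abs_square_less_1)
  \<comment> \<open>The slope of the moving strand is \<open>s\<close> times an odd function, and
    its meeting parameters change sign with \<open>s\<close>. So the slopes at the crossings, and
    with them the directions, stay the same.\<close>
  have e: "R'.e k l = R.e k l" if "k < 3" "l < 3" "k \<noteq> l" for k l
    unfolding R.e_def R'.e_def
    using \<tau>2 that(3) k3[OF that(1)] k3[OF that(2)]
    by (elim disjE) (simp_all add: xs dg_def)
  note es = e[OF TMB(2,1) TMB(4)[symmetric]] e[OF TMB(3,1) TMB(5)[symmetric]] e[OF TMB(3,2) TMB(6)[symmetric]]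
  \<comment> \<open>The move reverses the order of the crossings along the strands.\<close>
  have F: "(- x B M < - x B T) = (\<not> x B M < x B T)" "(- x M T < - x B M) = (\<not> x M T < x B M)"
    using distinct by auto
  \<comment> \<open>The triangle condition is checked for each of the six assignments of
    heights.\<close>
  have FG: "((x B M < x B T) \<longleftrightarrow> \<not> x M T < x B M) \<longleftrightarrow> (R.e B T \<longleftrightarrow> R.e M T)"
    unfolding R.e_def
    using perm \<tau>(1,2) \<tau>2
    by (elim disjE conjE) (simp_all add: xs dg_def)
  have sol: "T'.sol y \<longleftrightarrow> R3_system T M B (R.e M T) (R.e B T) (R.e B M) (\<not> x B M < x B T) (\<not> x M T < x B M) y"
    for y :: "'x segments"
    unfolding R'.sol_R3 es F ..
  have sw: "T'.strand_weight \<psi> n y' = T.strand_weight \<psi> n y"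
    if "\<And>k j. k \<noteq> B \<or> j \<noteq> 1 \<Longrightarrow> y' k j = y k j"
      and "R3_bottom_weight \<psi> n T M B (R.e B T) (R.e B M) (\<not> x B M < x B T) (\<not> x M T < x B M) y' =
        R3_bottom_weight \<psi> n T M B (R.e B T) (R.e B M) (x B M < x B T) (x M T < x B M) y"
    for n y and y' :: "'x segments"
    unfolding R.strand_weight_R3 R'.strand_weight_R3 es F that(2) using that(1) TMB by simp
  have ends: "same_ends y y'" if "\<And>k j. k \<noteq> B \<or> j \<noteq> 1 \<Longrightarrow> y' k j = y k j"
    for y y' :: "'x segments"
    unfolding same_ends_def R.three using that TMB
    by (auto simp: R.below_TMB R'.below_TMB)
  show ?thesis
  proof (rule heap_invariant_tangle_pair)
    fix y :: "'x segments" assume "T.sol y"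
    then have s: "R3_system T M B (R.e M T) (R.e B T) (R.e B M) (x B M < x B T) (x M T < x B M) y"
      by (simp only: R.sol_R3)
    obtain y' where y': "R3_system T M B (R.e M T) (R.e B T) (R.e B M) (\<not> x B M < x B T) (\<not> x M T < x B M) y'"
      "\<And>k j. k \<noteq> B \<or> j \<noteq> 1 \<Longrightarrow> y' k j = y k j"
      "\<And>n. R3_bottom_weight \<psi> n T M B (R.e B T) (R.e B M) (\<not> x B M < x B T) (\<not> x M T < x B M) y' =
        R3_bottom_weight \<psi> n T M B (R.e B T) (R.e B M) (x B M < x B T) (x M T < x B M) y"
      by (rule R3_system_move[OF s TMB(4-6) FG \<psi>]) (rule that)
    show "\<exists>y'. T'.sol y' \<and> same_ends y y' \<and> (\<forall>n. T'.strand_weight \<psi> n y' = T.strand_weight \<psi> n y)"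
    proof (intro exI conjI allI)
      show "T'.sol y'" using y'(1) by (simp only: sol)
      show "same_ends y y'" by (rule ends[OF y'(2)])
      show "T'.strand_weight \<psi> n y' = T.strand_weight \<psi> n y" for n by (rule sw[OF y'(2,3)])
    qed
  next
    fix y' :: "'x segments" assume "T'.sol y'"
    then have s: "R3_system T M B (R.e M T) (R.e B T) (R.e B M) (\<not> x B M < x B T) (\<not> x M T < x B M) y'"
      by (simp only: sol)
    \<comment> \<open>The condition is symmetric under negating both \<open>F\<close> and
      \<open>G\<close>, so the same lemma carries solutions back.\<close>
    have FG': "((\<not> x B M < x B T) \<longleftrightarrow> \<not> \<not> x M T < x B M) \<longleftrightarrow> (R.e B T \<longleftrightarrow> R.e M T)" using FG by auto
    obtain y where y0: "R3_system T M B (R.e M T) (R.e B T) (R.e B M) (\<not> \<not> x B M < x B T) (\<not> \<not> x M T < x B M) y"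
      "\<And>k j. k \<noteq> B \<or> j \<noteq> 1 \<Longrightarrow> y k j = y' k j"
      "\<And>n. R3_bottom_weight \<psi> n T M B (R.e B T) (R.e B M) (\<not> \<not> x B M < x B T) (\<not> \<not> x M T < x B M) y =
        R3_bottom_weight \<psi> n T M B (R.e B T) (R.e B M) (\<not> x B M < x B T) (\<not> x M T < x B M) y'"
      by (rule R3_system_move[OF s TMB(4-6) FG' \<psi>]) (rule that)
    note y = y0(1)[unfolded not_not] y0(2)[symmetric] y0(3)[unfolded not_not, symmetric]
    show "\<exists>y. T.sol y \<and> same_ends y y' \<and> (\<forall>n. T'.strand_weight \<psi> n y' = T.strand_weight \<psi> n y)"
    proof (intro exI conjI allI)
      show "T.sol y" using y(1) by (simp only: R.sol_R3)
      show "same_ends y y'" by (rule ends[OF y(2)])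
      show "T'.strand_weight \<psi> n y' = T.strand_weight \<psi> n y" for n by (rule sw[OF y(2,3)])
    qed
  next
    show "\<forall>k<3. \<forall>j \<le> card (T.U k). y1 k j = y2 k j"
      if "T.sol y1" "T.sol y2" "\<forall>k<3. y1 k 0 = y2 k 0 \<and> y1 k (card (T.U k)) = y2 k (card (T.U k))"
      for y1 y2 :: "'x segments"
      using R.sol_unique[OF that(1,2)] that(3) by simp
    show "\<forall>k<3. \<forall>j \<le> card (T'.U k). y1 k j = y2 k j"
      if "T'.sol y1" "T'.sol y2" "\<forall>k<3. y1 k 0 = y2 k 0 \<and> y1 k (card (T'.U k)) = y2 k (card (T'.U k))"
      for y1 y2 :: "'x segments"
      using R'.sol_unique[OF that(1,2)] that(3) by simp
  qed
qed

section \<open>The cancelation move\<close>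

lemma kink_bounds:
  assumes "t \<in> {-1..1}"
  shows "\<bar>Re (kink \<sigma> t)\<bar> \<le> \<bar>t\<bar>"
proof -
  have "\<bar>1 - 2 * bump t\<bar> \<le> 1" using bump_bounds[OF assms] by (auto simp: abs_le_iff)
  then have "\<bar>t\<bar> * \<bar>1 - 2 * bump t\<bar> \<le> \<bar>t\<bar> * 1" by (intro mult_left_mono) auto
  moreover have "Re (kink \<sigma> t) = t * (1 - 2 * bump t)" by (simp add: kink_def algebra_simps)
  ultimately show ?thesis by (simp add: abs_mult)
qed

lemma kink_ends [simp]: "kink \<sigma> (-1) = -1" "kink \<sigma> 1 = 1"
  by (simp_all add: kink_def complex_eq_iff)

lemma kink_Re_ends:
  assumes "t \<in> {-1..1}"
  shows "Re (kink \<sigma> t) \<ge> 1 \<Longrightarrow> t = 1" "Re (kink \<sigma> t) \<le> -1 \<Longrightarrow> t = -1"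
proof -
  have t: "t = 1 \<or> t = -1" if "\<bar>Re (kink \<sigma> t)\<bar> \<ge> 1"
    using kink_bounds[OF assms, of \<sigma>] that assms by (auto simp: abs_if split: if_splits)
  show "t = 1" if "Re (kink \<sigma> t) \<ge> 1" using t that by auto
  show "t = -1" if "Re (kink \<sigma> t) \<le> -1" using t that by auto
qed

text \<open>Equal imaginary parts force \<open>bump u = bump v\<close> and hence
  \<open>v = - u\<close>. The real part is odd, so it vanishes at a double point, and since
  \<open>u\<close> is nonzero the factor \<open>1 - 2 * bump u\<close> is zero.\<close>

lemma kink_eqD:
  assumes "kink \<sigma> u = kink \<sigma> v" "u \<noteq> v" "\<sigma> \<noteq> 0" "u \<in> {-1..1}" "v \<in> {-1..1}"
  shows "v = - u" "bump u = 1/2"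
proof -
  have b: "bump u = bump v" and re: "u * (1 - 2 * bump u) = v * (1 - 2 * bump v)"
    using assms(1,3) by (auto simp: kink_def complex_eq_iff algebra_simps)
  have "u\<^sup>2 \<le> 1" "v\<^sup>2 \<le> 1" using assms by (simp_all add: abs_le_iff abs_square_le_1)
  then have "1 - u\<^sup>2 = 1 - v\<^sup>2"
    by (intro power2_eq_imp_eq[OF b[unfolded bump_def]]) simp_all
  then have "u\<^sup>2 = v\<^sup>2" by simp
  then show v: "v = - u" using assms(2) by (auto simp: power2_eq_iff)
  have "u \<noteq> 0" using v assms(2) by auto
  moreover have "u * (1 - 2 * bump u) = - (u * (1 - 2 * bump u))"
    using re unfolding v bump_minus by simp
  then have "u * (1 - 2 * bump u) = 0" by linarith
  ultimately show "bump u = 1/2" by simp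
qed

lemma kink_double:
  assumes "bump u = 1/2"
  shows "kink \<sigma> (- u) = kink \<sigma> u"
  using assms by (simp add: kink_def)

lemma two_kinks_square:
  assumes "\<sigma> \<in> {-1, 1}" "\<sigma>' \<in> {-1, 1}" "t \<in> {-1..1}"
  shows "two_kinks \<sigma> \<sigma>' t \<in> square"
proof -
  have *: "\<bar>Re (kink \<sigma> u)\<bar> \<le> 1 \<and> \<bar>Im (kink \<sigma> u)\<bar> \<le> 1" if "\<sigma> \<in> {-1, 1}" "u \<in> {-1..1}" for \<sigma> u
    using kink_bounds[OF that(2), of \<sigma>] bump_bounds[OF that(2)] that by (auto simp: kink_def)
  show ?thesis
    using *[OF assms(1), of "2 * t + 1"] *[OF assms(2), of "2 * t - 1"] assms(3)
    by (auto simp: two_kinks_def square_def abs_le_iff)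
qed

text \<open>The two halves lie on different sides of the imaginary axis and touch it only at the
  common parameter 0, so a double point belongs to a single kink.\<close>

lemma two_kinks_eqD:
  assumes eq: "two_kinks \<sigma> \<sigma>' s = two_kinks \<sigma> \<sigma>' t" and st: "s < t" "s \<in> {-1..1}" "t \<in> {-1..1}"
    and \<sigma>: "\<sigma> \<noteq> 0" "\<sigma>' \<noteq> 0"
  shows "(t = -1 - s \<and> bump (2 * s + 1) = 1/2) \<or> (t = 1 - s \<and> bump (2 * s - 1) = 1/2)"
proof -
  consider "t \<le> 0" | "s \<le> 0" "0 < t" | "0 < s" by linarith
  then show ?thesis
  proof cases
    case 1
    then have "kink \<sigma> (2 * s + 1) = kink \<sigma> (2 * t + 1)" using eq st by (simp add: two_kinks_def)
    then show ?thesis using kink_eqD[of \<sigma> "2 * s + 1" "2 * t + 1"] 1 st \<sigma> by auto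
  next
    case 2
    have u: "2 * s + 1 \<in> {-1..1}" "2 * t - 1 \<in> {-1..1}" using 2 st by auto
    have "Re (-1/2 + kink \<sigma> (2 * s + 1) / 2) = Re (1/2 + kink \<sigma>' (2 * t - 1) / 2)"
      using eq 2 by (simp add: two_kinks_def)
    then have re: "Re (kink \<sigma> (2 * s + 1)) = 2 + Re (kink \<sigma>' (2 * t - 1))" by simp
    have "Re (kink \<sigma>' (2 * t - 1)) \<ge> -1" "Re (kink \<sigma> (2 * s + 1)) \<le> 1"
      using kink_bounds[OF u(1), of \<sigma>] kink_bounds[OF u(2), of \<sigma>'] u by auto
    then have "2 * t - 1 = -1" using re kink_Re_ends(2)[OF u(2), of \<sigma>'] by linarith
    then show ?thesis using 2 by simp
  next
    case 3
    then have "kink \<sigma>' (2 * s - 1) = kink \<sigma>' (2 * t - 1)" using eq st by (simp add: two_kinks_def)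
    then show ?thesis using kink_eqD[of \<sigma>' "2 * s - 1" "2 * t - 1"] 3 st \<sigma> by auto
  qed
qed

text \<open>Which of the two parameters passes under is not prescribed; \<open>p\<close> is the
  lower and \<open>p'\<close> the upper one.\<close>

lemma (in tangle) crossing_pair:
  assumes "k < m" "s \<in> {-1..1}" "t \<in> {-1..1}" "s \<noteq> t" "S k s = S k t"
  obtains p p' where "p \<in> U k" "p' \<notin> U k" "ov k p = (k, p')" "{p, p'} = {s, t}"
proof (cases "s \<in> U k")
  case True
  then show ?thesis
    using that[of s t] strand_crossing[of k k s t] strand_crossing(2)[of k k t s] assms ov_eqI[of k s k t] by auto
next
  case False
  then have "t \<in> U k" using strand_crossing(1)[of k k s t] assms by auto
  then show ?thesis
    using that[of t s] strand_crossing(2)[of k k s t] assms ov_eqI[of k t k s] False by auto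
qed

theorem heap_invariant_cancelation_move:
  fixes \<psi> :: "'x::{group_add,finite} \<Rightarrow> 'x \<Rightarrow> 'x \<Rightarrow> 'a::ab_group_add"
  assumes D: "link_diagram D" and D': "link_diagram D'" and R: "cancelation_move D D'"
    and \<psi>: "\<psi> \<in> Z2_SD"
  shows "heap_invariant \<psi> D' = heap_invariant \<psi> D"
proof -
  from R[unfolded cancelation_move_def]
  obtain \<kappa> \<alpha> r \<sigma> \<sigma>' where \<sigma>: "\<sigma> \<in> {-1, 1}" "\<sigma>' \<in> {-1, 1}"
    and rep: "replaces_strands D D' 1 (\<lambda>_ t. Complex t 0) (\<lambda>_. two_kinks \<sigma> \<sigma>') \<kappa> \<alpha> r"
    and opposite: "\<forall>\<tau> \<in> crossings D'. \<forall>\<tau>' \<in> crossings D'.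
      pos D' (fst \<tau>) \<in> square \<and> pos D' (fst \<tau>') \<in> square \<and> \<tau> \<noteq> \<tau>' \<longrightarrow>
      (positive_crossing D' \<tau> \<longleftrightarrow> \<not> positive_crossing D' \<tau>')"
    by (elim exE bexE conjE) (rule that)
  have \<sigma>0: "\<sigma> \<noteq> 0" "\<sigma>' \<noteq> 0" using \<sigma> by auto
  obtain \<tau> :: real where \<tau>: "0 < \<tau>" "\<tau> < 1" "\<And>t. t \<in> {-1..1} \<Longrightarrow> bump t = 1/2 \<longleftrightarrow> t = \<tau> \<or> t = - \<tau>"
    by (rule bump_half) blast
  \<comment> \<open>The double points of the left and the right kink, where the arguments
    \<open>2 * t + 1\<close> and \<open>2 * t - 1\<close> of \<open>kink\<close> are
    \<open>- \<tau>\<close> or \<open>\<tau>\<close>.\<close>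
  define a1 a2 b1 b2 where "a1 = (-1 - \<tau>) / 2" and "a2 = (-1 + \<tau>) / 2"
    and "b1 = (1 - \<tau>) / 2" and "b2 = (1 + \<tau>) / 2"
  have ab: "-1 < a1" "a1 < a2" "a2 < 0" "0 < b1" "b1 < b2" "b2 < 1" using \<tau>
    by (auto simp: a1_def a2_def b1_def b2_def)
  have double: "s = a1 \<and> t = a2 \<or> s = b1 \<and> t = b2"
    if "two_kinks \<sigma> \<sigma>' s = two_kinks \<sigma> \<sigma>' t" "s < t" "s \<in> {-1..1}" "t \<in> {-1..1}" for s t
    using two_kinks_eqD[OF that \<sigma>0]
  proof
    assume h: "t = -1 - s \<and> bump (2 * s + 1) = 1/2"
    then have "2 * s + 1 \<in> {-1..1}" using that by auto
    then have "2 * s + 1 = \<tau> \<or> 2 * s + 1 = - \<tau>" using \<tau>(3) h by blast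
    then show ?thesis using h that(2) \<tau> by (auto simp: a1_def a2_def)
  next
    assume h: "t = 1 - s \<and> bump (2 * s - 1) = 1/2"
    then have "2 * s - 1 \<in> {-1..1}" using that by auto
    then have "2 * s - 1 = \<tau> \<or> 2 * s - 1 = - \<tau>" using \<tau>(3) h by blast
    then show ?thesis using h that(2) \<tau> by (auto simp: b1_def b2_def)
  qed
  have args: "2 * a1 + 1 = - \<tau>" "2 * a2 + 1 = \<tau>" "2 * b1 - 1 = - \<tau>" "2 * b2 - 1 = \<tau>"
    by (simp_all add: a1_def a2_def b1_def b2_def field_simps)
  have "bump \<tau> = 1/2" using \<tau> by auto
  from kink_double[OF this]
  have meet: "two_kinks \<sigma> \<sigma>' a1 = two_kinks \<sigma> \<sigma>' a2" "two_kinks \<sigma> \<sigma>' b1 = two_kinks \<sigma> \<sigma>' b2"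
    using ab by (simp_all add: two_kinks_def args)
  interpret tangle_pair D D' 1 "\<lambda>_ t. Complex t 0" "\<lambda>_. two_kinks \<sigma> \<sigma>'" \<kappa> \<alpha> r
  proof (rule tangle_pair_intro[OF D D' rep])
    fix k :: nat and t :: real
    assume t: "t \<in> {-1..1}"
    show "Complex t 0 \<in> square" using t by (auto simp: square_def)
    show "two_kinks \<sigma> \<sigma>' t \<in> square" using two_kinks_square[OF \<sigma> t] .
  next
    fix k l :: nat and s t :: real
    assume "k < 1" "t \<in> {-1, 1}" "l < 1" "s \<in> {-1..1}" and eq: "two_kinks \<sigma> \<sigma>' s = two_kinks \<sigma> \<sigma>' t"
    then show "l = k \<and> s = t"
      using double[of s t] double[of t s] ab by (cases s t rule: linorder_cases) auto
  qed auto
  have U0: "T.U 0 = {}"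
  proof (rule equals0I)
    fix t assume t: "t \<in> T.U 0"
    show False using T.U_meets[OF _ t] T.ov(1)[OF _ t] by auto
  qed
  have abI: "a1 \<in> {-1..1}" "a2 \<in> {-1..1}" "b1 \<in> {-1..1}" "b2 \<in> {-1..1}" using ab by auto
  obtain p p' where p: "p \<in> T'.U 0" "p' \<notin> T'.U 0" "T'.ov 0 p = (0, p')" "{p, p'} = {a1, a2}"
    by (rule T'.crossing_pair[of 0 a1 a2]) (use abI ab meet in auto)
  obtain q q' where q: "q \<in> T'.U 0" "q' \<notin> T'.U 0" "T'.ov 0 q = (0, q')" "{q, q'} = {b1, b2}"
    by (rule T'.crossing_pair[of 0 b1 b2]) (use abI ab meet in auto)
  have pq: "-1 < p" "p < 0" "-1 < p'" "p' < 0" "0 < q" "q < 1" "0 < q'" "q' < 1"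
    using p(4) q(4) ab by (auto simp: doubleton_eq_iff)
  have U: "T'.U 0 = {p, q}"
  proof (intro equalityI subsetI)
    fix t assume t: "t \<in> T'.U 0"
    define s where "s = snd (T'.ov 0 t)"
    have "s \<in> {-1..1}" "t \<in> {-1..1}" "two_kinks \<sigma> \<sigma>' s = two_kinks \<sigma> \<sigma>' t" "s \<noteq> t"
      using T'.ov[OF _ t] T'.U_meets[OF _ t] t by (auto simp: s_def T'.U_def)
    then have "t \<in> {a1, a2} \<union> {b1, b2}"
      using double[of s t] double[of t s] by (cases s t rule: linorder_cases) auto
    then have "t \<in> {p, p'} \<union> {q, q'}" using p(4) q(4) by simp
    then show "t \<in> {p, q}" using t p(2) q(2) by auto
  qed (use p q in auto)
  define e where "e = T'.rl 0 p"
  have rp: "T'.rl 0 p = e" by (simp add: e_def)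
  \<comment> \<open>The two passages have opposite directions because the crossings have opposite
    signs and lie on the same strand. The hypothesis \<open>opposite\<close> speaks of normalized
    crossings, hence the detour through \<open>normal_point\<close>.\<close>
  have rq: "T'.rl 0 q = (\<not> e)"
  proof -
    let ?pl = "place \<kappa> \<alpha> r 0"
    have cross: "crosses D' (?pl p') (?pl p)" "crosses D' (?pl q') (?pl q)"
      using T'.ov(3)[of 0 p] T'.ov(3)[of 0 q] p q by auto
    have in_cr: "(normal_point s, normal_point t) \<in> crossings D' \<and>
        positive_crossing D' (normal_point s, normal_point t) = positive_crossing D' (s, t) \<and>
        pos D' (normal_point s) = pos D' s" if c: "crosses D' s t" for s t
    proof -
      have "crosses D' (normal_point s) (normal_point t)"
        by (rule crosses_same_point[OF D' c]) simp_all
      then have "(normal_point s, normal_point t) \<in> crossings D'"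
        using snd_normal_point[of s] snd_normal_point[of t] underpts_points[OF D', of "normal_point t"]
        by (auto simp: crosses_def crossings_def simp del: snd_normal_point)
      then show ?thesis
        using positive_crossing_same_point[OF D' _ _ same_point_normal(1) same_point_normal(1), of s t]
          pos_same_point[OF D' _ same_point_normal(1), of s] c underpts_points[OF D', of t]
        by (simp add: crosses_def)
    qed
    have ps: "pos D' (?pl p') \<in> square" "pos D' (?pl q') \<in> square"
      using T'.pos[of 0] T'.S[of 0] pq by auto
    have "normal_point (?pl p) \<noteq> normal_point (?pl q)"
    proof
      assume "normal_point (?pl p) = normal_point (?pl q)"
      then have "same_point (?pl p) (?pl q)" by (metis same_point_normal same_point_trans)
      then show False using T'.overlap[of 0 0 p q] pq by auto
    qed
    then have "positive_crossing D' (?pl p', ?pl p) \<longleftrightarrow> \<not> positive_crossing D' (?pl q', ?pl q)"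
      using opposite[rule_format, of "(normal_point (?pl p'), normal_point (?pl p))" "(normal_point (?pl q'), normal_point (?pl q))"]
        in_cr[OF cross(1)] in_cr[OF cross(2)] ps by auto
    then show ?thesis unfolding e_def T'.rl_def p(3) q(3) fst_conv snd_conv by blast
  qed
  have bel: "below (T'.U 0) p = 0" "below (T'.U 0) q = 1" "card (T'.U 0) = 2"
    "below (T'.U 0) p' = (if p < p' then 1 else 0)" "below (T'.U 0) q' = (if q < q' then 2 else 1)"
    using pq by (auto simp: U below_insert)
  \<comment> \<open>If the strand first passes under, the over-passage belongs to the piece behind
    the crossing, otherwise to the piece in front of it.\<close>
  have oc: "T'.over_color y 0 p = (if p < p' then y 0 1 else y 0 0)"
    "T'.over_color y 0 q = (if q < q' then y 0 2 else y 0 1)" for y :: "'x segments"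
    unfolding T'.over_color_def p(3) q(3) by (simp_all add: bel)
  have "p \<noteq> q" using pq by auto
  have sol0: "T'.sol y \<longleftrightarrow> y 0 1 = slide e (if p < p' then y 0 1 else y 0 0) (y 0 0) \<and>
      y 0 2 = slide (\<not> e) (if q < q' then y 0 2 else y 0 1) (y 0 1)" for y :: "'x segments"
  proof -
    have "T'.sol y \<longleftrightarrow>
        y 0 (Suc (below (T'.U 0) p)) = slide (T'.rl 0 p) (T'.over_color y 0 p) (y 0 (below (T'.U 0) p)) \<and>
        y 0 (Suc (below (T'.U 0) q)) = slide (T'.rl 0 q) (T'.over_color y 0 q) (y 0 (below (T'.U 0) q))"
      unfolding T'.sol_def by (auto simp: U)
    then show ?thesis unfolding bel oc rp rq One_nat_def[symmetric] Suc_1 .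
  qed
  have sol: "T'.sol y \<longleftrightarrow> y 0 1 = kinked e (y 0 0) \<and> y 0 2 = y 0 0" for y :: "'x segments"
  proof -
    \<comment> \<open>The over-color is either the incoming color or the unknown outgoing one; both
      equations have the same solution.\<close>
    have step: "z = slide f (if P then z else w) w \<longleftrightarrow> z = kinked f w" for z w :: "'x \<times> 'x" and f P
      using eq_slide_self[of z f w] by (auto simp: kinked_def[symmetric])
    show ?thesis unfolding sol0 step using kinked_inverse[of e "y 0 0"] by auto
  qed
  have sw: "T'.strand_weight \<psi> n y = 0" if "T'.sol y" for y :: "'x segments" and n
  proof -
    have s: "y 0 1 = kinked e (y 0 0) \<and> y 0 2 = y 0 0" using that unfolding sol .
    then have y1: "y 0 1 = kinked e (y 0 0)" and y2: "y 0 2 = kinked (\<not> e) (y 0 1)"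
      by (simp_all only: kinked_inverse)
    \<comment> \<open>Each weight may be computed as if the over-passage carried the incoming
      color.\<close>
    have "pass_weight \<psi> e n (T'.over_color y 0 p) (y 0 0) = pass_weight \<psi> e n (y 0 0) (y 0 0)"
      using pass_weight_kinked[OF \<psi>, of e n "y 0 0"] unfolding oc y1 by simp
    moreover have "pass_weight \<psi> (\<not> e) n (T'.over_color y 0 q) (y 0 1) = pass_weight \<psi> (\<not> e) n (y 0 1) (y 0 1)"
      using pass_weight_kinked[OF \<psi>, of "\<not> e" n "y 0 1"] unfolding oc y2 by simp
    moreover have "pass_weight \<psi> e n (y 0 0) (y 0 0) + pass_weight \<psi> (\<not> e) n (y 0 1) (y 0 1) = 0"
      unfolding y1 by (rule pass_weight_kinks_cancel[OF \<psi>])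
    ultimately have z: "pass_weight \<psi> (T'.rl 0 p) n (T'.over_color y 0 p) (y 0 (below (T'.U 0) p)) +
      pass_weight \<psi> (T'.rl 0 q) n (T'.over_color y 0 q) (y 0 (below (T'.U 0) q)) = 0"
      by (simp only: rp rq bel)
    have s2: "(\<Sum>t \<in> T'.U 0. f t) = f p + f q" for f :: "real \<Rightarrow> 'a" using \<open>p \<noteq> q\<close> by (simp add: U)
    have s1: "(\<Sum>k<1. f k) = f 0" for f :: "nat \<Rightarrow> 'a" by simp
    have neg: "- A + - B = 0" if "A + B = 0" for A B :: 'a
      using that by (metis add.inverse_neutral minus_add_distrib)
    show ?thesis
      unfolding T'.strand_weight_def s1 s2 Let_def using z neg[OF z] by (cases "r 0 > 0") simp_all
  qed
  have one: "k < 1 \<longleftrightarrow> k = 0" for k :: nat by auto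
  show ?thesis
  proof (rule heap_invariant_crossingless, unfold one)
    show "T.U k = {}" if "k = 0" for k using U0 that by simp
    fix x :: "nat \<Rightarrow> 'x \<times> 'x"
    \<comment> \<open>The piece between the two crossings carries the kinked color; the second kink
      undoes it.\<close>
    define y where "y k j = (if j = 1 then kinked e (x 0) else x 0)" for k j :: nat
    have "T'.sol y" unfolding sol by (simp add: y_def)
    then show "\<exists>y. T'.sol y \<and> (\<forall>k. k = 0 \<longrightarrow> y k 0 = x k)" by (auto simp: y_def)
  next
    fix y :: "'x segments" and k :: nat
    assume "T'.sol y" "k = (0::nat)"
    then show "y k (card (T'.U k)) = y k 0" using bel(3) unfolding sol by simp
  next
    fix y1 y2 :: "'x segments"
    assume s: "T'.sol y1" "T'.sol y2"
      and eq: "\<forall>k. k = 0 \<longrightarrow> y1 k 0 = y2 k 0 \<and> y1 k (card (T'.U k)) = y2 k (card (T'.U k))"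
    have "y1 0 j = y2 0 j" if "j \<le> 2" for j
    proof -
      have "j = 0 \<or> j = 1 \<or> j = 2" using that by linarith
      then show ?thesis using s[unfolded sol] eq by (elim disjE) simp_all
    qed
    then show "\<forall>k. k = 0 \<longrightarrow> (\<forall>j \<le> card (T'.U k). y1 k j = y2 k j)" using bel(3) by simp
  qed (fact sw)
qed

section \<open>Invariance\<close>

lemma heap_invariant_framed_move:
  fixes \<psi> :: "'x::{group_add,finite} \<Rightarrow> 'x \<Rightarrow> 'x \<Rightarrow> 'a::ab_group_add"
  assumes "\<psi> \<in> Z2_SD" "framed_move D D'"
  shows "heap_invariant \<psi> D = heap_invariant \<psi> D'"
  using assms heap_invariant_planar_isotopic[of D D' \<psi>] heap_invariant_Reidemeister_II[of D D' \<psi>]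
    heap_invariant_Reidemeister_III[of D D' \<psi>] heap_invariant_cancelation_move[of D D' \<psi>]
  unfolding framed_move_def by auto

theorem theorem5p8:
  fixes \<psi> :: "'x::{group_add,finite} \<Rightarrow> 'x \<Rightarrow> 'x \<Rightarrow> 'a::ab_group_add"
  assumes "\<psi> \<in> Z2_SD"
  shows "(\<forall>D D'. same_framed_link D D' \<longrightarrow> heap_invariant \<psi> D = heap_invariant \<psi> D') \<and>
         (\<psi> \<in> B2_SD \<longrightarrow>
            (\<forall>D. link_diagram D \<longrightarrow> (\<exists>n::int. heap_invariant \<psi> D = Poly_Mapping.single (0, 0) n))) \<and>
         (\<forall>\<phi> \<in> Z2_SD. cohomology_class \<phi> = cohomology_class \<psi> \<longrightarrow>
            (\<forall>D. link_diagram D \<longrightarrow> heap_invariant \<phi> D = heap_invariant \<psi> D))"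
proof (intro conjI allI impI ballI)
  fix D D' assume "same_framed_link D D'"
  then have "equivclp framed_move D D'" by (simp add: same_framed_link_def)
  then show "heap_invariant \<psi> D = heap_invariant \<psi> D'"
    by (induction rule: equivclp_induct) (use heap_invariant_framed_move[OF assms] in auto)
next
  fix D assume "\<psi> \<in> B2_SD" "link_diagram D"
  then show "\<exists>n::int. heap_invariant \<psi> D = Poly_Mapping.single (0, 0) n"
    by (rule heap_invariant_coboundary)
next
  fix \<phi> :: "'x \<Rightarrow> 'x \<Rightarrow> 'x \<Rightarrow> 'a" and D
  assume "\<phi> \<in> Z2_SD" "cohomology_class \<phi> = cohomology_class \<psi>" "link_diagram D"
  then show "heap_invariant \<phi> D = heap_invariant \<psi> D"
    using heap_invariant_cohomologous cohomology_class_eqD assms by blast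
qed

end
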